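(* Consider the one-sector stochastic optimal growth model described in the context, with policy function $k_{t+1}=g(k_t,z_t)$, and let $k',k''$ be as defined there. Assume that a degenerate stationary equilibrium at $k>0$ does not exist, i.e. there is no $k>0$ with $g(k,z)=k$ for all $z\in\widehat{\mathcal{Z}}$. Then, for any initial value $k_0>0$, the distributions of $k_t$ converge in the uniform metric, as $t\to\infty$, to a unique non-degenerate stationary distribution $\pi$ (the same for all $k_0>0$), with support in $[k',k'']$.
   Context: Model. Consumption $c_t$ and capital $k_t$ are chosen to maximize $\mathbf{E}\sum_{t=0}^\infty\beta^t u(c_t)$ subject to $f(k_t,z_t)\ge c_t+k_{t+1}$, $c_t\ge 0$ (and $k_{t+1}\ge 0$), where $\beta\in(0,1)$. The productivity shock $z_t$ takes values in a finite set $\widehat{\mathcal{Z}}=\{z^1,\ldots,z^n\}$, $n\ge 2$, and is a time-homogeneous Markov chain with transition probabilities $p(z,z^+)=\mathbf{P}(z_{t+1}=z^+\mid z_t=z)>0$ for all $z,z^+\in\widehat{\mathcal{Z}}$. The utility function $u:\mathbb{R}_+\to\mathbb{R}\cup\{-\infty\}$ is continuous, strictly increasing and strictly concave on $\mathbb{R}_+$ (on $\mathbb{R}_{++}$ if $u(0)=-\infty$), with $\lim_{c\downarrow 0}u(c)=u(0)$; it is twice continuously differentiable for $c>0$ and $\lim_{c\downarrow 0}u'(c)=\infty$. The production function $f:\mathbb{R}_+\times\widehat{\mathcal{Z}}\to\mathbb{R}_+$ is continuously differentiable, strictly increasing and strictly concave in $k$, with $\lim_{k\downarrow 0}f_k(k,z)=\infty$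 and $f(0,z)=0$ for all $z\in\widehat{\mathcal{Z}}$ ($f_k=\partial f/\partial k$), and there is $k^{\max}>0$ with $f(k,z)<k$ for all $k>k^{\max}$ and all $z\in\widehat{\mathcal{Z}}$. Initial conditions $k_0>0$ and $z_0\in\widehat{\mathcal{Z}}$ are given. The value function satisfies $v(k,z)=\max_{0\le k^+\le f(k,z)}u(f(k,z)-k^+)+\beta\mathbf{E}[v(k^+,z^+)\mid z]$. The optimal policy function is $k_{t+1}=g(k_t,z_t)$, and $c(k,z):=f(k,z)-g(k,z)$. It is standard that $c(k,z)$ and $g(k,z)$ are continuous and increasing in $k$, and that $v(k,z)$ is increasing, strictly concave and differentiable in $k$ for $k>0$. Envelopes: $\bar g(k):=\max_z g(k,z)$, $\underline{g}(k):=\min_z g(k,z)$. Define $k'':=\inf\{k>0:\bar g(k)\le k\}$ and $k':=\sup\{0<k\le k'':\underline{g}(k)=k\}$. Uniform metric between distributions on the real line with distribution functions $F,G$: $d(F,G)=\sup_x|F(x)-G(x)|$. "Unique stationary distribution" means a unique limiting distribution for any initial value of the process. *)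

theory Defs
  imports "HOL-Probability.Probability"
begin

definition strictly_concave_on :: "real set \<Rightarrow> (real \<Rightarrow> real) \<Rightarrow> bool" where
  "strictly_concave_on S h \<longleftrightarrow> convex S \<and>
     (\<forall>x\<in>S. \<forall>y\<in>S. \<forall>a\<in>{0<..<1}. x \<noteq> y \<longrightarrow>
        a * h x + (1 - a) * h y < h (a * x + (1 - a) * y))"

text \<open>
  The transition probability from \<open>z\<close> to \<open>z'\<close> is \<open>pmf (p z) z'\<close>; \<open>set_pmf (p z) = Z\<close> says
  that the chain lives on \<open>Z\<close> and that all transition probabilities within \<open>Z\<close> are positive.
  Utility is extended-real valued because \<open>u 0 = -\<infinity>\<close> is allowed; continuity of \<open>u\<close> is meant
  in the topology of the extended reals. Functions of capital and consumption are only
  constrained on nonnegative arguments.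
\<close>

locale growth_model =
  fixes \<beta> :: real
    and Z :: "'z set"
    and p :: "'z \<Rightarrow> 'z pmf"
    and u :: "real \<Rightarrow> ereal"
    and f :: "real \<Rightarrow> 'z \<Rightarrow> real"
  assumes discount: "0 < \<beta>" "\<beta> < 1"
    and shocks: "finite Z" "card Z \<ge> 2"
    and transition: "\<And>z. z \<in> Z \<Longrightarrow> set_pmf (p z) = Z"
    and u_finite: "\<And>c. c > 0 \<Longrightarrow> \<bar>u c\<bar> \<noteq> \<infinity>"
    and u_zero: "u 0 \<noteq> \<infinity>"
    and u_continuous: "continuous_on {0..} u"
    and u_limit: "(u \<longlongrightarrow> u 0) (at_right 0)"
    and u_increasing:
      "strict_mono_on (if u 0 = -\<infinity> then {0<..} else {0..}) (\<lambda>c. real_of_ereal (u c))"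
    and u_concave:
      "strictly_concave_on (if u 0 = -\<infinity> then {0<..} else {0..}) (\<lambda>c. real_of_ereal (u c))"
    and u_differentiable:
      "\<And>c. c > 0 \<Longrightarrow> (\<lambda>c. real_of_ereal (u c)) field_differentiable at c"
    and u_twice_differentiable:
      "\<And>c. c > 0 \<Longrightarrow> deriv (\<lambda>c. real_of_ereal (u c)) field_differentiable at c"
    and u_C2: "continuous_on {0<..} (deriv (deriv (\<lambda>c. real_of_ereal (u c))))"
    and u_Inada: "filterlim (deriv (\<lambda>c. real_of_ereal (u c))) at_top (at_right 0)"
    and f_nonneg: "\<And>k z. k \<ge> 0 \<Longrightarrow> z \<in> Z \<Longrightarrow> f k z \<ge> 0"
    and f_continuous: "\<And>z. z \<in> Z \<Longrightarrow> continuous_on {0..} (\<lambda>k. f k z)"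
    and f_differentiable:
      "\<And>k z. k > 0 \<Longrightarrow> z \<in> Z \<Longrightarrow> (\<lambda>k. f k z) field_differentiable at k"
    and f_C1: "\<And>z. z \<in> Z \<Longrightarrow> continuous_on {0<..} (deriv (\<lambda>k. f k z))"
    and f_increasing: "\<And>z. z \<in> Z \<Longrightarrow> strict_mono_on {0..} (\<lambda>k. f k z)"
    and f_concave: "\<And>z. z \<in> Z \<Longrightarrow> strictly_concave_on {0..} (\<lambda>k. f k z)"
    and f_Inada: "\<And>z. z \<in> Z \<Longrightarrow> filterlim (deriv (\<lambda>k. f k z)) at_top (at_right 0)"
    and f_zero: "\<And>z. z \<in> Z \<Longrightarrow> f 0 z = 0"
    and k_max: "\<exists>kmax>0. \<forall>k>kmax. \<forall>z\<in>Z. f k z < k"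

text \<open>
  Law of the shock history \<open>[z\<^sub>t, \<dots>, z\<^sub>0]\<close>, most recent shock first.
\<close>

primrec shock_history :: "('z \<Rightarrow> 'z pmf) \<Rightarrow> 'z \<Rightarrow> nat \<Rightarrow> 'z list pmf" where
  "shock_history p z0 0 = return_pmf [z0]"
| "shock_history p z0 (Suc t) =
     bind_pmf (shock_history p z0 t) (\<lambda>h. map_pmf (\<lambda>z. z # h) (p (hd h)))"

text \<open>
  Library integrals of signed functions are not extended-real valued; all distributions to which
  this is applied have finite support and the integrands never take the value \<open>\<infinity>\<close>.
\<close>

definition expect_pmf :: "'a pmf \<Rightarrow> ('a \<Rightarrow> ereal) \<Rightarrow> ereal" where
  "expect_pmf q X = (\<Sum>x\<in>set_pmf q. ereal (pmf q x) * X x)"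

text \<open>
  A plan \<open>\<kappa>\<close> maps the history \<open>[z\<^sub>t, \<dots>, z\<^sub>0]\<close> to the capital \<open>k\<^bsub>t+1\<^esub>\<close> chosen after it has been
  observed, and the empty history to \<open>k\<^sub>0\<close>. At a history \<open>h\<close> of length \<open>t + 1\<close> the current
  capital \<open>k\<^sub>t\<close> is therefore \<open>\<kappa> (tl h)\<close> and the current shock \<open>z\<^sub>t\<close> is \<open>hd h\<close>.
\<close>

definition feasible_plans ::
  "('z \<Rightarrow> 'z pmf) \<Rightarrow> (real \<Rightarrow> 'z \<Rightarrow> real) \<Rightarrow> real \<Rightarrow> 'z \<Rightarrow> ('z list \<Rightarrow> real) set" where
  "feasible_plans p f k0 z0 =
     {\<kappa>. \<kappa> [] = k0 \<and>
        (\<forall>t. \<forall>h\<in>set_pmf (shock_history p z0 t). 0 \<le> \<kappa> h \<and> \<kappa> h \<le> f (\<kappa> (tl h)) (hd h))}"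

definition consumption :: "(real \<Rightarrow> 'z \<Rightarrow> real) \<Rightarrow> ('z list \<Rightarrow> real) \<Rightarrow> 'z list \<Rightarrow> real" where
  "consumption f \<kappa> h = f (\<kappa> (tl h)) (hd h) - \<kappa> h"

text \<open>
  Expectation and sum are interchanged: under a feasible plan of a \<open>growth_model\<close>, consumption is
  bounded, hence the terms are bounded above by a summable sequence, the series converges
  in \<open>[-\<infinity>, \<infinity>)\<close>, and monotone convergence applies.
\<close>

definition lifetime_utility ::
  "real \<Rightarrow> ('z \<Rightarrow> 'z pmf) \<Rightarrow> (real \<Rightarrow> ereal) \<Rightarrow> (real \<Rightarrow> 'z \<Rightarrow> real) \<Rightarrow> 'z \<Rightarrow> ('z list \<Rightarrow> real) \<Rightarrow> ereal"
where
  "lifetime_utility \<beta> p u f z0 \<kappa> =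
     (\<Sum>t. ereal (\<beta> ^ t) * expect_pmf (shock_history p z0 t) (\<lambda>h. u (consumption f \<kappa> h)))"

definition value_fun ::
  "real \<Rightarrow> ('z \<Rightarrow> 'z pmf) \<Rightarrow> (real \<Rightarrow> ereal) \<Rightarrow> (real \<Rightarrow> 'z \<Rightarrow> real) \<Rightarrow> real \<Rightarrow> 'z \<Rightarrow> ereal" where
  "value_fun \<beta> p u f k z = (SUP \<kappa>\<in>feasible_plans p f k z. lifetime_utility \<beta> p u f z \<kappa>)"

definition bellman_objective ::
  "real \<Rightarrow> ('z \<Rightarrow> 'z pmf) \<Rightarrow> (real \<Rightarrow> ereal) \<Rightarrow> (real \<Rightarrow> 'z \<Rightarrow> real) \<Rightarrow> real \<Rightarrow> 'z \<Rightarrow> real \<Rightarrow> ereal" where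
  "bellman_objective \<beta> p u f k z k' =
     u (f k z - k') + ereal \<beta> * expect_pmf (p z) (\<lambda>z'. value_fun \<beta> p u f k' z')"

definition optimal_policy ::
  "real \<Rightarrow> 'z set \<Rightarrow> ('z \<Rightarrow> 'z pmf) \<Rightarrow> (real \<Rightarrow> ereal) \<Rightarrow> (real \<Rightarrow> 'z \<Rightarrow> real) \<Rightarrow>
   (real \<Rightarrow> 'z \<Rightarrow> real) \<Rightarrow> bool" where
  "optimal_policy \<beta> Z p u f g \<longleftrightarrow>
     (\<forall>k\<ge>0. \<forall>z\<in>Z. g k z \<in> {0..f k z} \<and>
        value_fun \<beta> p u f k z = bellman_objective \<beta> p u f k z (g k z) \<and>
        (\<forall>k'\<in>{0..f k z}. bellman_objective \<beta> p u f k z k' \<le> value_fun \<beta> p u f k z))"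

definition upper_envelope :: "'z set \<Rightarrow> (real \<Rightarrow> 'z \<Rightarrow> real) \<Rightarrow> real \<Rightarrow> real" where
  "upper_envelope Z g k = Max (g k ` Z)"

definition lower_envelope :: "'z set \<Rightarrow> (real \<Rightarrow> 'z \<Rightarrow> real) \<Rightarrow> real \<Rightarrow> real" where
  "lower_envelope Z g k = Min (g k ` Z)"

text \<open>The points \<open>k''\<close> (\<open>k_upper\<close>) and \<open>k'\<close> (\<open>k_lower\<close>).\<close>

definition k_upper :: "'z set \<Rightarrow> (real \<Rightarrow> 'z \<Rightarrow> real) \<Rightarrow> real" where
  "k_upper Z g = Inf {k. 0 < k \<and> upper_envelope Z g k \<le> k}"

definition k_lower :: "'z set \<Rightarrow> (real \<Rightarrow> 'z \<Rightarrow> real) \<Rightarrow> real" where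
  "k_lower Z g = Sup {k. 0 < k \<and> k \<le> k_upper Z g \<and> lower_envelope Z g k = k}"

primrec policy_plan :: "(real \<Rightarrow> 'z \<Rightarrow> real) \<Rightarrow> real \<Rightarrow> 'z list \<Rightarrow> real" where
  "policy_plan g k0 [] = k0"
| "policy_plan g k0 (z # h) = g (policy_plan g k0 h) z"

definition capital_distribution ::
  "('z \<Rightarrow> 'z pmf) \<Rightarrow> (real \<Rightarrow> 'z \<Rightarrow> real) \<Rightarrow> real \<Rightarrow> 'z \<Rightarrow> nat \<Rightarrow> real pmf" where
  "capital_distribution p g k0 z0 t =
     map_pmf (\<lambda>h. policy_plan g k0 (tl h)) (shock_history p z0 t)"

definition uniform_metric :: "real measure \<Rightarrow> real measure \<Rightarrow> real" where
  "uniform_metric M N = (SUP x. \<bar>cdf M x - cdf N x\<bar>)"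

definition limiting_distribution ::
  "('z \<Rightarrow> 'z pmf) \<Rightarrow> (real \<Rightarrow> 'z \<Rightarrow> real) \<Rightarrow> real \<Rightarrow> 'z \<Rightarrow> real measure \<Rightarrow> bool" where
  "limiting_distribution p g k0 z0 \<pi> \<longleftrightarrow> real_distribution \<pi> \<and>
     (\<lambda>t. uniform_metric (measure_pmf (capital_distribution p g k0 z0 t)) \<pi>) \<longlonglongrightarrow> 0"

text \<open>
  Capital alone is not a Markov process, the pair \<open>(k\<^sub>t, z\<^sub>t)\<close> is. A distribution of capital is
  stationary if it is the capital marginal of an invariant distribution of this pair on the
  state space of positive capital stocks; the trivial rest point \<open>k = 0\<close> is excluded.
\<close>

definition invariant_state_distribution ::
  "'z set \<Rightarrow> ('z \<Rightarrow> 'z pmf) \<Rightarrow> (real \<Rightarrow> 'z \<Rightarrow> real) \<Rightarrow> (real \<times> 'z) measure \<Rightarrow> bool" where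
  "invariant_state_distribution Z p g \<mu> \<longleftrightarrow> prob_space \<mu> \<and>
     sets \<mu> = sets (restrict_space borel {0<..} \<Otimes>\<^sub>M count_space Z) \<and>
     (\<forall>A\<in>sets borel. A \<subseteq> {0<..} \<longrightarrow> (\<forall>z'\<in>Z.
        measure \<mu> (A \<times> {z'}) = (\<integral>(k, z). indicator A (g k z) * pmf (p z) z' \<partial>\<mu>)))"

definition stationary_distribution ::
  "'z set \<Rightarrow> ('z \<Rightarrow> 'z pmf) \<Rightarrow> (real \<Rightarrow> 'z \<Rightarrow> real) \<Rightarrow> real measure \<Rightarrow> bool" where
  "stationary_distribution Z p g \<pi> \<longleftrightarrow>
     (\<exists>\<mu>. invariant_state_distribution Z p g \<mu> \<and> \<pi> = distr \<mu> borel fst)"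

definition degenerate_distribution :: "real measure \<Rightarrow> bool" where
  "degenerate_distribution \<pi> \<longleftrightarrow> (\<exists>x. \<pi> = return borel x)"

definition measure_support :: "real measure \<Rightarrow> real set" where
  "measure_support \<pi> = {x. \<forall>U. open U \<and> x \<in> U \<longrightarrow> measure \<pi> U > 0}"

end

theory Submission
  imports Defs
begin

text \<open>
  The optimal policy satisfies an Euler equation, and three facts follow from it: saving and
  consumption both increase with capital (and are continuous in it, since their sum, output, is);
  near zero capital always grows; and, the decisive one, it cannot happen that
  capital weakly falls under every shock at some \<open>k\<close> and weakly rises under every shock at some
  \<open>k' > k\<close> (lemma \<open>no_crossing\<close>). The last fact is a Perron--Frobenius comparison: marginal
  utilities at \<open>k\<close> form a positive super-solution, those at \<open>k'\<close> a positive sub-solution, of the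
  linear systems \<open>x = \<beta> P diag(f\<^sub>k) x\<close>, whose matrix is strictly smaller at \<open>k'\<close> since \<open>f\<close> is
  strictly concave.

  Consequently every positive stock below \<open>k''\<close> can rise and every stock above \<open>k'\<close> can fall, where
  \<open>k' < k''\<close> as there is no degenerate equilibrium (lemma \<open>growth_model_mixing\<close>). Everything
  afterwards uses only these properties, collected in the locale \<open>mixing_policy\<close>. On a compact
  interval that the policy maps into itself and that contains \<open>[k', k'']\<close>, fix a level strictly
  between \<open>k'\<close> and \<open>k''\<close>. Some finite word of shocks lifts the whole interval above that level and
  another word of the same length pushes the whole interval below it; as all transition
  probabilities are positive, either word occurs with probability bounded away from zero, whatever
  the initial shock, and can be followed by one fixed shock. For a function \<open>h\<close> of the state that
  decreases in capital, these two events shrink the oscillation of its expected future value by a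
  factor \<open>1 - e\<close> independent of \<open>h\<close> (lemma \<open>oscillation_contracts\<close>). Applied to the indicators of
  \<open>{k \<le> x, z = \<zeta>}\<close>, this yields convergence of the joint distribution functions, uniformly in \<open>x\<close>
  and irrespective of the initial state.

  The limits are distribution functions and define a measure on states. It is invariant because the
  states that the monotone continuous policy sends below \<open>x\<close> again form a lower interval, on which
  the convergence is already known. Any invariant measure has the same distribution function, since
  integrating the \<open>t\<close>-step probabilities against it changes nothing while they converge to a
  constant.
\<close>

section \<open>Concave functions\<close>

lemma strictly_concave_on_imp_convex_on:
  assumes "strictly_concave_on S h"
  shows "convex_on S (\<lambda>x. - h x)"
proof (rule convex_onI)
  show "convex S" using assms by (simp add: strictly_concave_on_def)
  fix t x y :: real assume *: "0 < t" "t < 1" "x \<in> S" "y \<in> S"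
  show "- h ((1 - t) *\<^sub>R x + t *\<^sub>R y) \<le> (1 - t) * - h x + t * - h y"
  proof (cases "x = y")
    case False
    then have "t * h y + (1 - t) * h x < h (t * y + (1 - t) * x)"
      using assms * by (auto simp: strictly_concave_on_def)
    then show ?thesis by (simp add: algebra_simps)
  qed (simp add: algebra_simps)
qed

lemma strictly_concave_tangent:
  assumes S: "strictly_concave_on S h" and x: "x \<in> interior S" and y: "y \<in> S" "y \<noteq> x"
    and d: "(h has_real_derivative d) (at x)"
  shows "h y < h x + d * (y - x)"
proof -
  have xS: "x \<in> S" using x interior_subset by blast
  have conv: "convex S" using S by (simp add: strictly_concave_on_def)
  define m where "m = (1/2) * y + (1 - 1/2) * x"
  have mS: "m \<in> S" using convexD_alt[OF conv xS y(1), of "1/2"] by (simp add: m_def algebra_simps)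
  have "(1/2) * h y + (1 - 1/2) * h x < h m"
  proof -
    have "1/2 \<in> {0<..<1::real}" by simp
    then show ?thesis using S xS y unfolding strictly_concave_on_def m_def by blast
  qed
  moreover have "- h m - - h x \<ge> - d * (m - x)"
    by (rule convex_on_imp_above_tangent[OF strictly_concave_on_imp_convex_on[OF S] convex_connected[OF conv] x mS])
      (auto intro!: derivative_eq_intros has_field_derivative_at_within[OF d])
  ultimately show ?thesis by (simp add: m_def algebra_simps)
qed

text \<open>
  A differentiable function touching a concave one from below fixes the supergradient at the point of
  contact. Extending the chord from \<open>y\<close> through \<open>k\<close> beyond \<open>k\<close> turns the lower bound into the upper
  bound needed here, so differentiability of \<open>V\<close> need not be discussed.
\<close>

lemma concave_supergradient:
  fixes V \<phi> :: "real \<Rightarrow> real"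
  assumes concave: "\<And>x y a. 0 < x \<Longrightarrow> 0 < y \<Longrightarrow> 0 < a \<Longrightarrow> a < 1 \<Longrightarrow> a * V x + (1 - a) * V y \<le> V (a * x + (1 - a) * y)"
    and k: "0 < k" and y: "0 < y"
    and \<phi>: "(\<phi> has_real_derivative D) (at k)" "\<phi> k = V k" "eventually (\<lambda>x. \<phi> x \<le> V x) (nhds k)"
  shows "V y \<le> V k + D * (y - k)"
proof (rule ccontr)
  assume contr: "\<not> ?thesis"
  define d where "d = y - k"
  define \<psi> where "\<psi> t = \<phi> (k - t * d) + t * (V y - V k)" for t
  have "(\<psi> has_real_derivative - D * d + (V y - V k)) (at 0)"
    unfolding \<psi>_def by (auto intro!: derivative_eq_intros DERIV_chain2[where f = \<phi>] \<phi>(1))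
  moreover have "0 < - D * d + (V y - V k)" using contr by (simp add: d_def algebra_simps)
  ultimately obtain \<delta> where \<delta>: "\<delta> > 0" "\<And>h. 0 < h \<Longrightarrow> h < \<delta> \<Longrightarrow> \<psi> 0 < \<psi> h"
    by (auto dest!: DERIV_pos_inc_right)
  have "((\<lambda>t. k - t * d) \<longlongrightarrow> k - 0 * d) (at_right 0)" by (intro tendsto_intros)
  then have lim: "filterlim (\<lambda>t. k - t * d) (nhds k) (at_right 0)" by simp
  have "eventually (\<lambda>t. \<phi> (k - t * d) \<le> V (k - t * d)) (at_right 0)"
    by (rule eventually_compose_filterlim[OF \<phi>(3) lim])
  moreover have "eventually (\<lambda>t. 0 < k - t * d) (at_right 0)"
    by (rule order_tendstoD(1)[OF lim k])
  moreover have "eventually (\<lambda>t. 0 < t \<and> t < \<delta>) (at_right 0)"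
    using \<delta>(1) eventually_at_right_real[of 0 \<delta>] by (simp add: greaterThanLessThan_def)
  ultimately have "eventually (\<lambda>t. False) (at_right (0::real))"
  proof eventually_elim
    case (elim t)
    have pos: "0 < 1 / (1 + t)" "1 / (1 + t) < 1" using elim by auto
    \<comment> \<open>\<open>k\<close> lies between \<open>k - t d\<close> and \<open>y\<close> with weights \<open>1 / (1 + t)\<close> and \<open>t / (1 + t)\<close>.\<close>
    have k_eq: "1 / (1 + t) * (k - t * d) + (1 - 1 / (1 + t)) * y = k"
    proof -
      have "1 - 1 / (1 + t) = t / (1 + t)" using elim by (simp add: field_simps)
      then have "1 / (1 + t) * (k - t * d) + (1 - 1 / (1 + t)) * y = ((k - t * d) + t * y) / (1 + t)"
        by (simp add: add_divide_distrib)
      also have "(k - t * d) + t * y = k * (1 + t)" by (simp add: d_def algebra_simps)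
      finally show ?thesis using elim by simp
    qed
    have "1 / (1 + t) * V (k - t * d) + (1 - 1 / (1 + t)) * V y \<le> V k"
      using concave[OF elim(2) y pos] k_eq by simp
    then have "(1 + t) * (1 / (1 + t) * V (k - t * d) + (1 - 1 / (1 + t)) * V y) \<le> (1 + t) * V k"
      using elim by (intro mult_left_mono) auto
    moreover have "(1 + t) * (1 / (1 + t) * A + (1 - 1 / (1 + t)) * B) = A + t * B" for A B
    proof -
      have "(1 + t) * (s * A + (1 - s) * B) = ((1 + t) * s) * A + ((1 + t) - (1 + t) * s) * B" for s
        by (simp add: algebra_simps)
      then have "(1 + t) * (1 / (1 + t) * A + (1 - 1 / (1 + t)) * B)
        = ((1 + t) * (1 / (1 + t))) * A + ((1 + t) - (1 + t) * (1 / (1 + t))) * B" .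
      also have "(1 + t) * (1 / (1 + t)) = 1" using elim by simp
      finally show ?thesis by simp
    qed
    ultimately have "V (k - t * d) + t * V y \<le> (1 + t) * V k" by simp
    moreover have "\<psi> 0 < \<psi> t" using \<delta> elim by auto
    ultimately show ?case using elim \<phi>(2) by (simp add: \<psi>_def algebra_simps)
  qed
  then show False by simp
qed

section \<open>Series and expectations in the extended reals\<close>

lemma ereal_sum_distrib:
  fixes X :: "'a \<Rightarrow> ereal"
  assumes "0 \<le> a"
  shows "ereal a * sum X A = (\<Sum>x\<in>A. ereal a * X x)"
  by (induction A rule: infinite_finite_induct) (simp_all add: ereal_pos_distrib assms)

text \<open>
  Utility flows are bounded above by a geometric sequence but may equal \<open>-\<infinity>\<close>. Subtracting them from
  the bound gives a nonnegative series, which always converges.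
\<close>

lemma ereal_series_below_summable:
  fixes X :: "nat \<Rightarrow> ereal" and b :: "nat \<Rightarrow> real"
  assumes le: "\<And>t. X t \<le> ereal (b t)" and b: "b sums s"
  shows "X sums suminf X" "suminf X \<le> ereal s"
proof -
  define Y where "Y t = ereal (b t) - X t" for t
  have Y: "0 \<le> Y t" for t using le[of t] by (cases "X t") (auto simp: Y_def)
  define S where "S = (SUP n. \<Sum>t<n. Y t)"
  have S: "(\<lambda>n. \<Sum>t<n. Y t) \<longlonglongrightarrow> S"
    using sums_ereal_positive[of Y, OF Y] by (simp add: sums_def S_def)
  have "0 \<le> S" unfolding S_def by (rule SUP_upper2[of 0]) auto
  have X: "(\<Sum>t<n. X t) = - ((\<Sum>t<n. Y t) + ereal (- (\<Sum>t<n. b t)))" for n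
  proof (induction n)
    case (Suc n)
    have "0 \<le> (\<Sum>t<n. Y t)" by (simp add: sum_nonneg Y)
    then show ?case using Suc le[of n]
      by (cases "X n"; cases "\<Sum>t<n. Y t") (auto simp: Y_def)
  qed (simp add: zero_ereal_def)
  have "(\<lambda>n. ereal (- (\<Sum>t<n. b t))) \<longlonglongrightarrow> ereal (- s)"
    using b by (intro tendsto_intros) (simp add: sums_def)
  then have "(\<lambda>n. (\<Sum>t<n. Y t) + ereal (- (\<Sum>t<n. b t))) \<longlonglongrightarrow> S + ereal (- s)"
    using S \<open>0 \<le> S\<close> by (intro tendsto_add_ereal_nonneg) auto
  then have "X sums - (S + ereal (- s))"
    unfolding sums_def X by (rule tendsto_uminus_ereal)
  then show "X sums suminf X" "suminf X \<le> ereal s"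
    using \<open>0 \<le> S\<close> by (auto simp: sums_iff) (cases S; auto)+
qed

lemma expect_pmf_const_le:
  assumes "finite (set_pmf q)" "\<And>x. x \<in> set_pmf q \<Longrightarrow> X x \<le> ereal B"
  shows "expect_pmf q X \<le> ereal B"
proof -
  have "expect_pmf q X \<le> (\<Sum>x\<in>set_pmf q. ereal (pmf q x) * ereal B)"
    unfolding expect_pmf_def by (intro sum_mono ereal_mult_left_mono assms) auto
  also have "\<dots> = ereal B"
    using sum_pmf_eq_1[OF assms(1) subset_refl] by (simp flip: sum_distrib_right)
  finally show ?thesis .
qed

lemma expect_pmf_const_ge:
  assumes "finite (set_pmf q)" "\<And>x. x \<in> set_pmf q \<Longrightarrow> ereal B \<le> X x"
  shows "ereal B \<le> expect_pmf q X"
proof -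
  have "ereal B = (\<Sum>x\<in>set_pmf q. ereal (pmf q x) * ereal B)"
    using sum_pmf_eq_1[OF assms(1) subset_refl] by (simp flip: sum_distrib_right)
  also have "\<dots> \<le> expect_pmf q X"
    unfolding expect_pmf_def by (intro sum_mono ereal_mult_left_mono assms) auto
  finally show ?thesis .
qed

section \<open>Histories of shocks\<close>

lemma shock_history_range:
  assumes "\<And>z. z \<in> Z \<Longrightarrow> set_pmf (p z) = Z" "z \<in> Z" "h \<in> set_pmf (shock_history p z t)"
  shows "h \<noteq> [] \<and> set h \<subseteq> Z"
  using assms(3)
proof (induction t arbitrary: h)
  case (Suc t)
  then obtain h' z' where h: "h' \<in> set_pmf (shock_history p z t)" "z' \<in> set_pmf (p (hd h'))" "h = z' # h'"
    by auto
  have "h' \<noteq> []" "set h' \<subseteq> Z" using Suc.IH[OF h(1)] by auto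
  then show ?case using h assms(1)[of "hd h'"] by (cases h') auto
qed (use assms in simp)

lemma finite_shock_history:
  assumes "finite Z" "\<And>z. z \<in> Z \<Longrightarrow> set_pmf (p z) = Z" "z \<in> Z"
  shows "finite (set_pmf (shock_history p z t))"
proof (induction t)
  case (Suc t)
  have "finite (set_pmf (p (hd h)))" if "h \<in> set_pmf (shock_history p z t)" for h
    using shock_history_range[of Z p, OF assms(2,3) that] assms(2)[of "hd h"] assms(1) by (cases h) auto
  then show ?case using Suc by simp
qed simp

section \<open>The value function\<close>

context growth_model
begin

lemma Z_nonempty: "Z \<noteq> {}"
  using shocks by auto

abbreviation "supp z t \<equiv> set_pmf (shock_history p z t)"

lemma supp_finite: "z \<in> Z \<Longrightarrow> finite (supp z t)"
  using finite_shock_history shocks transition by metis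

lemma supp_Z: "z \<in> Z \<Longrightarrow> h \<in> supp z t \<Longrightarrow> h \<noteq> [] \<and> hd h \<in> Z"
  using shock_history_range[of Z p z h t] transition by (cases h) auto

text \<open>
  Away from zero consumption, where \<open>u\<close> may be \<open>-\<infinity>\<close>, all calculus is done with the real-valued \<open>U\<close>.
\<close>

definition U :: "real \<Rightarrow> real" where "U c = real_of_ereal (u c)"
definition dU :: "real \<Rightarrow> real" where "dU = deriv U"
definition df :: "real \<Rightarrow> 'z \<Rightarrow> real" where "df k z = deriv (\<lambda>k. f k z) k"

lemma u_eq: "0 < c \<Longrightarrow> u c = ereal (U c)"
  using u_finite[of c] by (simp add: U_def ereal_real)

lemma U_has_derivative: "0 < c \<Longrightarrow> (U has_real_derivative dU c) (at c)"
  using u_differentiable[of c] unfolding U_def[abs_def] dU_def by (simp add: DERIV_deriv_iff_field_differentiable)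

lemma f_has_derivative: "0 < k \<Longrightarrow> z \<in> Z \<Longrightarrow> ((\<lambda>k. f k z) has_real_derivative df k z) (at k)"
  using f_differentiable[of k z] unfolding df_def by (simp add: DERIV_deriv_iff_field_differentiable)

lemma U_strict_mono: "0 < c \<Longrightarrow> c < c' \<Longrightarrow> U c < U c'"
  using u_increasing unfolding strict_mono_on_def U_def by (auto split: if_splits)

lemma U_tangent:
  assumes "0 < c" "0 < c' \<or> c' = 0 \<and> u 0 \<noteq> -\<infinity>" "c' \<noteq> c"
  shows "U c' < U c + dU c * (c' - c)"
proof (rule strictly_concave_tangent[OF _ _ _ assms(3) U_has_derivative[OF assms(1)]])
  show "strictly_concave_on (if u 0 = -\<infinity> then {0<..} else {0..}) U"
    using u_concave by (simp add: U_def[abs_def])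
qed (use assms in \<open>auto simp: interior_open\<close>)

lemma f_strict_mono: "z \<in> Z \<Longrightarrow> 0 \<le> k \<Longrightarrow> k < k' \<Longrightarrow> f k z < f k' z"
  using f_increasing[of z] unfolding strict_mono_on_def by auto

lemma f_mono: "z \<in> Z \<Longrightarrow> 0 \<le> k \<Longrightarrow> k \<le> k' \<Longrightarrow> f k z \<le> f k' z"
  using f_strict_mono[of z k k'] by (cases "k = k'") auto

lemma f_pos: "z \<in> Z \<Longrightarrow> 0 < k \<Longrightarrow> 0 < f k z"
  using f_strict_mono[of z 0 k] f_zero by simp

lemma f_tangent:
  assumes "z \<in> Z" "0 < k" "0 \<le> k'" "k' \<noteq> k"
  shows "f k' z < f k z + df k z * (k' - k)"
  by (rule strictly_concave_tangent[OF f_concave[OF assms(1)] _ _ assms(4) f_has_derivative[OF assms(2,1)]])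
    (use assms in auto)

lemma dU_pos: "0 < c \<Longrightarrow> 0 < dU c"
  using U_tangent[of c "c + 1"] U_strict_mono[of c "c + 1"] by simp

lemma dU_strict_antimono: "0 < c \<Longrightarrow> c < c' \<Longrightarrow> dU c' < dU c"
proof -
  assume c: "0 < c" "c < c'"
  have "0 < (dU c - dU c') * (c' - c)"
    using U_tangent[of c c'] U_tangent[of c' c] c by (simp add: algebra_simps)
  then show ?thesis using c by (simp add: zero_less_mult_iff)
qed

lemma df_pos: "0 < k \<Longrightarrow> z \<in> Z \<Longrightarrow> 0 < df k z"
  using f_tangent[of z k "k + 1"] f_strict_mono[of z k "k + 1"] by simp

lemma df_strict_antimono: "0 < k \<Longrightarrow> k < k' \<Longrightarrow> z \<in> Z \<Longrightarrow> df k' z < df k z"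
proof -
  assume k: "0 < k" "k < k'" "z \<in> Z"
  have "0 < (df k z - df k' z) * (k' - k)"
    using f_tangent[of z k k'] f_tangent[of z k' k] k by (simp add: algebra_simps)
  then show ?thesis using k by (simp add: zero_less_mult_iff)
qed

lemma dU_unbounded: "\<exists>d>0. \<forall>c. 0 < c \<longrightarrow> c < d \<longrightarrow> B < dU c"
proof -
  have "eventually (\<lambda>c. B < dU c) (at_right 0)"
    using u_Inada unfolding dU_def U_def[abs_def] by (simp add: filterlim_at_top_dense)
  then show ?thesis by (auto simp: eventually_at_right_field)
qed

lemma df_unbounded: "z \<in> Z \<Longrightarrow> \<exists>d>0. \<forall>k. 0 < k \<longrightarrow> k < d \<longrightarrow> B < df k z"
proof -
  assume "z \<in> Z"
  then have "eventually (\<lambda>k. B < df k z) (at_right 0)"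
    using f_Inada[of z] unfolding df_def by (simp add: filterlim_at_top_dense)
  then show ?thesis by (auto simp: eventually_at_right_field)
qed

lemma u_mono: "0 \<le> c \<Longrightarrow> c \<le> c' \<Longrightarrow> u c \<le> u c'"
proof (cases "c = c'")
  case False
  assume c: "0 \<le> c" "c \<le> c'"
  with False have c': "0 < c'" "c < c'" by auto
  show ?thesis
  proof (cases "c = 0 \<and> u 0 = -\<infinity>")
    case nb: False
    then have "U c < U c'" using u_increasing c c' unfolding strict_mono_on_def U_def by (auto split: if_splits)
    moreover have "u c = ereal (U c)"
      using nb c u_eq[of c] u_zero by (cases "c = 0") (auto simp: U_def ereal_real)
    ultimately show ?thesis using u_eq[OF c'(1)] by simp
  qed auto
qed simp

lemma u_mix:
  assumes "0 \<le> c" "0 \<le> c'" "0 < a" "a < 1"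
  shows "ereal a * u c + ereal (1 - a) * u c' \<le> u (a * c + (1 - a) * c')"
proof (cases "c = c'")
  case True
  have "u c = -\<infinity> \<or> u c = ereal (U c)" using assms u_eq[of c] u_zero by (cases "c = 0") (auto simp: U_def ereal_real)
  then show ?thesis using True assms by (auto simp: algebra_simps)
next
  case False
  have val: "u c = ereal (U c)" if "0 \<le> c" "\<not> (c = 0 \<and> u 0 = -\<infinity>)" for c
    using that u_eq[of c] u_zero by (cases "c = 0") (auto simp: U_def ereal_real)
  show ?thesis
  proof (cases "u 0 = -\<infinity> \<and> (c = 0 \<or> c' = 0)")
    case True
    then have "ereal a * u c = -\<infinity> \<or> ereal (1 - a) * u c' = -\<infinity>" using assms by auto
    moreover have "u c \<noteq> \<infinity>" "u c' \<noteq> \<infinity>" using assms u_eq u_zero by (metis PInfty_neq_ereal(1) less_eq_real_def)+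
    ultimately show ?thesis using assms by (cases "u c"; cases "u c'") auto
  next
    case nb: False
    then have "a * U c + (1 - a) * U c' < U (a * c + (1 - a) * c')"
      using u_concave assms \<open>c \<noteq> c'\<close> unfolding strictly_concave_on_def U_def by (auto split: if_splits)
    moreover have "0 < a * c + (1 - a) * c'" using assms \<open>c \<noteq> c'\<close>
      by (cases "c = 0") (auto intro: add_pos_nonneg)
    ultimately show ?thesis using assms nb val[of c] val[of c'] u_eq by auto
  qed
qed

lemma capacity: "\<exists>M\<ge>k. 0 < M \<and> (\<forall>z\<in>Z. f M z < M)"
proof -
  obtain K where K: "K > 0" "\<And>k z. k > K \<Longrightarrow> z \<in> Z \<Longrightarrow> f k z < k" using k_max by blast
  then show ?thesis by (intro exI[of _ "max k (K + 1)"]) auto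
qed

definition utility_flow :: "'z \<Rightarrow> ('z list \<Rightarrow> real) \<Rightarrow> nat \<Rightarrow> ereal" where
  "utility_flow z \<kappa> t = ereal (\<beta> ^ t) * expect_pmf (shock_history p z t) (\<lambda>h. u (consumption f \<kappa> h))"

lemma lifetime_utility_eq: "lifetime_utility \<beta> p u f z \<kappa> = suminf (utility_flow z \<kappa>)"
  by (simp add: lifetime_utility_def utility_flow_def[abs_def])

lemma feasible_predecessor:
  assumes "\<kappa> \<in> feasible_plans p f k z" "0 \<le> k" "z \<in> Z" "h \<in> supp z t"
  shows "0 \<le> \<kappa> (tl h) \<and> (t = 0 \<longrightarrow> tl h = []) \<and> (\<forall>s. t = Suc s \<longrightarrow> tl h \<in> supp z s)"
  using assms by (cases t) (auto simp: feasible_plans_def)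

lemma feasible_bounded:
  assumes \<kappa>: "\<kappa> \<in> feasible_plans p f k z" and k: "0 \<le> k" "k \<le> M" and z: "z \<in> Z" and M: "\<forall>z\<in>Z. f M z < M"
    and h: "h \<in> supp z t"
  shows "0 \<le> \<kappa> (tl h) \<and> \<kappa> (tl h) \<le> M \<and> 0 \<le> consumption f \<kappa> h \<and> consumption f \<kappa> h \<le> M"
proof -
  have bound: "\<kappa> h \<le> M" if "h \<in> supp z t" for h t using that
  proof (induction t arbitrary: h)
    case 0
    then have "\<kappa> h \<le> f k z" using \<kappa> by (fastforce simp: feasible_plans_def dest: spec[of _ 0])
    then show ?case using f_mono[OF z k] M z by fastforce
  next
    case (Suc t)
    have "tl h \<in> supp z t" using feasible_predecessor[OF \<kappa> k(1) z Suc.prems] by blast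
    then have "\<kappa> (tl h) \<le> M" by (rule Suc.IH)
    moreover have "\<kappa> h \<le> f (\<kappa> (tl h)) (hd h)" using \<kappa> Suc.prems unfolding feasible_plans_def by blast
    moreover have "0 \<le> \<kappa> (tl h)" using feasible_predecessor[OF \<kappa> k(1) z Suc.prems] by blast
    moreover have "hd h \<in> Z" using supp_Z[OF z Suc.prems] by blast
    ultimately show ?case using f_mono[of "hd h" "\<kappa> (tl h)" M] M by fastforce
  qed
  have p: "0 \<le> \<kappa> (tl h)" "hd h \<in> Z" using feasible_predecessor[OF \<kappa> k(1) z h] supp_Z[OF z h] by auto
  have le: "\<kappa> (tl h) \<le> M"
  proof (cases t)
    case 0
    then show ?thesis using feasible_predecessor[OF \<kappa> k(1) z h] \<kappa> k by (auto simp: feasible_plans_def)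
  next
    case (Suc s)
    then show ?thesis using feasible_predecessor[OF \<kappa> k(1) z h] bound[of "tl h" s] by auto
  qed
  have "0 \<le> \<kappa> h" "\<kappa> h \<le> f (\<kappa> (tl h)) (hd h)" using \<kappa> h unfolding feasible_plans_def by blast+
  moreover have "f (\<kappa> (tl h)) (hd h) \<le> M" using f_mono[OF p(2,1) le] M p(2) by fastforce
  ultimately show ?thesis using p le by (auto simp: consumption_def)
qed

lemma utility_flow_le:
  assumes "\<kappa> \<in> feasible_plans p f k z" "0 \<le> k" "k \<le> M" "z \<in> Z" "0 < M" "\<forall>z\<in>Z. f M z < M"
  shows "utility_flow z \<kappa> t \<le> ereal (\<beta> ^ t * U M)"
proof -
  have "expect_pmf (shock_history p z t) (\<lambda>h. u (consumption f \<kappa> h)) \<le> ereal (U M)"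
  proof (rule expect_pmf_const_le[OF supp_finite[OF assms(4)]])
    fix h assume h: "h \<in> supp z t"
    have c: "0 \<le> consumption f \<kappa> h" "consumption f \<kappa> h \<le> M"
      using feasible_bounded[OF assms(1-4) assms(6) h] by auto
    show "u (consumption f \<kappa> h) \<le> ereal (U M)"
      using u_mono[OF c] u_eq[OF assms(5)] by simp
  qed
  then have "utility_flow z \<kappa> t \<le> ereal (\<beta> ^ t) * ereal (U M)"
    unfolding utility_flow_def using discount by (intro ereal_mult_left_mono) auto
  then show ?thesis by simp
qed

lemma geometric: "(\<lambda>t. \<beta> ^ t * B) sums (1 / (1 - \<beta>) * B)"
  by (intro sums_mult2 geometric_sums) (use discount in auto)

lemma lifetime_utility_sums:
  assumes "\<kappa> \<in> feasible_plans p f k z" "0 \<le> k" "z \<in> Z"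
  shows "utility_flow z \<kappa> sums lifetime_utility \<beta> p u f z \<kappa>"
proof -
  obtain M where "M \<ge> k" "0 < M" "\<forall>z\<in>Z. f M z < M" using capacity by blast
  then show ?thesis unfolding lifetime_utility_eq
    using ereal_series_below_summable(1)[OF utility_flow_le[OF assms(1,2) _ assms(3)] geometric] by blast
qed

lemma value_fun_less_top:
  assumes "0 \<le> k" "z \<in> Z"
  shows "value_fun \<beta> p u f k z < \<infinity>"
proof -
  obtain M where M: "M \<ge> k" "0 < M" "\<forall>z\<in>Z. f M z < M" using capacity by blast
  have "value_fun \<beta> p u f k z \<le> ereal (1 / (1 - \<beta>) * U M)"
    unfolding value_fun_def lifetime_utility_eq
    using M by (intro SUP_least ereal_series_below_summable(2)[OF utility_flow_le geometric, OF _ assms(1) _ assms(2)]) auto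
  then show ?thesis by (rule le_less_trans) simp
qed

text \<open>
  Since \<open>f\<^sub>k\<close> is unbounded near zero, a small stock \<open>b\<close> produces at least \<open>2 b\<close> under every shock.
  Holding capital at \<open>b\<close> forever then leaves at least \<open>b\<close> for consumption in each period.
\<close>

lemma value_fun_greater_bot:
  assumes k: "0 < k" and z: "z \<in> Z"
  shows "-\<infinity> < value_fun \<beta> p u f k z"
proof -
  have "eventually (\<lambda>x. \<forall>z\<in>Z. 2 < df x z) (at_right 0)"
    using f_Inada shocks(1) unfolding df_def
    by (intro eventually_ball_finite) (auto simp: filterlim_at_top_dense)
  then obtain d where d: "d > 0" "\<And>x z. 0 < x \<Longrightarrow> x < d \<Longrightarrow> z \<in> Z \<Longrightarrow> 2 < df x z"
    by (auto simp: eventually_at_right_field)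
  define b where "b = min (d / 2) k"
  have b: "0 < b" "b < d" "b \<le> k" using d k by (auto simp: b_def)
  have fb: "2 * b \<le> f b z" if "z \<in> Z" for z
  proof -
    have "df b z * b < f b z" using f_tangent[OF that b(1), of 0] b f_zero[OF that] by simp
    moreover have "2 * b < df b z * b" using d(2)[OF b(1,2) that] b by simp
    ultimately show ?thesis by simp
  qed
  define \<kappa> where "\<kappa> h = (if h = [] then k else b)" for h :: "'z list"
  have f\<kappa>: "2 * b \<le> f (\<kappa> h') y" if "y \<in> Z" for h' y
    using fb[OF that] f_mono[OF that _ b(3)] b by (force simp: \<kappa>_def)
  have "0 \<le> \<kappa> h \<and> \<kappa> h \<le> f (\<kappa> (tl h)) (hd h) \<and> b \<le> consumption f \<kappa> h" if "h \<in> supp z t" for h t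
    using supp_Z[OF z that] f\<kappa>[of "hd h" "tl h"] b by (auto simp: \<kappa>_def consumption_def)
  then have feas: "\<kappa> \<in> feasible_plans p f k z" and cons: "\<And>h t. h \<in> supp z t \<Longrightarrow> b \<le> consumption f \<kappa> h"
    by (auto simp: feasible_plans_def) (simp add: \<kappa>_def)
  have "ereal (\<beta> ^ t * U b) \<le> utility_flow z \<kappa> t" for t
  proof -
    have "ereal (U b) \<le> expect_pmf (shock_history p z t) (\<lambda>h. u (consumption f \<kappa> h))"
    proof (rule expect_pmf_const_ge[OF supp_finite[OF z]])
      fix h assume "h \<in> supp z t"
      then show "ereal (U b) \<le> u (consumption f \<kappa> h)"
        using u_mono[OF _ cons] b u_eq[OF b(1)] by auto
    qed
    then have "ereal (\<beta> ^ t) * ereal (U b) \<le> utility_flow z \<kappa> t"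
      unfolding utility_flow_def using discount by (intro ereal_mult_left_mono) auto
    then show ?thesis by simp
  qed
  then have "ereal (1 / (1 - \<beta>) * U b) \<le> lifetime_utility \<beta> p u f z \<kappa>"
    by (rule sums_le[OF _ sums_ereal[THEN iffD2, OF geometric] lifetime_utility_sums[OF feas less_imp_le[OF k] z]])
  also have "\<dots> \<le> value_fun \<beta> p u f k z"
    unfolding value_fun_def by (rule SUP_upper[OF feas])
  finally show ?thesis by (rule less_le_trans[rotated]) simp
qed

definition V :: "real \<Rightarrow> 'z \<Rightarrow> real" where "V k z = real_of_ereal (value_fun \<beta> p u f k z)"

lemma value_fun_eq: "0 < k \<Longrightarrow> z \<in> Z \<Longrightarrow> value_fun \<beta> p u f k z = ereal (V k z)"
  using value_fun_less_top[of k z] value_fun_greater_bot[of k z] by (auto simp: V_def ereal_real)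

text \<open>
  Concavity of \<open>f\<close> makes convex combinations of plans feasible and lets them consume at least the
  combined consumption; concavity of \<open>u\<close> does the rest, period by period.
\<close>

lemma mixed_plan:
  assumes \<kappa>: "\<kappa> \<in> feasible_plans p f k z" and \<kappa>': "\<kappa>' \<in> feasible_plans p f k' z"
    and k: "0 \<le> k" "0 \<le> k'" and a: "0 < a" "a < 1" and z: "z \<in> Z"
  defines "\<mu> \<equiv> \<lambda>h. a * \<kappa> h + (1 - a) * \<kappa>' h"
  shows "\<mu> \<in> feasible_plans p f (a * k + (1 - a) * k') z"
    and "ereal a * lifetime_utility \<beta> p u f z \<kappa> + ereal (1 - a) * lifetime_utility \<beta> p u f z \<kappa>'
       \<le> lifetime_utility \<beta> p u f z \<mu>"
proof -
  have f_mix: "a * f x y + (1 - a) * f x' y \<le> f (a * x + (1 - a) * x') y" if "0 \<le> x" "0 \<le> x'" "y \<in> Z" for x x' y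
  proof (cases "x = x'")
    case False
    then have "a * f x y + (1 - a) * f x' y < f (a * x + (1 - a) * x') y"
      using f_concave[OF that(3)] that a by (auto simp: strictly_concave_on_def)
    then show ?thesis by simp
  qed (simp add: algebra_simps)
  have step: "0 \<le> \<mu> h \<and> \<mu> h \<le> f (\<mu> (tl h)) (hd h) \<and>
      0 \<le> consumption f \<kappa> h \<and> 0 \<le> consumption f \<kappa>' h \<and>
      a * consumption f \<kappa> h + (1 - a) * consumption f \<kappa>' h \<le> consumption f \<mu> h"
    if h: "h \<in> supp z t" for h t
  proof -
    have 1: "0 \<le> \<kappa> h" "\<kappa> h \<le> f (\<kappa> (tl h)) (hd h)" using \<kappa> h unfolding feasible_plans_def by blast+
    have 2: "0 \<le> \<kappa>' h" "\<kappa>' h \<le> f (\<kappa>' (tl h)) (hd h)" using \<kappa>' h unfolding feasible_plans_def by blast+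
    have "0 \<le> \<kappa> (tl h)" "0 \<le> \<kappa>' (tl h)" "hd h \<in> Z"
      using feasible_predecessor[OF \<kappa> k(1) z h] feasible_predecessor[OF \<kappa>' k(2) z h] supp_Z[OF z h] by auto
    note mix = f_mix[OF this]
    have "a * \<kappa> h + (1 - a) * \<kappa>' h \<le> a * f (\<kappa> (tl h)) (hd h) + (1 - a) * f (\<kappa>' (tl h)) (hd h)"
      using 1 2 a by (intro add_mono mult_left_mono) auto
    moreover have "0 \<le> a * \<kappa> h + (1 - a) * \<kappa>' h" using 1 2 a by simp
    ultimately show ?thesis using mix 1 2 by (simp add: \<mu>_def consumption_def algebra_simps)
  qed
  show feas: "\<mu> \<in> feasible_plans p f (a * k + (1 - a) * k') z"
    using step \<kappa> \<kappa>' by (auto simp: feasible_plans_def) (simp add: \<mu>_def)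
  have utility_flow_mix: "ereal a * utility_flow z \<kappa> t + ereal (1 - a) * utility_flow z \<kappa>' t \<le> utility_flow z \<mu> t" for t
  proof -
    let ?q = "shock_history p z t"
    let ?X = "\<lambda>\<kappa> h. u (consumption f \<kappa> h)"
    have "ereal a * expect_pmf ?q (?X \<kappa>) + ereal (1 - a) * expect_pmf ?q (?X \<kappa>')
      = (\<Sum>h\<in>set_pmf ?q. ereal (pmf ?q h) * (ereal a * ?X \<kappa> h + ereal (1 - a) * ?X \<kappa>' h))"
      using a by (simp add: expect_pmf_def ereal_sum_distrib ereal_pos_distrib sum.distrib mult.left_commute)
    also have "\<dots> \<le> expect_pmf ?q (?X \<mu>)"
      unfolding expect_pmf_def
    proof (intro sum_mono ereal_mult_left_mono)
      fix h assume "h \<in> set_pmf ?q"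
      note s = step[OF this]
      have "ereal a * ?X \<kappa> h + ereal (1 - a) * ?X \<kappa>' h \<le> u (a * consumption f \<kappa> h + (1 - a) * consumption f \<kappa>' h)"
        using s a by (intro u_mix) auto
      also have "\<dots> \<le> ?X \<mu> h" using s a by (intro u_mono) auto
      finally show "ereal a * ?X \<kappa> h + ereal (1 - a) * ?X \<kappa>' h \<le> ?X \<mu> h" .
    qed simp
    finally have "ereal (\<beta> ^ t) * (ereal a * expect_pmf ?q (?X \<kappa>) + ereal (1 - a) * expect_pmf ?q (?X \<kappa>'))
       \<le> utility_flow z \<mu> t"
      unfolding utility_flow_def using discount by (intro ereal_mult_left_mono) auto
    then show ?thesis using discount by (simp add: utility_flow_def ereal_pos_distrib mult.left_commute)
  qed
  let ?L = "lifetime_utility \<beta> p u f z"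
  have nt: "?L \<kappa> \<noteq> \<infinity>" "?L \<kappa>' \<noteq> \<infinity>"
  proof -
    have "?L \<kappa> \<le> value_fun \<beta> p u f k z" "?L \<kappa>' \<le> value_fun \<beta> p u f k' z"
      unfolding value_fun_def using \<kappa> \<kappa>' by (auto intro: SUP_upper)
    then show "?L \<kappa> \<noteq> \<infinity>" "?L \<kappa>' \<noteq> \<infinity>"
      using value_fun_less_top[OF k(1) z] value_fun_less_top[OF k(2) z] by auto
  qed
  show "ereal a * ?L \<kappa> + ereal (1 - a) * ?L \<kappa>' \<le> ?L \<mu>"
  proof (cases "?L \<kappa> = -\<infinity> \<or> ?L \<kappa>' = -\<infinity>")
    case True
    then show ?thesis using nt a by (cases "?L \<kappa>"; cases "?L \<kappa>'") auto
  next
    case False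
    have "(\<lambda>n. ereal a * (\<Sum>t<n. utility_flow z \<kappa> t) + ereal (1 - a) * (\<Sum>t<n. utility_flow z \<kappa>' t))
      \<longlonglongrightarrow> ereal a * ?L \<kappa> + ereal (1 - a) * ?L \<kappa>'"
      using False nt lifetime_utility_sums[OF \<kappa> k(1) z] lifetime_utility_sums[OF \<kappa>' k(2) z]
      by (intro tendsto_add_ereal tendsto_cmult_ereal) (auto simp: sums_def)
    moreover have "(\<lambda>n. \<Sum>t<n. utility_flow z \<mu> t) \<longlonglongrightarrow> ?L \<mu>"
      using lifetime_utility_sums[OF feas _ z] k a by (simp add: sums_def)
    moreover have "ereal a * (\<Sum>t<n. utility_flow z \<kappa> t) + ereal (1 - a) * (\<Sum>t<n. utility_flow z \<kappa>' t) \<le> (\<Sum>t<n. utility_flow z \<mu> t)" for n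
    proof -
      have "ereal a * (\<Sum>t<n. utility_flow z \<kappa> t) + ereal (1 - a) * (\<Sum>t<n. utility_flow z \<kappa>' t)
         = (\<Sum>t<n. ereal a * utility_flow z \<kappa> t + ereal (1 - a) * utility_flow z \<kappa>' t)"
        using a by (simp add: ereal_sum_distrib sum.distrib)
      also have "\<dots> \<le> (\<Sum>t<n. utility_flow z \<mu> t)" by (intro sum_mono utility_flow_mix)
      finally show ?thesis .
    qed
    ultimately show ?thesis by (intro LIMSEQ_le) auto
  qed
qed

lemma V_concave:
  assumes x: "0 < x" and y: "0 < y" and a: "0 < a" "a < 1" and z: "z \<in> Z"
  shows "a * V x z + (1 - a) * V y z \<le> V (a * x + (1 - a) * y) z"
proof (rule field_le_epsilon)
  fix e :: real assume e: "0 < e"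
  let ?L = "lifetime_utility \<beta> p u f z"
  have xy: "0 < a * x + (1 - a) * y" using x y a by (simp add: add_pos_pos)
  have approx: "\<exists>\<kappa>\<in>feasible_plans p f k z. ereal (V k z - e) < ?L \<kappa>" if "0 < k" for k
  proof -
    have "ereal (V k z - e) < (SUP \<kappa>\<in>feasible_plans p f k z. ?L \<kappa>)"
      using value_fun_eq[OF that z] e by (simp add: value_fun_def)
    then show ?thesis by (simp add: less_SUP_iff)
  qed
  obtain \<kappa> where \<kappa>: "\<kappa> \<in> feasible_plans p f x z" "ereal (V x z - e) < ?L \<kappa>" using approx[OF x] by blast
  obtain \<kappa>' where \<kappa>': "\<kappa>' \<in> feasible_plans p f y z" "ereal (V y z - e) < ?L \<kappa>'" using approx[OF y] by blast
  note mix = mixed_plan[OF \<kappa>(1) \<kappa>'(1) less_imp_le[OF x] less_imp_le[OF y] a z]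
  have "ereal (a * (V x z - e) + (1 - a) * (V y z - e)) = ereal a * ereal (V x z - e) + ereal (1 - a) * ereal (V y z - e)"
    by simp
  also have "\<dots> \<le> ereal a * ?L \<kappa> + ereal (1 - a) * ?L \<kappa>'"
    using \<kappa>(2) \<kappa>'(2) a by (intro add_mono ereal_mult_left_mono) auto
  also have "\<dots> \<le> value_fun \<beta> p u f (a * x + (1 - a) * y) z"
    by (rule order.trans[OF mix(2)]) (unfold value_fun_def, rule SUP_upper[OF mix(1)])
  also have "\<dots> = ereal (V (a * x + (1 - a) * y) z)" by (rule value_fun_eq[OF xy z])
  finally show "a * V x z + (1 - a) * V y z \<le> V (a * x + (1 - a) * y) z + e"
    by (simp add: algebra_simps)
qed

end

section \<open>The Euler equation\<close>

locale growth_policy = growth_model \<beta> Z p u f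
  for \<beta> and Z :: "'z set" and p u f +
  fixes g :: "real \<Rightarrow> 'z \<Rightarrow> real"
  assumes policy: "optimal_policy \<beta> Z p u f g"
begin

definition continuation :: "real \<Rightarrow> 'z \<Rightarrow> real" where
  "continuation y z = \<beta> * (\<Sum>z'\<in>Z. pmf (p z) z' * V y z')"

definition opt_cons :: "real \<Rightarrow> 'z \<Rightarrow> real" where "opt_cons k z = f k z - g k z"

lemma objective_eq:
  assumes "0 < y" "z \<in> Z"
  shows "bellman_objective \<beta> p u f k z y = u (f k z - y) + ereal (continuation y z)"
proof -
  have "expect_pmf (p z) (\<lambda>z'. value_fun \<beta> p u f y z') = (\<Sum>z'\<in>Z. ereal (pmf (p z) z' * V y z'))"
    unfolding expect_pmf_def transition[OF assms(2)] by (intro sum.cong) (auto simp: value_fun_eq assms)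
  then show ?thesis by (simp add: bellman_objective_def continuation_def)
qed

lemma g_range: "0 \<le> k \<Longrightarrow> z \<in> Z \<Longrightarrow> 0 \<le> g k z \<and> g k z \<le> f k z"
  using policy by (auto simp: optimal_policy_def)

lemma bellman: "0 \<le> k \<Longrightarrow> z \<in> Z \<Longrightarrow> value_fun \<beta> p u f k z = bellman_objective \<beta> p u f k z (g k z)"
  using policy by (auto simp: optimal_policy_def)

lemma bellman_le: "0 \<le> k \<Longrightarrow> z \<in> Z \<Longrightarrow> 0 \<le> y \<Longrightarrow> y \<le> f k z \<Longrightarrow>
    bellman_objective \<beta> p u f k z y \<le> value_fun \<beta> p u f k z"
  using policy unfolding optimal_policy_def by (meson atLeastAtMost_iff)

lemma V_ge:
  assumes "0 < k" "z \<in> Z" "0 < y" "y < f k z"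
  shows "U (f k z - y) + continuation y z \<le> V k z"
  using bellman_le[of k z y] assms by (simp add: objective_eq u_eq value_fun_eq)

lemma continuation_concave:
  assumes "0 < x" "0 < y" "0 < a" "a < 1" "z \<in> Z"
  shows "a * continuation x z + (1 - a) * continuation y z \<le> continuation (a * x + (1 - a) * y) z"
proof -
  have "a * continuation x z + b * continuation y z = \<beta> * (\<Sum>z'\<in>Z. pmf (p z) z' * (a * V x z' + b * V y z'))" for b
    by (simp add: continuation_def algebra_simps sum_distrib_left sum.distrib)
  from this[of "1 - a"] have "a * continuation x z + (1 - a) * continuation y z = \<beta> * (\<Sum>z'\<in>Z. pmf (p z) z' * (a * V x z' + (1 - a) * V y z'))" .
  also have "\<dots> \<le> continuation (a * x + (1 - a) * y) z"
    unfolding continuation_def using assms discount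
    by (intro mult_left_mono sum_mono V_concave) auto
  finally show ?thesis .
qed

text \<open>
  Consuming nothing is never optimal: consuming \<open>e\<close> instead costs at most a multiple of \<open>e\<close> in
  continuation value, by concavity, whereas marginal utility is unbounded near zero.
\<close>

lemma consumption_positive:
  assumes k: "0 < k" and z: "z \<in> Z"
  shows "g k z < f k z"
proof (rule ccontr)
  assume "\<not> ?thesis"
  then have g: "g k z = f k z" using g_range[of k z] k z by auto
  define y where "y = f k z"
  have y: "0 < y" using f_pos[OF z k] by (simp add: y_def)
  have V: "ereal (V k z) = u 0 + ereal (continuation y z)"
    using bellman[of k z] k z by (simp add: g value_fun_eq objective_eq y flip: y_def)
  then have u0: "u 0 \<noteq> -\<infinity>" by auto
  then have u0': "u 0 = ereal (U 0)" using u_zero by (auto simp: U_def ereal_real)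
  define L where "L = (continuation y z - continuation (y / 2) z) * (2 / y)"
  have le: "dU e \<le> L" if e: "0 < e" "e < y / 2" for e
  proof -
    have "U e + continuation (y - e) z \<le> U 0 + continuation y z"
      using V_ge[OF k z, of "y - e"] e V by (simp add: y_def u0')
    moreover have "continuation y z - continuation (y - e) z \<le> e * L"
    proof -
      define t where "t = 2 * e / y"
      have t: "0 < t" "t < 1" using e y by (auto simp: t_def)
      have "t * continuation (y / 2) z + (1 - t) * continuation y z \<le> continuation (t * (y / 2) + (1 - t) * y) z"
        by (rule continuation_concave) (use t y z in auto)
      also have "t * (y / 2) + (1 - t) * y = y - e" using y by (simp add: t_def field_simps)
      finally have "continuation y z - continuation (y - e) z \<le> t * (continuation y z - continuation (y / 2) z)" by (simp add: algebra_simps)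
      also have "t * (continuation y z - continuation (y / 2) z) = e * L" by (simp add: t_def L_def)
      finally show ?thesis .
    qed
    moreover have "U 0 < U e + dU e * (0 - e)" by (rule U_tangent) (use e u0 in auto)
    ultimately have "e * dU e < e * L" by (simp add: mult.commute)
    then show ?thesis using e by simp
  qed
  obtain d where d: "d > 0" "\<And>c. 0 < c \<Longrightarrow> c < d \<Longrightarrow> L < dU c" using dU_unbounded[of L] by blast
  define e where "e = min d (y / 2) / 2"
  have "0 < e" "e < y / 2" "e < d" using d(1) y by (auto simp: e_def min_def)
  then show False using le[of e] d(2)[of e] by simp
qed

text \<open>
  Saving nothing is never optimal: the first \<open>e\<close> units saved cost utility proportional to \<open>e\<close>, whereas
  eating their output next period and nothing afterwards gains more than any multiple of \<open>e\<close>, because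
  \<open>f\<^sub>k\<close> is unbounded near zero. If \<open>u 0 = -\<infinity>\<close> the value of zero capital is \<open>-\<infinity>\<close> and saving nothing
  is ruled out at once.
\<close>

lemma saving_positive:
  assumes k: "0 < k" and z: "z \<in> Z"
  shows "0 < g k z"
proof (rule ccontr)
  assume "\<not> ?thesis"
  then have g: "g k z = 0" using g_range[of k z] k z by auto
  define b where "b = f k z"
  have b: "0 < b" using f_pos[OF z k] by (simp add: b_def)
  define v0 where "v0 z' = value_fun \<beta> p u f 0 z'" for z'
  define E0 where "E0 y = expect_pmf (p y) v0" for y
  have obj0: "bellman_objective \<beta> p u f x y 0 = u (f x y) + ereal \<beta> * E0 y" for x y
    by (simp add: bellman_objective_def E0_def v0_def[abs_def])
  have V: "ereal (V k z) = ereal (U b) + ereal \<beta> * E0 z"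
    using bellman[of k z] k z b by (simp add: g obj0 value_fun_eq u_eq flip: b_def)
  have top0: "v0 y \<noteq> \<infinity>" if "y \<in> Z" for y
    using value_fun_less_top[of 0 y] that by (simp add: v0_def)
  have fin0: "\<bar>v0 y\<bar> \<noteq> \<infinity>" if y: "y \<in> Z" for y
  proof -
    have "v0 y \<noteq> -\<infinity>"
    proof
      assume "v0 y = -\<infinity>"
      moreover have "0 < pmf (p z) y" using transition[OF z] y by (simp add: pmf_positive)
      ultimately have m: "ereal (pmf (p z) y) * v0 y = -\<infinity>" by simp
      have "E0 z = ereal (pmf (p z) y) * v0 y + (\<Sum>y\<in>Z - {y}. ereal (pmf (p z) y) * v0 y)"
        unfolding E0_def expect_pmf_def transition[OF z] using shocks(1) y by (simp add: sum.remove)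
      moreover have "(\<Sum>y\<in>Z - {y}. ereal (pmf (p z) y) * v0 y) \<noteq> \<infinity>"
        using top0 shocks(1) by (auto simp: sum_Pinfty)
      ultimately have "E0 z = -\<infinity>" using m by simp
      then show False using V discount by simp
    qed
    then show ?thesis using top0[OF y] by auto
  qed
  define r where "r y = real_of_ereal (v0 y)" for y
  have r: "v0 y = ereal (r y)" if "y \<in> Z" for y using fin0[OF that] by (simp add: r_def ereal_real)
  have E0: "E0 y = ereal (\<Sum>y'\<in>Z. pmf (p y) y' * r y')" if "y \<in> Z" for y
    unfolding E0_def expect_pmf_def transition[OF that] by (simp add: r cong: sum.cong)
  define R where "R y = \<beta> * (\<Sum>y'\<in>Z. pmf (p y) y' * r y')" for y
  have V': "V k z = U b + R z" using V E0[OF z] by (simp add: R_def)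
  have r_eq: "ereal (r y) = u 0 + ereal (R y)" if y: "y \<in> Z" for y
  proof -
    have "g 0 y = 0" using g_range[of 0 y] f_zero[OF y] y by simp
    then show ?thesis using bellman[of 0 y] y r[OF y] E0[OF y] by (simp add: obj0 f_zero R_def flip: v0_def)
  qed
  have u0: "u 0 \<noteq> -\<infinity>" using r_eq[OF z] by auto
  then have u0': "u 0 = ereal (U 0)" using u_zero by (auto simp: U_def ereal_real)
  have r_eq': "r y = U 0 + R y" if "y \<in> Z" for y using r_eq[OF that] by (simp add: u0')
  \<comment> \<open>What a stock \<open>e\<close> adds to the value of zero capital if its whole output is eaten.\<close>
  have V_small: "r y + dU (f 1 y) * df e y * e \<le> V e y" if e: "0 < e" "e < 1" and y: "y \<in> Z" for e y
  proof -
    have fe: "0 < f e y" "f e y < f 1 y" using f_pos[OF y e(1)] f_strict_mono[OF y _ e(2)] e by auto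
    have "U (f e y) + R y \<le> V e y"
      using bellman_le[of e y 0] e y fe E0[OF y] by (simp add: obj0 u_eq value_fun_eq R_def)
    moreover have "U 0 < U (f e y) + dU (f e y) * (0 - f e y)"
      by (rule U_tangent) (use fe u0 in auto)
    moreover have "dU (f 1 y) * (df e y * e) \<le> dU (f e y) * f e y"
    proof (rule mult_mono)
      show "dU (f 1 y) \<le> dU (f e y)" using dU_strict_antimono[OF fe] by simp
      show "df e y * e \<le> f e y" using f_tangent[OF y e(1), of 0] e f_zero[OF y] by simp
      show "0 \<le> dU (f e y)" using dU_pos[OF fe(1)] by simp
      show "0 \<le> df e y * e" using df_pos[OF e(1) y] e by simp
    qed
    ultimately show ?thesis using r_eq'[OF y] by (simp add: algebra_simps)
  qed
  define q where "q = \<beta> * pmf (p z) z * dU (f 1 z)"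
  have pz: "0 < pmf (p z) z" using transition[OF z] z by (simp add: pmf_positive)
  have q: "0 < q" using discount pz dU_pos[OF f_pos[OF z, of 1]] by (simp add: q_def)
  have le: "q * df e z \<le> dU (b / 2)" if e: "0 < e" "e < 1" "e < b / 2" for e
  proof -
    have "R z + q * df e z * e \<le> continuation e z"
    proof -
      have "(\<Sum>y\<in>Z. pmf (p z) y * r y) + pmf (p z) z * (dU (f 1 z) * df e z * e)
         = (\<Sum>y\<in>Z. pmf (p z) y * (r y + (if y = z then dU (f 1 z) * df e z * e else 0)))"
        using shocks(1) z by (simp add: distrib_left sum.distrib if_distrib[of "\<lambda>x. _ * x"] cong: if_cong)
      also have "\<dots> \<le> (\<Sum>y\<in>Z. pmf (p z) y * V e y)"
      proof (intro sum_mono mult_left_mono)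
        fix y assume y: "y \<in> Z"
        have "0 \<le> dU (f 1 y) * df e y * e"
          using dU_pos[OF f_pos[OF y, of 1]] df_pos[OF e(1) y] e by simp
        then show "r y + (if y = z then dU (f 1 z) * df e z * e else 0) \<le> V e y"
          using V_small[OF e(1,2) y] by auto
      qed simp
      finally have "\<beta> * ((\<Sum>y\<in>Z. pmf (p z) y * r y) + pmf (p z) z * (dU (f 1 z) * df e z * e)) \<le> continuation e z"
        unfolding continuation_def using discount by (intro mult_left_mono) auto
      then show ?thesis by (simp add: R_def q_def distrib_left mult.assoc)
    qed
    moreover have "U (b - e) + continuation e z \<le> U b + R z"
      using V_ge[OF k z e(1)] e b V' by (simp add: b_def)
    moreover have "U b < U (b - e) + dU (b - e) * (b - (b - e))"
      by (rule U_tangent) (use e in auto)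
    ultimately have "q * df e z * e < dU (b - e) * e" by simp
    then have "q * df e z < dU (b - e)" using e by simp
    also have "dU (b - e) \<le> dU (b / 2)" using dU_strict_antimono[of "b / 2" "b - e"] e b by simp
    finally show ?thesis by simp
  qed
  obtain d where d: "d > 0" "\<And>x. 0 < x \<Longrightarrow> x < d \<Longrightarrow> dU (b / 2) / q < df x z"
    using df_unbounded[OF z, of "dU (b / 2) / q"] by blast
  define e where "e = min d (min 1 (b / 2)) / 2"
  have "0 < e" "e < 1" "e < b / 2" "e < d" using d(1) b by (auto simp: e_def)
  then show False using le[of e] d(2)[of e] q by (simp add: field_simps)
qed

lemma opt_cons_pos: "0 < k \<Longrightarrow> z \<in> Z \<Longrightarrow> 0 < opt_cons k z"
  using consumption_positive by (simp add: opt_cons_def)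

lemma V_eq: "0 < k \<Longrightarrow> z \<in> Z \<Longrightarrow> V k z = U (opt_cons k z) + continuation (g k z) z"
  using bellman[of k z] saving_positive[of k z] opt_cons_pos[of k z]
  by (simp add: objective_eq value_fun_eq u_eq flip: opt_cons_def)

text \<open>
  The marginal value of capital according to the envelope theorem. It is never identified with a
  derivative of \<open>V\<close>; that it is a supergradient suffices.
\<close>

definition marginal_value :: "real \<Rightarrow> 'z \<Rightarrow> real" where "marginal_value k z = dU (opt_cons k z) * df k z"

text \<open>
  Keeping the savings \<open>g k z\<close> fixed and consuming all additional output is feasible near \<open>k\<close> (the
  argument of Benveniste and Scheinkman).
\<close>

lemma value_minorant:
  assumes k: "0 < k" and z: "z \<in> Z"
  shows "\<exists>\<phi>. (\<phi> has_real_derivative marginal_value k z) (at k) \<and> \<phi> k = V k z \<and> eventually (\<lambda>x. \<phi> x \<le> V x z) (nhds k)"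
proof -
  define \<phi> where "\<phi> x = U (f x z - g k z) + continuation (g k z) z" for x
  have fd: "((\<lambda>x. f x z) has_real_derivative df k z) (at k)" by (rule f_has_derivative[OF k z])
  have "(\<phi> has_real_derivative marginal_value k z) (at k)"
    unfolding \<phi>_def marginal_value_def using U_has_derivative[OF opt_cons_pos[OF k z]]
    by (auto intro!: derivative_eq_intros DERIV_chain2[where f = U] fd simp: opt_cons_def)
  moreover have "\<phi> k = V k z" using V_eq[OF k z] by (simp add: \<phi>_def opt_cons_def)
  moreover have "eventually (\<lambda>x. \<phi> x \<le> V x z) (nhds k)"
  proof -
    have "isCont (\<lambda>x. f x z) k" using fd by (rule DERIV_isCont)
    then have "eventually (\<lambda>x. g k z < f x z) (at k)"
      unfolding isCont_def by (rule order_tendstoD(1)[OF _ consumption_positive[OF k z]])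
    then have "eventually (\<lambda>x. g k z < f x z) (nhds k)"
      using consumption_positive[OF k z] by (simp add: eventually_nhds_conv_at)
    moreover have "eventually (\<lambda>x. x \<in> {0<..}) (nhds k)" using k by (intro eventually_nhds_in_open) auto
    ultimately show ?thesis
      by eventually_elim (use V_ge[OF _ z saving_positive[OF k z]] in \<open>auto simp: \<phi>_def\<close>)
  qed
  ultimately show ?thesis by blast
qed

lemma supergradient:
  assumes k: "0 < k" and y: "0 < y" and z: "z \<in> Z"
  shows "V y z \<le> V k z + marginal_value k z * (y - k)"
proof -
  obtain \<phi> where \<phi>: "(\<phi> has_real_derivative marginal_value k z) (at k)" "\<phi> k = V k z" "eventually (\<lambda>x. \<phi> x \<le> V x z) (nhds k)"
    using value_minorant[OF k z] by blast
  show ?thesis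
    by (rule concave_supergradient[where V = "\<lambda>x. V x z" and \<phi> = \<phi>, OF _ k y \<phi>])
      (rule V_concave, use z in auto)
qed

lemma marginal_value_antimono:
  assumes "0 < k" "k \<le> k'" "z \<in> Z"
  shows "marginal_value k' z \<le> marginal_value k z"
proof (cases "k = k'")
  case False
  have "0 \<le> (marginal_value k z - marginal_value k' z) * (k' - k)"
    using supergradient[of k k' z] supergradient[of k' k z] assms by (simp add: algebra_simps)
  then show ?thesis using assms False by (simp add: zero_le_mult_iff)
qed simp

definition marginal_saving :: "real \<Rightarrow> 'z \<Rightarrow> real" where "marginal_saving y z = \<beta> * (\<Sum>z'\<in>Z. pmf (p z) z' * marginal_value y z')"

lemma marginal_saving_antimono: "0 < k \<Longrightarrow> k \<le> k' \<Longrightarrow> z \<in> Z \<Longrightarrow> marginal_saving k' z \<le> marginal_saving k z"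
  unfolding marginal_saving_def using discount by (intro mult_left_mono sum_mono marginal_value_antimono) auto

text \<open>
  Replacing next period's values by their differentiable minorants keeps the optimal saving a local
  maximum, so the first-order condition holds for the resulting differentiable objective.
\<close>

lemma euler:
  assumes k: "0 < k" and z: "z \<in> Z"
  shows "dU (opt_cons k z) = marginal_saving (g k z) z"
proof -
  define y0 where "y0 = g k z"
  have y0: "0 < y0" "y0 < f k z" using saving_positive[OF k z] consumption_positive[OF k z] by (auto simp: y0_def)
  have "\<forall>z'\<in>Z. \<exists>\<phi>. (\<phi> has_real_derivative marginal_value y0 z') (at y0) \<and> \<phi> y0 = V y0 z' \<and> eventually (\<lambda>x. \<phi> x \<le> V x z') (nhds y0)"
    using value_minorant[OF y0(1)] by blast
  then obtain \<phi> where \<phi>: "\<And>z'. z' \<in> Z \<Longrightarrow> (\<phi> z' has_real_derivative marginal_value y0 z') (at y0)"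
    "\<And>z'. z' \<in> Z \<Longrightarrow> \<phi> z' y0 = V y0 z'" "\<And>z'. z' \<in> Z \<Longrightarrow> eventually (\<lambda>x. \<phi> z' x \<le> V x z') (nhds y0)"
    by (metis (no_types))
  define \<Psi> where "\<Psi> y = U (f k z - y) + \<beta> * (\<Sum>z'\<in>Z. pmf (p z) z' * \<phi> z' y)" for y
  have d: "(\<Psi> has_real_derivative - dU (opt_cons k z) + marginal_saving y0 z) (at y0)"
  proof -
    have "((\<lambda>y. U (f k z - y)) has_real_derivative dU (opt_cons k z) * (- 1)) (at y0)"
      using U_has_derivative[OF opt_cons_pos[OF k z]]
      by (intro DERIV_chain2[where f = U]) (auto intro!: derivative_eq_intros simp: opt_cons_def y0_def)
    moreover have "((\<lambda>y. \<beta> * (\<Sum>z'\<in>Z. pmf (p z) z' * \<phi> z' y)) has_real_derivative marginal_saving y0 z) (at y0)"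
      unfolding marginal_saving_def by (intro DERIV_cmult DERIV_sum \<phi>(1))
    ultimately show ?thesis unfolding \<Psi>_def by (auto dest: DERIV_add)
  qed
  have "\<Psi> y0 = V k z"
    using V_eq[OF k z] \<phi>(2) by (simp add: \<Psi>_def continuation_def opt_cons_def flip: y0_def)
  moreover have "eventually (\<lambda>y. \<Psi> y \<le> V k z) (nhds y0)"
  proof -
    have "eventually (\<lambda>y. \<forall>z'\<in>Z. \<phi> z' y \<le> V y z') (nhds y0)"
      using shocks(1) \<phi>(3) by (intro eventually_ball_finite) auto
    moreover have "eventually (\<lambda>y. y \<in> {0<..<f k z}) (nhds y0)"
      using y0 by (intro eventually_nhds_in_open) auto
    ultimately show ?thesis
    proof eventually_elim
      case (elim y)
      have "\<Psi> y \<le> U (f k z - y) + continuation y z"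
        unfolding \<Psi>_def continuation_def using elim discount by (intro add_left_mono mult_left_mono sum_mono) auto
      also have "\<dots> \<le> V k z" using V_ge[OF k z] elim by auto
      finally show ?case .
    qed
  qed
  ultimately obtain \<delta> where "\<delta> > 0" "\<forall>y. dist y y0 < \<delta> \<longrightarrow> \<Psi> y \<le> \<Psi> y0"
    by (auto simp: eventually_nhds_metric)
  then have "\<forall>y. \<bar>y0 - y\<bar> < \<delta> \<longrightarrow> \<Psi> y \<le> \<Psi> y0" by (simp add: dist_real_def abs_minus_commute)
  from DERIV_local_max[OF d \<open>\<delta> > 0\<close> this] show ?thesis by (simp add: y0_def)
qed

text \<open>
  If more capital led to less saving, it would lead to more consumption, hence to a lower marginal
  utility, whereas less saving has a weakly higher marginal value.
\<close>

lemma g_mono: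
  assumes k: "0 < k" "k \<le> k'" and z: "z \<in> Z"
  shows "g k z \<le> g k' z"
proof (rule ccontr)
  assume gt: "\<not> ?thesis"
  then have "k \<noteq> k'" by auto
  then have k': "0 < k'" "k < k'" using k by auto
  have "opt_cons k z < opt_cons k' z" using f_strict_mono[OF z _ k'(2)] k gt by (simp add: opt_cons_def)
  then have "dU (opt_cons k' z) < dU (opt_cons k z)" by (rule dU_strict_antimono[OF opt_cons_pos[OF k(1) z]])
  moreover have "marginal_saving (g k z) z \<le> marginal_saving (g k' z) z"
    using gt saving_positive[OF k'(1) z] z by (intro marginal_saving_antimono) auto
  ultimately show False using euler[OF k(1) z] euler[OF k'(1) z] by simp
qed

lemma opt_cons_mono:
  assumes k: "0 < k" "k \<le> k'" and z: "z \<in> Z"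
  shows "opt_cons k z \<le> opt_cons k' z"
proof (rule ccontr)
  assume gt: "\<not> ?thesis"
  have k': "0 < k'" using k by simp
  have "dU (opt_cons k z) < dU (opt_cons k' z)" using gt dU_strict_antimono[OF opt_cons_pos[OF k' z]] by simp
  moreover have "marginal_saving (g k' z) z \<le> marginal_saving (g k z) z"
    using saving_positive[OF k(1) z] g_mono[OF k z] z by (intro marginal_saving_antimono) auto
  ultimately show False using euler[OF k(1) z] euler[OF k' z] by simp
qed

text \<open>
  Saving and consumption both increase with capital and add up to output, so neither varies more than
  output does.
\<close>

lemma g_cont:
  assumes z: "z \<in> Z"
  shows "continuous_on {0<..} (\<lambda>k. g k z)"
  unfolding continuous_on_def
proof
  fix k :: real assume k: "k \<in> {0<..}"
  have lip: "\<bar>g y z - g k z\<bar> \<le> \<bar>f y z - f k z\<bar>" if "0 < y" for y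
    using g_mono[of k y z] g_mono[of y k z] opt_cons_mono[of k y z] opt_cons_mono[of y k z] that k z
    by (cases "k \<le> y") (auto simp: opt_cons_def)
  have "((\<lambda>y. f y z) \<longlongrightarrow> f k z) (at k within {0<..})"
  proof -
    have "continuous_on {0<..} (\<lambda>k. f k z)"
      by (rule continuous_on_subset[OF f_continuous[OF z]]) auto
    then show ?thesis using k unfolding continuous_on_def by blast
  qed
  then have "((\<lambda>y. f y z - f k z) \<longlongrightarrow> 0) (at k within {0<..})" by (simp add: LIM_zero)
  then have "((\<lambda>y. g y z - g k z) \<longlongrightarrow> 0) (at k within {0<..})"
    by (rule tendsto_0_le[where K = 1]) (use lip in \<open>auto simp: eventually_at_filter\<close>)
  then show "((\<lambda>y. g y z) \<longlongrightarrow> g k z) (at k within {0<..})" by (simp add: LIM_zero_iff)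
qed

section \<open>Fixed points of the envelopes\<close>

text \<open>
  If capital did not grow from a small \<open>k\<close> to \<open>y = g k z \<le> k\<close>, consumption under a repeated shock \<open>z\<close>
  would not grow either. Then that one term of the Euler equation already forces
  \<open>\<beta> p(z, z) f\<^sub>k(y, z) \<le> 1\<close>, which fails near zero.
\<close>

lemma growth_near_zero: "\<exists>m>0. \<forall>k z. 0 < k \<longrightarrow> k \<le> m \<longrightarrow> z \<in> Z \<longrightarrow> k < g k z"
proof -
  have "eventually (\<lambda>x. \<forall>z\<in>Z. 1 / (\<beta> * pmf (p z) z) < df x z) (at_right 0)"
    using f_Inada shocks(1) unfolding df_def
    by (intro eventually_ball_finite) (auto simp: filterlim_at_top_dense)
  then obtain d where d: "d > 0" "\<And>x z. 0 < x \<Longrightarrow> x < d \<Longrightarrow> z \<in> Z \<Longrightarrow> 1 / (\<beta> * pmf (p z) z) < df x z"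
    by (auto simp: eventually_at_right_field)
  have "k < g k z" if k: "0 < k" "k \<le> d / 2" and z: "z \<in> Z" for k z
  proof (rule ccontr)
    assume le: "\<not> k < g k z"
    define y where "y = g k z"
    have y: "0 < y" "y < d" "y \<le> k" using saving_positive[OF k(1) z] le k d(1) by (auto simp: y_def)
    have pz: "0 < \<beta> * pmf (p z) z" using transition[OF z] z discount by (simp add: pmf_positive)
    have one: "1 < \<beta> * pmf (p z) z * df y z" using d(2)[OF y(1,2) z] pz by (simp add: field_simps)
    have Dpos: "0 \<le> marginal_value y z'" if "z' \<in> Z" for z'
      using dU_pos[OF opt_cons_pos[OF y(1) that]] df_pos[OF y(1) that] by (simp add: marginal_value_def)
    have "dU (opt_cons y z) < \<beta> * pmf (p z) z * df y z * dU (opt_cons y z)"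
      using one dU_pos[OF opt_cons_pos[OF y(1) z]] by simp
    also have "\<dots> = \<beta> * (pmf (p z) z * marginal_value y z)" by (simp add: marginal_value_def)
    also have "\<dots> \<le> marginal_saving y z"
      unfolding marginal_saving_def using discount shocks(1) Dpos z
      by (intro mult_left_mono member_le_sum) auto
    also have "\<dots> = dU (opt_cons k z)" using euler[OF k(1) z] by (simp add: y_def)
    also have "\<dots> \<le> dU (opt_cons y z)"
      using opt_cons_mono[OF y(1,3) z] dU_strict_antimono[OF opt_cons_pos[OF y(1) z], of "opt_cons k z"]
      by (cases "opt_cons y z = opt_cons k z") auto
    finally show False by simp
  qed
  then show ?thesis using d(1) by (intro exI[of _ "d / 2"]) auto
qed

text \<open>
  The Euler equation makes \<open>w\<close>, the marginal utilities at \<open>k\<close>, a super-solution and \<open>x\<close>, those at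
  \<open>k'\<close>, a sub-solution of linear systems with positive coefficients that are strictly smaller at \<open>k'\<close>.
  At a shock where the ratio \<open>x / w\<close> is largest the two inequalities contradict each other.
\<close>

lemma no_crossing:
  assumes k: "0 < k" "k < k'" and le: "\<And>z. z \<in> Z \<Longrightarrow> g k z \<le> k" and ge: "\<And>z. z \<in> Z \<Longrightarrow> k' \<le> g k' z"
  shows False
proof -
  have k': "0 < k'" using k by simp
  define w where "w z = dU (opt_cons k z)" for z
  define x where "x z = dU (opt_cons k' z)" for z
  have wpos: "0 < w z" and xpos: "0 < x z" if "z \<in> Z" for z
    using dU_pos opt_cons_pos that k(1) k' by (auto simp: w_def x_def)
  have w_ge: "\<beta> * (\<Sum>z'\<in>Z. pmf (p z) z' * (w z' * df k z')) \<le> w z" if z: "z \<in> Z" for z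
    using euler[OF k(1) z] marginal_saving_antimono[OF saving_positive[OF k(1) z] le[OF z] z]
    by (simp add: w_def marginal_saving_def marginal_value_def)
  have x_le: "x z \<le> \<beta> * (\<Sum>z'\<in>Z. pmf (p z) z' * (x z' * df k' z'))" if z: "z \<in> Z" for z
    using euler[OF k' z] marginal_saving_antimono[OF k' ge[OF z] z] by (simp add: x_def marginal_saving_def marginal_value_def)
  obtain z where z: "z \<in> Z" "Max ((\<lambda>z. x z / w z) ` Z) = x z / w z"
  proof -
    have "Max ((\<lambda>z. x z / w z) ` Z) \<in> (\<lambda>z. x z / w z) ` Z"
      using shocks(1) Z_nonempty by (intro Max_in) auto
    then show ?thesis using that by blast
  qed
  define R where "R = x z / w z"
  have R: "0 < R" using wpos[OF z(1)] xpos[OF z(1)] by (simp add: R_def)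
  have xR: "x z' \<le> R * w z'" if "z' \<in> Z" for z'
  proof -
    have "x z' / w z' \<le> R" unfolding R_def z(2)[symmetric] using that shocks(1) by (intro Max_ge) auto
    then show ?thesis using wpos[OF that] by (simp add: field_simps)
  qed
  have "x z \<le> \<beta> * (\<Sum>z'\<in>Z. pmf (p z) z' * (x z' * df k' z'))" by (rule x_le[OF z(1)])
  also have "\<dots> < \<beta> * (\<Sum>z'\<in>Z. pmf (p z) z' * (R * w z' * df k z'))"
  proof (intro mult_strict_left_mono sum_strict_mono shocks(1) Z_nonempty)
    fix z' assume z': "z' \<in> Z"
    show "x z' * df k' z' < R * w z' * df k z'"
    proof -
      have "x z' * df k' z' \<le> R * w z' * df k' z'"
        using xR[OF z'] df_pos[OF k' z'] by (intro mult_right_mono) auto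
      also have "\<dots> < R * w z' * df k z'"
        using R wpos[OF z'] df_strict_antimono[OF k z'] by (intro mult_strict_left_mono) auto
      finally show ?thesis .
    qed
    show "0 < pmf (p z) z'" using transition[OF z(1)] z' by (simp add: pmf_positive)
  qed (use discount in auto)
  also have "\<dots> = R * (\<beta> * (\<Sum>z'\<in>Z. pmf (p z) z' * (w z' * df k z')))"
    by (simp add: sum_distrib_left algebra_simps)
  also have "\<dots> \<le> R * w z" using w_ge[OF z(1)] R by (intro mult_left_mono) auto
  also have "\<dots> = x z" using wpos[OF z(1)] by (simp add: R_def)
  finally show False by simp
qed

end

section \<open>The uniform metric\<close>

lemma uniform_metric_upper:
  assumes "prob_space M" "prob_space N"
  shows "\<bar>cdf M x - cdf N x\<bar> \<le> uniform_metric M N"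
  unfolding uniform_metric_def
proof (rule cSUP_upper)
  show "bdd_above (range (\<lambda>x. \<bar>cdf M x - cdf N x\<bar>))"
  proof (rule bdd_aboveI2)
    fix x
    have "0 \<le> cdf M x" "cdf M x \<le> 1" "0 \<le> cdf N x" "cdf N x \<le> 1"
      using assms by (auto simp: cdf_def prob_space.prob_le_1)
    then show "\<bar>cdf M x - cdf N x\<bar> \<le> 1" by linarith
  qed
qed simp

lemma limiting_distribution_unique:
  assumes "limiting_distribution p g k z \<pi>" "limiting_distribution p g k z \<pi>'"
  shows "\<pi> = \<pi>'"
proof (rule cdf_unique)
  let ?C = "capital_distribution p g k z"
  show rd: "real_distribution \<pi>" "real_distribution \<pi>'"
    using assms by (auto simp: limiting_distribution_def)
  then have ps: "prob_space \<pi>" "prob_space \<pi>'" by (auto simp: real_distribution_def)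
  show "cdf \<pi> = cdf \<pi>'"
  proof
    fix x
    have "(\<lambda>t. cdf (?C t) x) \<longlonglongrightarrow> cdf \<pi>0 x" if "limiting_distribution p g k z \<pi>0" for \<pi>0
    proof (rule Lim_null[THEN iffD2], rule tendsto_0_le[where K=1])
      show "(\<lambda>t. uniform_metric (?C t) \<pi>0) \<longlonglongrightarrow> 0"
        using that by (simp add: limiting_distribution_def)
      have "prob_space \<pi>0" using that by (simp add: limiting_distribution_def real_distribution_def)
      then show "\<forall>\<^sub>F t in sequentially. norm (cdf (?C t) x - cdf \<pi>0 x) \<le> norm (uniform_metric (?C t) \<pi>0) * 1"
        using uniform_metric_upper[OF prob_space_measure_pmf] by (auto intro!: always_eventually order.trans[OF _ abs_ge_self])
    qed
    from this[OF assms(1)] this[OF assms(2)] show "cdf \<pi> x = cdf \<pi>' x"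
      by (rule LIMSEQ_unique)
  qed
qed

section \<open>The chain of capital and shock\<close>

lemma measure_bind_pmf: "measure (bind_pmf N f) X = (\<integral>x. measure (measure_pmf (f x)) X \<partial>measure_pmf N)"
proof -
  have "ennreal (measure (bind_pmf N f) X) = (\<integral>\<^sup>+x. ennreal (measure (f x) X) \<partial>N)"
    by (simp flip: measure_pmf.emeasure_eq_measure)
  also have "\<dots> = ennreal (\<integral>x. measure (f x) X \<partial>N)"
    by (intro nn_integral_eq_integral measure_pmf.integrable_const_bound[where B=1]) auto
  finally show ?thesis by (simp add: integral_nonneg_AE)
qed

text \<open>
  The weight \<open>e\<close> is common to the two points and need not be their exact probability, so one factor
  serves all initial shocks in the contraction below.
\<close>

lemma expectation_two_atoms:
  fixes f :: "'a \<Rightarrow> real"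
  assumes "finite (set_pmf q)" "\<And>x. x \<in> set_pmf q \<Longrightarrow> 0 \<le> f x" "x \<noteq> y" "e \<le> pmf q x" "e \<le> pmf q y" "0 < e"
  shows "e * f x + e * f y \<le> (\<integral>x. f x \<partial>q)"
proof -
  have xy: "{x, y} \<subseteq> set_pmf q" using assms by (auto simp: set_pmf_iff)
  have "e * f x + e * f y \<le> f x * pmf q x + f y * pmf q y"
    using assms xy by (subst (1 2) mult.commute) (auto intro!: add_mono mult_left_mono)
  also have "\<dots> = (\<Sum>a\<in>{x,y}. f a * pmf q a)" using assms by simp
  also have "\<dots> \<le> (\<Sum>a\<in>set_pmf q. f a * pmf q a)"
    using assms xy by (intro sum_mono2) auto
  also have "\<dots> = (\<integral>x. f x \<partial>q)"
    by (rule integral_measure_pmf_real[symmetric]) (use assms in auto)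
  finally show ?thesis .
qed

lemma policy_plan_append: "policy_plan g k (w @ v) = policy_plan g (policy_plan g k v) w"
  by (induction w) auto

text \<open>
  The invariance equation expresses one measure as a combination of several others; as for single
  measures, it suffices to compare the distribution functions.
\<close>

lemma measure_combination_eqI:
  fixes M :: "real measure" and K :: "'i \<Rightarrow> real measure" and c :: "'i \<Rightarrow> real"
  assumes M: "finite_borel_measure M" and K: "\<And>i. i \<in> I \<Longrightarrow> finite_borel_measure (K i)"
    and eq: "\<And>x. measure M {..x} = (\<Sum>i\<in>I. c i * measure (K i) {..x})"
    and A: "A \<in> sets borel"
  shows "measure M A = (\<Sum>i\<in>I. c i * measure (K i) A)"
proof -
  interpret M: finite_borel_measure M by fact
  have sM[simp]: "sets M = sets borel" "space M = UNIV" using M.M_is_borel M.borel_UNIV by auto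
  have sK[simp]: "sets (K i) = sets borel" "space (K i) = UNIV" if "i \<in> I" for i
    using finite_borel_measure.M_is_borel[OF K[OF that]] finite_borel_measure.borel_UNIV[OF K[OF that]] by auto
  have fK: "finite_measure (K i)" if "i \<in> I" for i using K[OF that] by (simp add: finite_borel_measure_def)
  have UNIV: "measure M UNIV = (\<Sum>i\<in>I. c i * measure (K i) UNIV)"
  proof (rule tendsto_unique)
    show "((\<lambda>x. \<Sum>i\<in>I. c i * measure (K i) {..x}) \<longlongrightarrow> measure M UNIV) at_top"
      using M.cdf_lim_at_top by (simp add: cdf_def flip: eq)
    show "((\<lambda>x. \<Sum>i\<in>I. c i * measure (K i) {..x}) \<longlongrightarrow> (\<Sum>i\<in>I. c i * measure (K i) UNIV)) at_top"
      using finite_borel_measure.cdf_lim_at_top[OF K]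
      by (intro tendsto_sum tendsto_mult tendsto_const) (simp add: cdf_def)
  qed simp
  have stable: "Int_stable (range (\<lambda>x::real. {..x}))" "range (\<lambda>x::real. {..x}) \<subseteq> Pow UNIV"
    by (auto simp: Int_stable_def)
  have "A \<in> sigma_sets UNIV (range (\<lambda>x::real. {..x}))"
    using A by (simp add: borel_eq_atMost)
  with stable show ?thesis
  proof (induction rule: sigma_sets_induct_disjoint)
    case (compl A)
    then have A: "A \<in> sets borel" by (simp add: borel_eq_atMost)
    have "measure M (UNIV - A) = measure M UNIV - measure M A"
      using M.finite_measure_compl[of A] A by simp
    also have "\<dots> = (\<Sum>i\<in>I. c i * (measure (K i) UNIV - measure (K i) A))"
      by (simp add: UNIV compl right_diff_distrib sum_subtractf)
    also have "\<dots> = (\<Sum>i\<in>I. c i * measure (K i) (UNIV - A))"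
      using finite_measure.finite_measure_compl[OF fK, of _ A] A by (intro sum.cong) auto
    finally show ?case .
  next
    case (union A)
    then have A: "range A \<subseteq> sets borel" by (auto simp: borel_eq_atMost)
    have "(\<lambda>n. \<Sum>i\<in>I. c i * measure (K i) (A n)) sums (\<Sum>i\<in>I. c i * measure (K i) (\<Union>n. A n))"
      using A union(1) by (intro sums_sum sums_mult finite_measure.finite_measure_UNION fK) auto
    moreover have "(\<lambda>n. measure M (A n)) sums measure M (\<Union>n. A n)"
      using A union(1) by (intro M.finite_measure_UNION) auto
    ultimately show ?case using union(3) by (simp add: sums_iff)
  qed (use eq in auto)
qed

text \<open>
  The monotone chain that the optimal policy induces, with \<open>lo\<close> and \<open>hi\<close> in the roles of \<open>k'\<close> and
  \<open>k''\<close>. The last two assumptions provide arbitrarily wide compact intervals that are mapped into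
  themselves.
\<close>

locale mixing_policy =
  fixes Z :: "'z set" and p :: "'z \<Rightarrow> 'z pmf" and g :: "real \<Rightarrow> 'z \<Rightarrow> real" and lo hi :: real
  assumes finite_Z: "finite Z"
    and full_support: "\<And>z. z \<in> Z \<Longrightarrow> set_pmf (p z) = Z"
    and lo_pos: "0 < lo" and lo_less_hi: "lo < hi"
    and g_mono: "\<And>z k k'. z \<in> Z \<Longrightarrow> 0 < k \<Longrightarrow> k \<le> k' \<Longrightarrow> g k z \<le> g k' z"
    and g_cont: "\<And>z. z \<in> Z \<Longrightarrow> continuous_on {0<..} (\<lambda>k. g k z)"
    and can_rise: "\<And>k. 0 < k \<Longrightarrow> k < hi \<Longrightarrow> \<exists>z\<in>Z. k < g k z"
    and can_fall: "\<And>k. lo < k \<Longrightarrow> \<exists>z\<in>Z. g k z < k"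
    and lo_floor: "\<And>z. z \<in> Z \<Longrightarrow> lo \<le> g lo z"
    and hi_ceiling: "\<And>z. z \<in> Z \<Longrightarrow> g hi z \<le> hi"
    and floor_below: "\<And>k. 0 < k \<Longrightarrow> \<exists>m>0. m \<le> k \<and> (\<forall>z\<in>Z. m \<le> g m z)"
    and ceiling_above: "\<And>k. 0 < k \<Longrightarrow> \<exists>M\<ge>k. \<forall>z\<in>Z. g M z \<le> M"
begin

lemma Z_nonempty: "Z \<noteq> {}"
  using can_rise[of lo] lo_pos lo_less_hi by auto

definition state_dist :: "real \<Rightarrow> 'z \<Rightarrow> nat \<Rightarrow> (real \<times> 'z) pmf" where
  "state_dist k z t = map_pmf (\<lambda>h. (policy_plan g k (tl h), hd h)) (shock_history p z t)"

lemma shock_history_Z: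
  "z \<in> Z \<Longrightarrow> h \<in> set_pmf (shock_history p z t) \<Longrightarrow> h \<noteq> [] \<and> set h \<subseteq> Z"
  using shock_history_range[of Z p] full_support by blast

lemma finite_histories: "z \<in> Z \<Longrightarrow> finite (set_pmf (shock_history p z t))"
  using finite_shock_history[OF finite_Z] full_support by blast

lemma finite_state_dist: "z \<in> Z \<Longrightarrow> finite (set_pmf (state_dist k z t))"
  by (simp add: state_dist_def finite_histories)

lemma state_dist_0: "state_dist k z 0 = return_pmf (k, z)"
  by (simp add: state_dist_def)

lemma state_dist_Suc:
  assumes "z \<in> Z"
  shows "state_dist k z (Suc t) =
    bind_pmf (state_dist k z t) (\<lambda>(k', z'). map_pmf (Pair (g k' z')) (p z'))"
proof -
  have "map_pmf (\<lambda>x. (policy_plan g k h, x)) (p (hd h)) =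
      map_pmf (Pair (g (policy_plan g k (tl h)) (hd h))) (p (hd h))"
    if "h \<in> set_pmf (shock_history p z t)" for h
    using shock_history_Z[OF assms that] by (cases h) auto
  then show ?thesis
    by (auto simp: state_dist_def map_bind_pmf bind_map_pmf map_pmf_comp o_def intro!: bind_pmf_cong)
qed

lemma state_dist_confined:
  assumes m: "0 < m" "\<And>z. z \<in> Z \<Longrightarrow> m \<le> g m z" and M: "\<And>z. z \<in> Z \<Longrightarrow> g M z \<le> M"
    and k: "m \<le> k" "k \<le> M" and z: "z \<in> Z"
  shows "set_pmf (state_dist k z t) \<subseteq> {m..M} \<times> Z"
proof (induction t)
  case 0
  then show ?case using k z by (simp add: state_dist_0)
next
  case (Suc t)
  have "m \<le> g k' z' \<and> g k' z' \<le> M" if "k' \<in> {m..M}" "z' \<in> Z" for k' z'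
    using that m(1) m(2)[of z'] M[of z'] g_mono[of z' m k'] g_mono[of z' k' M] by force
  then have "m \<le> g (fst x) (snd x) \<and> g (fst x) (snd x) \<le> M \<and> snd x \<in> Z"
    if "x \<in> set_pmf (state_dist k z t)" for x
    using Suc that by (cases x) auto
  then show ?case using z full_support by (auto simp: state_dist_Suc case_prod_beta)
qed

lemma state_dist_Z: "0 < k \<Longrightarrow> z \<in> Z \<Longrightarrow> set_pmf (state_dist k z t) \<subseteq> {0<..} \<times> Z"
proof -
  assume k: "0 < k" and z: "z \<in> Z"
  obtain m where m: "m > 0" "m \<le> k" "\<forall>z\<in>Z. m \<le> g m z" using floor_below[OF k] by blast
  obtain M where M: "M \<ge> k" "\<forall>z\<in>Z. g M z \<le> M" using ceiling_above[OF k] by blast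
  have "set_pmf (state_dist k z t) \<subseteq> {m..M} \<times> Z"
    by (rule state_dist_confined) (use m M z in auto)
  then show ?thesis using m(1) by fastforce
qed

text \<open>
  Histories grow at their most recent end, which gives the decomposition at the last step; the
  contraction argument needs to split off the first steps as well.
\<close>

lemma state_dist_add:
  assumes "0 < k" "z \<in> Z"
  shows "state_dist k z (s + t) = bind_pmf (state_dist k z s) (\<lambda>(k', z'). state_dist k' z' t)"
proof (induction t)
  case 0
  then show ?case by (simp add: state_dist_0 case_prod_beta' bind_return_pmf')
next
  case (Suc t)
  have "bind_pmf (case x of (k', z') \<Rightarrow> state_dist k' z' t) (\<lambda>(k', z'). map_pmf (Pair (g k' z')) (p z'))
      = (case x of (k', z') \<Rightarrow> state_dist k' z' (Suc t))"
    if "x \<in> set_pmf (state_dist k z s)" for x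
    using that state_dist_Z[OF assms, of s] by (force simp: state_dist_Suc)
  then show ?case
    using assms Suc by (auto simp: state_dist_Suc bind_assoc_pmf intro!: bind_pmf_cong)
qed

lemma measure_state_dist_Suc:
  assumes "0 < k" "z \<in> Z"
  shows "measure (state_dist k z (Suc t)) (A \<times> {\<zeta>}) =
    (\<Sum>z'\<in>Z. pmf (p z') \<zeta> * measure (state_dist k z t) ({k. g k z' \<in> A} \<times> {z'}))"
proof -
  let ?J = "state_dist k z t"
  have [simp]: "finite (set_pmf ?J)" using finite_state_dist assms by auto
  have eq: "measure (map_pmf (Pair a) (p y)) (A \<times> {\<zeta>}) = indicator A a * pmf (p y) \<zeta>" for a y
  proof -
    have "Pair a -` (A \<times> {\<zeta>}) = (if a \<in> A then {\<zeta>} else {})" by auto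
    then show ?thesis by (simp add: pmf.rep_eq)
  qed
  have "measure (state_dist k z (Suc t)) (A \<times> {\<zeta>}) =
     (\<integral>x. measure (case x of (k', z') \<Rightarrow> map_pmf (Pair (g k' z')) (p z')) (A \<times> {\<zeta>}) \<partial>?J)"
    by (simp only: state_dist_Suc[OF assms(2)] measure_bind_pmf)
  also have "\<dots> = (\<integral>x. (\<Sum>z'\<in>Z. pmf (p z') \<zeta> * indicator ({k. g k z' \<in> A} \<times> {z'}) x) \<partial>?J)"
  proof (rule integral_cong_AE)
    show "AE x in ?J. measure (case x of (k', z') \<Rightarrow> map_pmf (Pair (g k' z')) (p z')) (A \<times> {\<zeta>}) =
        (\<Sum>z'\<in>Z. pmf (p z') \<zeta> * indicator ({k. g k z' \<in> A} \<times> {z'}) x)"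
    proof (rule AE_pmfI)
      fix x assume "x \<in> set_pmf ?J"
      then obtain k' y where x: "x = (k', y)" "y \<in> Z" using state_dist_Z[OF assms, of t] by force
      have "(\<Sum>z'\<in>Z. pmf (p z') \<zeta> * indicator ({k. g k z' \<in> A} \<times> {z'}) x)
          = (\<Sum>z'\<in>Z. if z' = y then indicator A (g k' y) * pmf (p y) \<zeta> else 0)"
        by (rule sum.cong) (auto simp: x indicator_def)
      then show "measure (case x of (k', z') \<Rightarrow> map_pmf (Pair (g k' z')) (p z')) (A \<times> {\<zeta>}) =
        (\<Sum>z'\<in>Z. pmf (p z') \<zeta> * indicator ({k. g k z' \<in> A} \<times> {z'}) x)"
        using x finite_Z by (simp add: eq del: measure_map_pmf)
    qed
  qed auto
  also have "\<dots> = (\<Sum>z'\<in>Z. pmf (p z') \<zeta> * measure ?J ({k. g k z' \<in> A} \<times> {z'}))"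
    by (subst Bochner_Integration.integral_sum) (auto intro: integrable_measure_pmf_finite)
  finally show ?thesis .
qed

lemma policy_plan_mono:
  assumes "set w \<subseteq> Z" "0 < k" "k \<le> k'"
  shows "0 < policy_plan g k w \<and> policy_plan g k w \<le> policy_plan g k' w"
  using assms(1)
proof (induction w)
  case (Cons z w)
  let ?a = "policy_plan g k w"
  have a: "0 < ?a" "?a \<le> policy_plan g k' w" and z: "z \<in> Z" using Cons by auto
  obtain m where m: "m > 0" "m \<le> ?a" "\<forall>z\<in>Z. m \<le> g m z" using floor_below[OF a(1)] by blast
  have "m \<le> g ?a z" using m z g_mono[of z m ?a] by force
  then show ?case using m a z g_mono[of z ?a] by force
qed (use assms in auto)

text \<open>
  The supremum of the reachable stocks would be at least \<open>hi\<close>: at a smaller supremum some shock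
  raises capital strictly, and by continuity it does so from reachable stocks just below.
\<close>

lemma word_above:
  assumes m: "0 < m" and x: "x < hi"
  shows "\<exists>w. set w \<subseteq> Z \<and> x < policy_plan g m w"
proof (rule ccontr)
  assume contr: "\<not> ?thesis"
  define R where "R = {policy_plan g m w |w. set w \<subseteq> Z}"
  have le: "r \<le> x" if "r \<in> R" for r using contr that by (force simp: R_def)
  have mR: "m \<in> R" by (auto simp: R_def intro: exI[of _ "[]"])
  have bdd: "bdd_above R" using le by (auto simp: bdd_above_def)
  define s where "s = Sup R"
  have s: "m \<le> s" "s \<le> x" using mR le bdd by (auto simp: s_def cSup_upper intro: cSup_least)
  obtain z where z: "z \<in> Z" "s < g s z" using can_rise[of s] s m x by auto
  have "isCont (\<lambda>k. g k z) s"
    using g_cont[OF z(1)] s m by (simp add: continuous_on_eq_continuous_at)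
  then have "eventually (\<lambda>k. s < g k z) (at s)"
    using z(2) by (simp add: isCont_def order_tendsto_iff)
  then obtain d where d: "d > 0" "\<And>k. k \<noteq> s \<Longrightarrow> dist k s < d \<Longrightarrow> s < g k z"
    by (auto simp: eventually_at)
  obtain r where r: "r \<in> R" "s - d < r"
    using less_cSupD[of R "s - d"] mR d(1) by (auto simp: s_def)
  have "r \<le> s" using r bdd by (simp add: s_def cSup_upper)
  then have *: "s < g r z" using d(2)[of r] r z(2) by (cases "r = s") (auto simp: dist_real_def)
  obtain w where "r = policy_plan g m w" "set w \<subseteq> Z" using r by (auto simp: R_def)
  then have "g r z \<in> R" using z by (auto simp: R_def intro!: exI[of _ "z # w"])
  then show False using * bdd by (force simp: s_def dest: cSup_upper)
qed

lemma word_below: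
  assumes M: "0 < M" and x: "lo < x"
  shows "\<exists>w. set w \<subseteq> Z \<and> policy_plan g M w < x"
proof (rule ccontr)
  assume contr: "\<not> ?thesis"
  define R where "R = {policy_plan g M w |w. set w \<subseteq> Z}"
  have le: "x \<le> r" if "r \<in> R" for r using contr that by (force simp: R_def)
  have mR: "M \<in> R" by (auto simp: R_def intro: exI[of _ "[]"])
  have bdd: "bdd_below R" using le by (auto simp: bdd_below_def)
  define s where "s = Inf R"
  have s: "s \<le> M" "x \<le> s" using mR le bdd by (auto simp: s_def cInf_lower intro: cInf_greatest)
  have spos: "0 < s" using s x lo_pos by simp
  obtain z where z: "z \<in> Z" "g s z < s" using can_fall[of s] s x by auto
  have "isCont (\<lambda>k. g k z) s"
    using g_cont[OF z(1)] spos by (simp add: continuous_on_eq_continuous_at)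
  then have "eventually (\<lambda>k. g k z < s) (at s)"
    using z(2) by (simp add: isCont_def order_tendsto_iff)
  then obtain d where d: "d > 0" "\<And>k. k \<noteq> s \<Longrightarrow> dist k s < d \<Longrightarrow> g k z < s"
    by (auto simp: eventually_at)
  obtain r where r: "r \<in> R" "r < s + d"
    using cInf_lessD[of R "s + d"] mR d(1) by (auto simp: s_def)
  have "s \<le> r" using r bdd by (simp add: s_def cInf_lower)
  then have *: "g r z < s" using d(2)[of r] r z(2) by (cases "r = s") (auto simp: dist_real_def)
  obtain w where "r = policy_plan g M w" "set w \<subseteq> Z" using r by (auto simp: R_def)
  then have "g r z \<in> R" using z by (auto simp: R_def intro!: exI[of _ "z # w"])
  then show False using * bdd by (force simp: s_def dest: cInf_lower)
qed

text \<open>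
  Words of different lengths are brought to a common length by repeating a shock that keeps capital on
  the side of \<open>x\<close> already reached.
\<close>

lemma splitting_words:
  assumes "0 < m" "0 < M"
  shows "\<exists>x A B. set A \<subseteq> Z \<and> set B \<subseteq> Z \<and> length A = length B \<and>
    0 < x \<and> x < policy_plan g m A \<and> policy_plan g M B < x"
proof -
  define x where "x = (lo + hi) / 2"
  have x: "lo < x" "x < hi" "0 < x" using lo_less_hi lo_pos by (auto simp: x_def)
  obtain A where A: "set A \<subseteq> Z" "x < policy_plan g m A" using word_above[OF assms(1) x(2)] by blast
  obtain B where B: "set B \<subseteq> Z" "policy_plan g M B < x" using word_below[OF assms(2) x(1)] by blast
  obtain a where a: "a \<in> Z" "x < g x a" using can_rise x by blast
  obtain b where b: "b \<in> Z" "g x b < x" using can_fall x by blast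
  have A': "x < policy_plan g m (replicate n a @ A)" for n
  proof (induction n)
    case (Suc n)
    then show ?case using g_mono[OF a(1) x(3), of "policy_plan g m (replicate n a @ A)"] a by simp
  qed (use A in simp)
  have B': "policy_plan g M (replicate n b @ B) < x" for n
  proof (induction n)
    case (Suc n)
    have "0 < policy_plan g M (replicate n b @ B)"
      by (rule policy_plan_mono[THEN conjunct1]) (use assms b(1) B(1) in \<open>auto simp: set_replicate_conv_if\<close>)
    then show ?case using g_mono[OF b(1) _ less_imp_le[OF Suc]] b by simp
  qed (use B in simp)
  have "set (replicate (length B) a @ A) \<subseteq> Z" "set (replicate (length A) b @ B) \<subseteq> Z"
    using A B a b by auto
  then show ?thesis
    using A'[of "length B"] B'[of "length A"] x
    by (intro exI[of _ x] exI[of _ "replicate (length B) a @ A"] exI[of _ "replicate (length A) b @ B"]) auto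
qed

lemma pmf_shock_history_word:
  assumes "z \<in> Z" "set w \<subseteq> Z"
  shows "0 < pmf (shock_history p z (length w)) (w @ [z])"
proof -
  have "w @ [z] \<in> set_pmf (shock_history p z (length w))"
    using assms(2)
  proof (induction w)
    case (Cons a w)
    have "a \<in> set_pmf (p (hd (w @ [z])))"
      using Cons.prems assms(1) full_support by (cases w) auto
    then show ?case using Cons by force
  qed simp
  then show ?thesis by (rule pmf_positive)
qed

section \<open>Contraction of forecasts\<close>

definition forecast :: "(real \<Rightarrow> 'z \<Rightarrow> real) \<Rightarrow> nat \<Rightarrow> real \<Rightarrow> 'z \<Rightarrow> real" where
  "forecast h t k z = (\<integral>(k', z'). h k' z' \<partial>state_dist k z t)"

lemma forecast_bounds:
  assumes z: "z \<in> Z" and b: "\<And>k' z'. (k', z') \<in> set_pmf (state_dist k z t) \<Longrightarrow> a \<le> h k' z' \<and> h k' z' \<le> b"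
  shows "a \<le> forecast h t k z \<and> forecast h t k z \<le> b"
proof
  have i: "integrable (state_dist k z t) f" for f :: "_ \<Rightarrow> real"
    by (intro integrable_measure_pmf_finite finite_state_dist z)
  show "a \<le> forecast h t k z"
    unfolding forecast_def by (intro measure_pmf.integral_ge_const i AE_pmfI) (use b in auto)
  show "forecast h t k z \<le> b"
    unfolding forecast_def by (intro measure_pmf.integral_le_const i AE_pmfI) (use b in auto)
qed

lemma forecast_history:
  "forecast h t k z = (\<integral>w. h (policy_plan g k (tl w)) (hd w) \<partial>shock_history p z t)"
  by (simp add: forecast_def state_dist_def)

lemma forecast_antimono:
  assumes z: "z \<in> Z" and k: "0 < k" "k \<le> k'"
    and h: "\<And>z x y. z \<in> Z \<Longrightarrow> 0 < x \<Longrightarrow> x \<le> y \<Longrightarrow> h y z \<le> h x z"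
  shows "forecast h t k' z \<le> forecast h t k z"
  unfolding forecast_history
proof (rule integral_mono_AE)
  show "AE w in shock_history p z t. h (policy_plan g k' (tl w)) (hd w) \<le> h (policy_plan g k (tl w)) (hd w)"
  proof (rule AE_pmfI)
    fix w assume "w \<in> set_pmf (shock_history p z t)"
    then have w: "hd w \<in> Z" "set (tl w) \<subseteq> Z"
      using shock_history_Z[OF z] by (cases w; force)+
    show "h (policy_plan g k' (tl w)) (hd w) \<le> h (policy_plan g k (tl w)) (hd w)"
      using policy_plan_mono[OF w(2) k] h[OF w(1)] by blast
  qed
qed (intro integrable_measure_pmf_finite finite_histories z)+

lemma forecast_add:
  assumes "0 < k" "z \<in> Z"
  shows "forecast h (s + t) k z = forecast (forecast h t) s k z"
proof -
  have fin: "finite (set_pmf (state_dist k z s))" using finite_state_dist assms by blast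
  have fin': "finite (\<Union>x\<in>set_pmf (state_dist k z s). set_pmf (case x of (k', z') \<Rightarrow> state_dist k' z' t))"
    using fin state_dist_Z[OF assms, of s] by (force intro: finite_state_dist)
  have "forecast h (s + t) k z = (\<integral>x. (case x of (k', z') \<Rightarrow> h k' z')
     \<partial>bind_pmf (state_dist k z s) (\<lambda>(k', z'). state_dist k' z' t))"
    using assms by (simp add: forecast_def state_dist_add)
  also have "\<dots> = (\<Sum>x\<in>set_pmf (state_dist k z s). pmf (state_dist k z s) x *
       (\<integral>x. (case x of (k', z') \<Rightarrow> h k' z') \<partial>(case x of (k', z') \<Rightarrow> state_dist k' z' t)))"
    using fin state_dist_Z[OF assms, of s]
    by (subst pmf_expectation_bind[of "set_pmf (state_dist k z s)"]) (auto intro: finite_state_dist)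
  also have "\<dots> = forecast (forecast h t) s k z"
    unfolding forecast_def using fin
    by (subst integral_measure_pmf_real[where A = "set_pmf (state_dist k z s)"])
      (auto intro!: sum.cong)
  finally show ?thesis .
qed

text \<open>
  A forecast of a decreasing \<open>h\<close> is reduced by the word \<open>A\<close>, after which \<open>h\<close> is at most \<open>h x \<zeta>\<close>, and
  raised by the word \<open>B\<close>, after which \<open>h\<close> is at least \<open>h x \<zeta>\<close>. Comparing two initial states along \<open>A\<close>
  for the one and along \<open>B\<close> for the other cancels \<open>h x \<zeta>\<close> and gains \<open>e * (b - a)\<close>. Both words are
  followed by the same shock \<open>\<zeta>\<close>, which is why different initial shocks cause no loss.
\<close>

lemma oscillation_contracts:
  assumes m: "0 < m" "m \<le> M" and invariant: "\<forall>z\<in>Z. m \<le> g m z \<and> g M z \<le> M"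
  shows "\<exists>e n. 0 < e \<and> e \<le> 1 \<and> (\<forall>h a b.
     (\<forall>z\<in>Z. \<forall>x y. 0 < x \<longrightarrow> x \<le> y \<longrightarrow> h y z \<le> h x z) \<longrightarrow>
     (\<forall>k\<in>{m..M}. \<forall>z\<in>Z. a \<le> h k z \<and> h k z \<le> b) \<longrightarrow>
     (\<forall>k\<in>{m..M}. \<forall>z\<in>Z. \<forall>k'\<in>{m..M}. \<forall>z'\<in>Z.
        forecast h n k z - forecast h n k' z' \<le> (1 - e) * (b - a)))"
proof -
  obtain x A B where AB: "set A \<subseteq> Z" "set B \<subseteq> Z" "length A = length B" "0 < x"
      "x < policy_plan g m A" "policy_plan g M B < x"
    using splitting_words[of m M] m by auto
  obtain \<zeta> where \<zeta>: "\<zeta> \<in> Z" using Z_nonempty by blast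
  have Mpos: "0 < M" using m by simp
  have neq: "A \<noteq> B"
    using AB policy_plan_mono[OF AB(1) m(1,2)] by auto
  \<comment> \<open>The initial shock \<open>z\<close>, the word, and the final shock \<open>\<zeta>\<close> make up a history of length \<open>n + 1\<close>.\<close>
  define n where "n = Suc (length A)"
  define e where "e = Min ((\<lambda>z. min (pmf (shock_history p z n) (\<zeta> # A @ [z])) (pmf (shock_history p z n) (\<zeta> # B @ [z]))) ` Z)"
  have e_le: "e \<le> pmf (shock_history p z n) (\<zeta> # A @ [z]) \<and> e \<le> pmf (shock_history p z n) (\<zeta> # B @ [z])"
    if "z \<in> Z" for z
  proof -
    have "e \<le> min (pmf (shock_history p z n) (\<zeta> # A @ [z])) (pmf (shock_history p z n) (\<zeta> # B @ [z]))"
      unfolding e_def by (intro Min_le) (use that finite_Z in auto)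
    then show ?thesis by simp
  qed
  have pos: "0 < pmf (shock_history p z n) (\<zeta> # A @ [z])" "0 < pmf (shock_history p z n) (\<zeta> # B @ [z])"
    if "z \<in> Z" for z
    using pmf_shock_history_word[OF that, of "\<zeta> # A"] pmf_shock_history_word[OF that, of "\<zeta> # B"]
      AB \<zeta> by (auto simp: n_def)
  have e_pos: "0 < e" unfolding e_def using finite_Z Z_nonempty pos by (subst Min_gr_iff) auto
  have e_1: "e \<le> 1" using e_le[OF \<zeta>] pmf_le_1[of "shock_history p \<zeta> n" "\<zeta> # A @ [\<zeta>]"] by linarith
  have step: "m \<le> g k z \<and> g k z \<le> M" if "k \<in> {m..M}" "z \<in> Z" for k z
    using that m(1) invariant g_mono[of z m k] g_mono[of z k M] by force
  have "forecast h n k z - forecast h n k' z' \<le> (1 - e) * (b - a)"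
    if anti: "\<And>z x y. z \<in> Z \<Longrightarrow> 0 < x \<Longrightarrow> x \<le> y \<Longrightarrow> h y z \<le> h x z"
      and bnd: "\<And>k z. k \<in> {m..M} \<Longrightarrow> z \<in> Z \<Longrightarrow> a \<le> h k z \<and> h k z \<le> b"
      and k: "k \<in> {m..M}" "k' \<in> {m..M}" and z: "z \<in> Z" "z' \<in> Z" for h a b k z k' z'
  proof -
    define H where "H k w = h (policy_plan g k (tl w)) (hd w)" for k w
    have Hb: "a \<le> H k w \<and> H k w \<le> b" if "w \<in> set_pmf (shock_history p z n)" "z \<in> Z" "k \<in> {m..M}" for k w z
    proof -
      have "(policy_plan g k (tl w), hd w) \<in> set_pmf (state_dist k z n)"
        using that by (auto simp: state_dist_def)
      moreover have "set_pmf (state_dist k z n) \<subseteq> {m..M} \<times> Z"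
        by (rule state_dist_confined) (use m invariant that in auto)
      ultimately show ?thesis using bnd by (auto simp: H_def)
    qed
    have HA: "H k (\<zeta> # A @ [z]) \<le> h x \<zeta>" if "z \<in> Z" "k \<in> {m..M}" for k z
    proof -
      have "policy_plan g m A \<le> policy_plan g (g k z) A"
        using policy_plan_mono[OF AB(1) m(1)] step that by blast
      then show ?thesis using anti[OF \<zeta> AB(4)] AB(5) by (simp add: H_def policy_plan_append)
    qed
    have HB: "h x \<zeta> \<le> H k (\<zeta> # B @ [z])" if "z \<in> Z" "k \<in> {m..M}" for k z
    proof -
      have "0 < g k z" "g k z \<le> M" using step[OF that(2,1)] m(1) by auto
      then have "0 < policy_plan g (g k z) B" "policy_plan g (g k z) B \<le> policy_plan g M B"
        using policy_plan_mono[OF AB(2)] by blast+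
      then show ?thesis using anti[OF \<zeta>] AB(6) by (simp add: H_def policy_plan_append)
    qed
    have mem: "\<zeta> # A @ [z] \<in> set_pmf (shock_history p z n)" "\<zeta> # B @ [z] \<in> set_pmf (shock_history p z n)" 
      if "z \<in> Z" for z using pos[OF that] by (auto simp: set_pmf_iff)
    note fin = finite_histories[OF z(1), of n] finite_histories[OF z(2), of n]
    have int: "integrable (shock_history p y n) f" if "y \<in> Z" for y and f :: "_ \<Rightarrow> real"
      by (intro integrable_measure_pmf_finite finite_histories that)
    have up: "e * (b - H k (\<zeta> # A @ [z])) + e * (b - H k (\<zeta> # B @ [z])) \<le> b - forecast h n k z"
    proof -
      have "e * (b - H k (\<zeta> # A @ [z])) + e * (b - H k (\<zeta> # B @ [z])) \<le> (\<integral>w. b - H k w \<partial>shock_history p z n)"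
        by (rule expectation_two_atoms) (use fin Hb[OF _ z(1) k(1)] neq e_le z e_pos in auto)
      also have "\<dots> = b - forecast h n k z"
        unfolding forecast_history H_def using int[OF z(1)] by (subst Bochner_Integration.integral_diff) auto
      finally show ?thesis .
    qed
    have dn: "e * (H k' (\<zeta> # A @ [z']) - a) + e * (H k' (\<zeta> # B @ [z']) - a) \<le> forecast h n k' z' - a"
    proof -
      have "e * (H k' (\<zeta> # A @ [z']) - a) + e * (H k' (\<zeta> # B @ [z']) - a) \<le> (\<integral>w. H k' w - a \<partial>shock_history p z' n)"
        by (rule expectation_two_atoms) (use fin Hb[OF _ z(2) k(2)] neq e_le z e_pos in auto)
      also have "\<dots> = forecast h n k' z' - a"
        unfolding forecast_history H_def using int[OF z(2)] by (subst Bochner_Integration.integral_diff) auto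
      finally show ?thesis .
    qed
    have "b - a \<le> (b - H k (\<zeta> # A @ [z])) + (b - H k (\<zeta> # B @ [z])) + (H k' (\<zeta> # A @ [z']) - a) + (H k' (\<zeta> # B @ [z']) - a)"
      using HA[OF z(1) k(1)] HB[OF z(2) k(2)] Hb[OF mem(2)[OF z(1)] z(1) k(1)] Hb[OF mem(1)[OF z(2)] z(2) k(2)]
      by linarith
    then have "e * (b - a) \<le> e * ((b - H k (\<zeta> # A @ [z])) + (b - H k (\<zeta> # B @ [z])) + (H k' (\<zeta> # A @ [z']) - a) + (H k' (\<zeta> # B @ [z']) - a))"
      using e_pos by simp
    then show ?thesis using up dn by (simp add: algebra_simps)
  qed
  then show ?thesis using e_pos e_1 by (intro exI[of _ e] exI[of _ n]) blast
qed

text \<open>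
  Iterating the contraction bounds the oscillation at multiples of \<open>n\<close>; between them it cannot grow,
  as a forecast over a longer horizon averages
  those over a shorter one. The rate depends on the interval only, not on \<open>h\<close>.
\<close>

lemma forecasts_merge:
  assumes m: "0 < m" "m \<le> M" and invariant: "\<forall>z\<in>Z. m \<le> g m z \<and> g M z \<le> M"
  shows "\<exists>C. C \<longlonglongrightarrow> 0 \<and> (\<forall>h.
     (\<forall>z\<in>Z. \<forall>x y. 0 < x \<longrightarrow> x \<le> y \<longrightarrow> h y z \<le> h x z) \<longrightarrow>
     (\<forall>k z. 0 \<le> h k z \<and> h k z \<le> 1) \<longrightarrow>
     (\<forall>k\<in>{m..M}. \<forall>z\<in>Z. \<forall>k'\<in>{m..M}. \<forall>z'\<in>Z. \<forall>N s t. N \<le> s \<longrightarrow> N \<le> t \<longrightarrow>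
        \<bar>forecast h s k z - forecast h t k' z'\<bar> \<le> C N))"
proof -
  obtain e n where e: "0 < e" "e \<le> 1" and osc_h: "\<forall>h a b.
     (\<forall>z\<in>Z. \<forall>x y. 0 < x \<longrightarrow> x \<le> y \<longrightarrow> h y z \<le> h x z) \<longrightarrow>
     (\<forall>k\<in>{m..M}. \<forall>z\<in>Z. a \<le> h k z \<and> h k z \<le> b) \<longrightarrow>
     (\<forall>k\<in>{m..M}. \<forall>z\<in>Z. \<forall>k'\<in>{m..M}. \<forall>z'\<in>Z.
        forecast h n k z - forecast h n k' z' \<le> (1 - e) * (b - a))"
    using oscillation_contracts[OF m invariant] by (elim exE conjE) (rule that)
  have contr: "forecast h n k z - forecast h n k' z' \<le> (1 - e) * (b - a)"
    if "\<And>z x y. z \<in> Z \<Longrightarrow> 0 < x \<Longrightarrow> x \<le> y \<Longrightarrow> h y z \<le> h x z"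
      "\<And>k z. k \<in> {m..M} \<Longrightarrow> z \<in> Z \<Longrightarrow> a \<le> h k z \<and> h k z \<le> b"
      "k \<in> {m..M}" "z \<in> Z" "k' \<in> {m..M}" "z' \<in> Z" for h a b k z k' z'
    by (intro osc_h[rule_format] that)
  define n' where "n' = max n 1"
  define C where "C N = (1 - e) ^ (N div n')" for N
  have "C \<longlonglongrightarrow> 0"
  proof -
    have "filterlim (\<lambda>N. N div n') at_top sequentially"
    proof (rule filterlim_at_top[THEN iffD2], rule allI)
      fix K
      have "K \<le> N div n'" if "N \<ge> K * n'" for N
        using that by (simp add: n'_def less_eq_div_iff_mult_less_eq)
      then show "eventually (\<lambda>N. K \<le> N div n') sequentially"
        by (auto simp: eventually_sequentially)
    qed
    moreover have "(\<lambda>j. (1 - e) ^ j) \<longlonglongrightarrow> 0" using e by (intro LIMSEQ_power_zero) auto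
    ultimately show ?thesis unfolding C_def by (rule filterlim_compose[rotated])
  qed
  moreover have "\<bar>forecast h s k z - forecast h t k' z'\<bar> \<le> C N"
    if anti: "\<And>z x y. z \<in> Z \<Longrightarrow> 0 < x \<Longrightarrow> x \<le> y \<Longrightarrow> h y z \<le> h x z"
      and bnd: "\<And>k z. 0 \<le> h k z \<and> h k z \<le> 1"
      and k: "k \<in> {m..M}" "k' \<in> {m..M}" and z: "z \<in> Z" "z' \<in> Z" and N: "N \<le> s" "N \<le> t"
    for h k z k' z' N s t
  proof -
    have conf: "set_pmf (state_dist k z t) \<subseteq> {m..M} \<times> Z" if "k \<in> {m..M}" "z \<in> Z" for k z t
      by (rule state_dist_confined) (use m invariant that in auto)
    have pos: "0 < k" if "k \<in> {m..M}" for k using that m by auto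
    have ex: "\<exists>a b. b - a \<le> (1 - e) ^ j \<and>
      (\<forall>k\<in>{m..M}. \<forall>z\<in>Z. a \<le> forecast h (j * n) k z \<and> forecast h (j * n) k z \<le> b)" for j
    proof (induction j)
      case 0
      then show ?case using bnd
        by (intro exI[of _ 0] exI[of _ 1]) (simp add: forecast_def state_dist_0)
    next
      case (Suc j)
      then obtain a b where ab: "b - a \<le> (1 - e) ^ j"
        "\<And>k z. k \<in> {m..M} \<Longrightarrow> z \<in> Z \<Longrightarrow> a \<le> forecast h (j * n) k z \<and> forecast h (j * n) k z \<le> b" by blast
      let ?h = "forecast h (j * n)"
      let ?V = "(\<lambda>(k, z). forecast h (Suc j * n) k z) ` ({m..M} \<times> Z)"
      have osc: "forecast h (Suc j * n) k z - forecast h (Suc j * n) k' z' \<le> (1 - e) ^ Suc j"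
        if "k \<in> {m..M}" "z \<in> Z" "k' \<in> {m..M}" "z' \<in> Z" for k z k' z'
      proof -
        have "forecast ?h n k z - forecast ?h n k' z' \<le> (1 - e) * (b - a)"
          by (rule contr) (use that ab anti in \<open>auto intro!: forecast_antimono\<close>)
        also have "\<dots> \<le> (1 - e) * (1 - e) ^ j" using ab e by (intro mult_left_mono) auto
        finally show ?thesis using that pos by (simp add: forecast_add)
      qed
      have ne: "?V \<noteq> {}" using Z_nonempty m by auto
      have bdd: "bdd_above ?V" "bdd_below ?V"
      proof -
        obtain k0 z0 where "k0 \<in> {m..M}" "z0 \<in> Z" using ne by auto
        then have "v \<le> forecast h (Suc j * n) k0 z0 + (1 - e) ^ Suc j"
          "forecast h (Suc j * n) k0 z0 - (1 - e) ^ Suc j \<le> v" if "v \<in> ?V" for v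
          using that osc[OF _ _ \<open>k0 \<in> {m..M}\<close> \<open>z0 \<in> Z\<close>] osc[OF \<open>k0 \<in> {m..M}\<close> \<open>z0 \<in> Z\<close>]
          by (auto simp: algebra_simps simp del: power_Suc mult_Suc)
        then show "bdd_above ?V" "bdd_below ?V" unfolding bdd_above_def bdd_below_def by blast+
      qed
      have "Sup ?V \<le> Inf ?V + (1 - e) ^ Suc j"
      proof (rule cSup_least[OF ne])
        fix v assume "v \<in> ?V"
        then have "v - (1 - e) ^ Suc j \<le> w" if "w \<in> ?V" for w
          using that osc by (auto simp: algebra_simps simp del: power_Suc mult_Suc)
        then have "v - (1 - e) ^ Suc j \<le> Inf ?V" by (rule cInf_greatest[OF ne])
        then show "v \<le> Inf ?V + (1 - e) ^ Suc j" by simp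
      qed
      moreover have "Inf ?V \<le> forecast h (Suc j * n) k z \<and> forecast h (Suc j * n) k z \<le> Sup ?V"
        if "k \<in> {m..M}" "z \<in> Z" for k z
      proof -
        have "forecast h (Suc j * n) k z \<in> ?V" using that by (intro image_eqI[of _ _ "(k, z)"]) auto
        then show ?thesis by (intro conjI cInf_lower[OF _ bdd(2)] cSup_upper[OF _ bdd(1)])
      qed
      ultimately have "Sup ?V - Inf ?V \<le> (1 - e) ^ Suc j \<and> (\<forall>k\<in>{m..M}. \<forall>z\<in>Z.
          Inf ?V \<le> forecast h (Suc j * n) k z \<and> forecast h (Suc j * n) k z \<le> Sup ?V)"
        by (simp del: power_Suc mult_Suc)
      then show ?case by (intro exI)
    qed
    define j where "j = N div n'"
    have jn: "j * n \<le> N"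
    proof -
      have "j * n \<le> j * n'" by (simp add: n'_def)
      also have "\<dots> \<le> N" using div_times_less_eq_dividend[of N n'] by (simp add: j_def)
      finally show ?thesis .
    qed
    obtain a b where ab: "b - a \<le> (1 - e) ^ j"
      "\<And>k z. k \<in> {m..M} \<Longrightarrow> z \<in> Z \<Longrightarrow> a \<le> forecast h (j * n) k z \<and> forecast h (j * n) k z \<le> b" using ex by blast
    have "a \<le> forecast h r k z \<and> forecast h r k z \<le> b" if "k \<in> {m..M}" "z \<in> Z" "N \<le> r" for k z r
    proof -
      have "j * n \<le> r" using jn that(3) by simp
      then obtain r' where r: "r = r' + j * n" by (auto simp: le_iff_add ac_simps)
      show ?thesis unfolding r forecast_add[OF pos[OF that(1)] that(2)]
        by (rule forecast_bounds[OF that(2)]) (use conf[OF that(1,2)] ab in blast)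
    qed
    from this[OF k(1) z(1) N(1)] this[OF k(2) z(2) N(2)] ab(1) show ?thesis by (auto simp: C_def j_def)
  qed
  ultimately show ?thesis
    by (intro exI[of _ C] conjI allI impI ballI) blast+
qed

section \<open>Limiting distribution functions\<close>

abbreviation state_space :: "(real \<times> 'z) measure" where
  "state_space \<equiv> restrict_space borel {0<..} \<Otimes>\<^sub>M count_space Z"

lemma capital_distribution_eq: "capital_distribution p g k z t = map_pmf fst (state_dist k z t)"
  by (simp add: capital_distribution_def state_dist_def map_pmf_comp)

lemma measure_state_dist_cong:
  assumes "\<And>k' z'. (k', z') \<in> set_pmf (state_dist k z t) \<Longrightarrow> (k', z') \<in> X \<longleftrightarrow> (k', z') \<in> Y"
  shows "measure (state_dist k z t) X = measure (state_dist k z t) Y"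
  by (rule measure_pmf.finite_measure_eq_AE) (use assms in \<open>auto simp: AE_measure_pmf_iff\<close>)

lemma measure_state_dist_sum:
  assumes "0 < k" "z \<in> Z"
  shows "(\<Sum>\<zeta>\<in>Z. measure (state_dist k z t) (A \<times> {\<zeta>})) = measure (state_dist k z t) (fst -` A)"
proof -
  have "(\<Sum>\<zeta>\<in>Z. measure (state_dist k z t) (A \<times> {\<zeta>})) = measure (state_dist k z t) (\<Union>\<zeta>\<in>Z. A \<times> {\<zeta>})"
    using finite_Z by (intro measure_pmf.finite_measure_finite_Union[symmetric]) (auto simp: disjoint_family_on_def)
  also have "\<dots> = measure (state_dist k z t) (fst -` A)"
    using state_dist_Z[OF assms] by (intro measure_state_dist_cong) force
  finally show ?thesis .
qed

text \<open>
  The limit does not depend on the initial state. Starting at \<open>hi\<close> keeps the chain in \<open>[lo, hi]\<close>, which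
  shows where the limit distribution lives.
\<close>

definition joint_cdf :: "'z \<Rightarrow> real \<Rightarrow> real" where
  "joint_cdf \<zeta> x = lim (\<lambda>t. measure (state_dist hi (SOME z. z \<in> Z) t) ({..x} \<times> {\<zeta>}))"

lemma hi_pos: "0 < hi"
  using lo_pos lo_less_hi by simp

lemma joint_cdf_uniform:
  assumes k: "0 < k"
  shows "\<exists>C. C \<longlonglongrightarrow> 0 \<and> (\<forall>z\<in>Z. \<forall>\<zeta> x t. \<bar>measure (state_dist k z t) ({..x} \<times> {\<zeta>}) - joint_cdf \<zeta> x\<bar> \<le> C t)"
proof -
  define z0 where "z0 = (SOME z. z \<in> Z)"
  have z0: "z0 \<in> Z" using Z_nonempty by (auto simp: z0_def some_in_eq)
  obtain m where m: "m > 0" "m \<le> min k hi" "\<forall>z\<in>Z. m \<le> g m z"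
    using floor_below[of "min k hi"] k hi_pos by auto
  obtain M where M: "M \<ge> max k hi" "\<forall>z\<in>Z. g M z \<le> M"
    using ceiling_above[of "max k hi"] k by (metis less_max_iff_disj)
  have mM: "m \<le> M" using m M by simp
  have inv: "\<forall>z\<in>Z. m \<le> g m z \<and> g M z \<le> M" using m M by auto
  define h where "h x \<zeta> k z = (indicator ({..x} \<times> {\<zeta>}) (k, z) :: real)" for x k :: real and \<zeta> z :: 'z
  have fh: "forecast (h x \<zeta>) t k z = measure (state_dist k z t) ({..x} \<times> {\<zeta>})" for x \<zeta> t k z
    by (simp add: forecast_def h_def)
  obtain C where C: "C \<longlonglongrightarrow> 0" and bound: "\<forall>h.
     (\<forall>z\<in>Z. \<forall>x y. 0 < x \<longrightarrow> x \<le> y \<longrightarrow> h y z \<le> h x z) \<longrightarrow>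
     (\<forall>k z. 0 \<le> h k z \<and> h k z \<le> 1) \<longrightarrow>
     (\<forall>k\<in>{m..M}. \<forall>z\<in>Z. \<forall>k'\<in>{m..M}. \<forall>z'\<in>Z. \<forall>N s t. N \<le> s \<longrightarrow> N \<le> t \<longrightarrow>
        \<bar>forecast h s k z - forecast h t k' z'\<bar> \<le> C N)"
    using forecasts_merge[OF m(1) mM inv] by (elim exE conjE) (rule that)
  have b: "\<bar>measure (state_dist k z s) ({..x} \<times> {\<zeta>}) - measure (state_dist k' z' t) ({..x} \<times> {\<zeta>})\<bar> \<le> C N"
    if "k \<in> {m..M}" "z \<in> Z" "k' \<in> {m..M}" "z' \<in> Z" "N \<le> s" "N \<le> t" for k z s k' z' t N x \<zeta>
    unfolding fh[symmetric]
    by (rule bound[rule_format]) (use that in \<open>auto simp: h_def indicator_def\<close>)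
  have hiI: "hi \<in> {m..M}" and kI: "k \<in> {m..M}" using m M by auto
  have conv: "(\<lambda>t. measure (state_dist hi z0 t) ({..x} \<times> {\<zeta>})) \<longlonglongrightarrow> joint_cdf \<zeta> x" for x \<zeta>
  proof -
    have "Cauchy (\<lambda>t. measure (state_dist hi z0 t) ({..x} \<times> {\<zeta>}))"
    proof (rule metric_CauchyI)
      fix e :: real assume "0 < e"
      then have "eventually (\<lambda>N. C N < e) sequentially" by (rule order_tendstoD(2)[OF C])
      then obtain N where N: "C N < e" by (auto simp: eventually_sequentially)
      have "dist (measure (state_dist hi z0 s) ({..x} \<times> {\<zeta>})) (measure (state_dist hi z0 t) ({..x} \<times> {\<zeta>})) < e"
        if "N \<le> s" "N \<le> t" for s t
        using b[OF hiI z0 hiI z0 that, of x \<zeta>] N by (simp add: dist_real_def)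
      then show "\<exists>N. \<forall>s\<ge>N. \<forall>t\<ge>N. dist (measure (state_dist hi z0 s) ({..x} \<times> {\<zeta>})) (measure (state_dist hi z0 t) ({..x} \<times> {\<zeta>})) < e"
        by blast
    qed
    then show ?thesis unfolding joint_cdf_def z0_def[symmetric]
      by (simp add: Cauchy_convergent_iff convergent_LIMSEQ_iff)
  qed
  have "\<bar>measure (state_dist k z t) ({..x} \<times> {\<zeta>}) - joint_cdf \<zeta> x\<bar> \<le> C t" if "z \<in> Z" for z x \<zeta> t
  proof (rule tendsto_upperbound)
    show "(\<lambda>s. \<bar>measure (state_dist k z t) ({..x} \<times> {\<zeta>}) - measure (state_dist hi z0 s) ({..x} \<times> {\<zeta>})\<bar>)
      \<longlonglongrightarrow> \<bar>measure (state_dist k z t) ({..x} \<times> {\<zeta>}) - joint_cdf \<zeta> x\<bar>"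
      by (intro tendsto_intros conv)
    show "\<forall>\<^sub>F s in sequentially. \<bar>measure (state_dist k z t) ({..x} \<times> {\<zeta>}) - measure (state_dist hi z0 s) ({..x} \<times> {\<zeta>})\<bar> \<le> C t"
      using b[OF kI that hiI z0, of t t] by (auto simp: eventually_sequentially intro!: exI[of _ t])
  qed simp
  then show ?thesis using C by blast
qed

lemma joint_cdf_lim:
  assumes "0 < k" "z \<in> Z"
  shows "(\<lambda>t. measure (state_dist k z t) ({..x} \<times> {\<zeta>})) \<longlonglongrightarrow> joint_cdf \<zeta> x"
proof -
  obtain C where C: "C \<longlonglongrightarrow> 0" "\<And>t. \<bar>measure (state_dist k z t) ({..x} \<times> {\<zeta>}) - joint_cdf \<zeta> x\<bar> \<le> C t"
    using joint_cdf_uniform[OF assms(1)] assms(2) by blast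
  show ?thesis
    by (rule Lim_null[THEN iffD2], rule tendsto_0_le[OF C(1), where K=1])
      (auto intro!: always_eventually order.trans[OF C(2)] abs_ge_self)
qed

lemma state_dist_hi: "z \<in> Z \<Longrightarrow> set_pmf (state_dist hi z t) \<subseteq> {lo..hi} \<times> Z"
  by (rule state_dist_confined) (use lo_pos lo_less_hi lo_floor hi_ceiling in auto)

lemma joint_cdf_mono: "x \<le> y \<Longrightarrow> joint_cdf \<zeta> x \<le> joint_cdf \<zeta> y"
proof -
  assume "x \<le> y"
  obtain z where z: "z \<in> Z" using Z_nonempty by blast
  show ?thesis
    by (rule LIMSEQ_le[OF joint_cdf_lim[OF hi_pos z] joint_cdf_lim[OF hi_pos z]])
      (use \<open>x \<le> y\<close> in \<open>auto intro!: measure_pmf.finite_measure_mono exI[of _ 0]\<close>)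
qed

lemma joint_cdf_below: "x < lo \<Longrightarrow> joint_cdf \<zeta> x = 0"
proof -
  assume x: "x < lo"
  obtain z where z: "z \<in> Z" using Z_nonempty by blast
  have "measure (state_dist hi z t) ({..x} \<times> {\<zeta>}) = measure (state_dist hi z t) {}" for t
    using state_dist_hi[OF z, of t] x by (intro measure_state_dist_cong) force
  then show ?thesis using joint_cdf_lim[OF hi_pos z, of x \<zeta>] by (simp add: LIMSEQ_const_iff)
qed

lemma joint_cdf_above: "hi \<le> x \<Longrightarrow> joint_cdf \<zeta> x = joint_cdf \<zeta> hi"
proof -
  assume x: "hi \<le> x"
  obtain z where z: "z \<in> Z" using Z_nonempty by blast
  have "measure (state_dist hi z t) ({..x} \<times> {\<zeta>}) = measure (state_dist hi z t) ({..hi} \<times> {\<zeta>})" for t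
    using state_dist_hi[OF z, of t] x by (intro measure_state_dist_cong) force
  then show ?thesis using joint_cdf_lim[OF hi_pos z, of x \<zeta>] joint_cdf_lim[OF hi_pos z, of hi \<zeta>]
    by (simp add: LIMSEQ_unique)
qed

lemma joint_cdf_nonneg: "0 \<le> joint_cdf \<zeta> x"
  using joint_cdf_mono[of "min x (lo - 1)" x \<zeta>] joint_cdf_below[of "min x (lo - 1)" \<zeta>] by auto

lemma joint_cdf_sum: "(\<Sum>\<zeta>\<in>Z. joint_cdf \<zeta> hi) = 1"
proof -
  obtain z where z: "z \<in> Z" using Z_nonempty by blast
  have "measure (state_dist hi z t) (fst -` {..hi}) = 1" for t
  proof -
    have "measure (state_dist hi z t) (fst -` {..hi}) = measure (state_dist hi z t) UNIV"
      using state_dist_hi[OF z, of t] by (intro measure_state_dist_cong) force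
    then show ?thesis by simp
  qed
  then have "(\<lambda>t. \<Sum>\<zeta>\<in>Z. measure (state_dist hi z t) ({..hi} \<times> {\<zeta>})) \<longlonglongrightarrow> 1"
    by (simp add: measure_state_dist_sum[OF hi_pos z])
  then show ?thesis
    by (rule LIMSEQ_unique[rotated]) (intro tendsto_sum joint_cdf_lim hi_pos z)
qed

text \<open>
  Right continuity survives the uniform limit.
\<close>

lemma joint_cdf_right_continuous: "continuous (at_right a) (joint_cdf \<zeta>)"
  unfolding continuous_within
proof (rule tendstoI)
  fix e :: real assume e: "0 < e"
  obtain z where z: "z \<in> Z" using Z_nonempty by blast
  obtain C where C: "C \<longlonglongrightarrow> 0" "\<And>x t. \<bar>measure (state_dist hi z t) ({..x} \<times> {\<zeta>}) - joint_cdf \<zeta> x\<bar> \<le> C t"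
    using joint_cdf_uniform[OF hi_pos] z by blast
  have "eventually (\<lambda>N. C N < e / 2) sequentially"
    by (rule order_tendstoD(2)[OF C(1)]) (use e in simp)
  then obtain N where N: "C N < e / 2" by (auto simp: eventually_sequentially)
  let ?G = "\<lambda>x. measure (state_dist hi z N) ({..x} \<times> {\<zeta>})"
  have "eventually (\<lambda>x. \<forall>s\<in>set_pmf (state_dist hi z N). \<not> (a < fst s \<and> fst s \<le> x)) (at_right a)"
  proof (rule eventually_ball_finite[OF finite_state_dist[OF z]], rule ballI)
    fix s :: "real \<times> 'z"
    show "eventually (\<lambda>x. \<not> (a < fst s \<and> fst s \<le> x)) (at_right a)"
      by (cases "a < fst s") (auto simp: eventually_at_right_field not_le)
  qed
  moreover have "eventually (\<lambda>x. a < x) (at_right a)" by (simp add: eventually_at_right_less)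
  ultimately show "eventually (\<lambda>x. dist (joint_cdf \<zeta> x) (joint_cdf \<zeta> a) < e) (at_right a)"
  proof eventually_elim
    case (elim x)
    have "?G x = ?G a" by (rule measure_state_dist_cong) (use elim in force)
    then show ?case using C(2)[of N x] C(2)[of N a] N by (simp add: dist_real_def abs_if split: if_splits)
  qed
qed

definition slice :: "'z \<Rightarrow> real measure" where
  "slice \<zeta> = interval_measure (joint_cdf \<zeta>)"

lemma joint_cdf_at_bot: "(joint_cdf \<zeta> \<longlongrightarrow> 0) at_bot"
  by (rule tendsto_eventually) (auto simp: eventually_at_bot_linorder intro!: exI[of _ "lo - 1"] joint_cdf_below)

lemma joint_cdf_at_top: "(joint_cdf \<zeta> \<longlongrightarrow> joint_cdf \<zeta> hi) at_top"
  by (rule tendsto_eventually) (auto simp: eventually_at_top_linorder intro!: exI[of _ hi] joint_cdf_above)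

lemma
  shows finite_borel_slice: "finite_borel_measure (slice \<zeta>)"
    and emeasure_slice_UNIV: "emeasure (slice \<zeta>) UNIV = joint_cdf \<zeta> hi"
    and measure_slice_atMost: "measure (slice \<zeta>) {..x} = joint_cdf \<zeta> x"
  unfolding slice_def
  using finite_borel_measure_interval_measure[OF joint_cdf_mono joint_cdf_right_continuous joint_cdf_at_bot joint_cdf_at_top joint_cdf_nonneg]
    interval_measure_UNIV[OF joint_cdf_mono joint_cdf_right_continuous joint_cdf_at_bot joint_cdf_at_top joint_cdf_nonneg]
    cdf_interval_measure[OF joint_cdf_mono joint_cdf_right_continuous joint_cdf_at_bot]
  by (auto simp: cdf_def fun_eq_iff)

lemma sets_slice[simp, measurable_cong]: "sets (slice \<zeta>) = sets borel" and space_slice[simp]: "space (slice \<zeta>) = UNIV"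
  by (simp_all add: slice_def)

text \<open>
  A closed lower set is empty, everything, or a half-line, and all three are covered by the convergence
  of distribution functions. For general sets the limit and the measure need not agree.
\<close>

lemma slice_lim:
  assumes z: "z \<in> Z" and S: "closed S" "\<And>x y. y \<in> S \<Longrightarrow> x \<le> y \<Longrightarrow> x \<in> S"
  shows "(\<lambda>t. measure (state_dist hi z t) (S \<times> {\<zeta>})) \<longlonglongrightarrow> measure (slice \<zeta>) S"
proof -
  consider "S = {}" | "S = UNIV" | y where "S = {..y}"
  proof (cases "S = {} \<or> S = UNIV")
    case False
    then obtain u where u: "u \<notin> S" by auto
    have bdd: "bdd_above S" using u S(2) by (metis bdd_above_def linorder_le_cases)
    have "Sup S \<in> S" using closed_contains_Sup[OF _ bdd S(1)] False by blast
    then have "S = {..Sup S}" using S(2) bdd by (auto intro: cSup_upper)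
    then show ?thesis using that(3) by blast
  qed (use that in auto)
  then show ?thesis
  proof cases
    case 2
    have "measure (state_dist hi z t) (S \<times> {\<zeta>}) = measure (state_dist hi z t) ({..hi} \<times> {\<zeta>})" for t
      using state_dist_hi[OF z, of t] 2 by (intro measure_state_dist_cong) force
    then show ?thesis using joint_cdf_lim[OF hi_pos z, of hi \<zeta>] emeasure_slice_UNIV[of \<zeta>] 2
      by (simp add: measure_def joint_cdf_nonneg)
  qed (auto simp: measure_slice_atMost joint_cdf_lim[OF hi_pos z])
qed

text \<open>
  A continuous extension to all reals of the policy on \<open>[lo, \<infinity>)\<close>, which contains all states relevant to
  the limit.
\<close>

definition capped :: "'z \<Rightarrow> real \<Rightarrow> real" where "capped z k = g (max lo k) z"

lemma continuous_capped: "z \<in> Z \<Longrightarrow> continuous_on UNIV (capped z)"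
  unfolding capped_def
  by (rule continuous_on_compose2[OF g_cont, where f = "\<lambda>k. max lo k"]) (use lo_pos in \<open>auto intro!: continuous_intros\<close>)

lemma capped_measurable: "z \<in> Z \<Longrightarrow> capped z \<in> borel_measurable borel"
  by (intro borel_measurable_continuous_onI continuous_capped)

lemma capped_ge: "z \<in> Z \<Longrightarrow> lo \<le> capped z k"
  using g_mono[of z lo "max lo k"] lo_floor[of z] lo_pos by (auto simp: capped_def)

text \<open>
  Pass to the limit in \<open>measure_state_dist_Suc\<close>: preimages of half-lines under the policy are closed
  lower sets, so \<open>slice_lim\<close> applies to both sides.
\<close>

lemma slice_invariant:
  assumes \<zeta>: "\<zeta> \<in> Z" and A: "A \<in> sets borel"
  shows "measure (slice \<zeta>) A = (\<Sum>z\<in>Z. pmf (p z) \<zeta> * measure (slice z) (capped z -` A))"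
proof -
  have sp: "(capped z \<in> measurable (slice z) borel)" if "z \<in> Z" for z
    using capped_measurable[OF that] by (simp cong: measurable_cong_sets)
  have m: "measure (distr (slice z) borel (capped z)) A = measure (slice z) (capped z -` A)"
    if "z \<in> Z" "A \<in> sets borel" for z A
    using measure_distr[OF sp[OF that(1)] that(2)] by simp
  have fin: "finite_borel_measure (distr (slice z) borel (capped z))" if "z \<in> Z" for z
    using finite_measure.finite_measure_distr[OF _ sp[OF that]] finite_borel_slice[of z]
    by (auto simp: finite_borel_measure_def finite_borel_measure_axioms_def)
  have "measure (slice \<zeta>) A = (\<Sum>z\<in>Z. pmf (p z) \<zeta> * measure (distr (slice z) borel (capped z)) A)"
  proof (rule measure_combination_eqI[OF finite_borel_slice fin _ A])
    fix x
    obtain z0 where z0: "z0 \<in> Z" using Z_nonempty by blast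
    have S: "closed (capped z -` {..x})" "\<And>a b. b \<in> capped z -` {..x} \<Longrightarrow> a \<le> b \<Longrightarrow> a \<in> capped z -` {..x}"
      if "z \<in> Z" for z
    proof -
      show "closed (capped z -` {..x})"
        by (rule closed_vimage[OF closed_atMost continuous_capped[OF that]])
      fix a b assume b: "b \<in> capped z -` {..x}" "a \<le> b"
      have "capped z a \<le> capped z b" unfolding capped_def
        by (rule g_mono[OF that]) (use b lo_pos in auto)
      then show "a \<in> capped z -` {..x}" using b by auto
    qed
    have "measure (state_dist hi z0 (Suc t)) ({..x} \<times> {\<zeta>}) =
       (\<Sum>z\<in>Z. pmf (p z) \<zeta> * measure (state_dist hi z0 t) ((capped z -` {..x}) \<times> {z}))" for t
      unfolding measure_state_dist_Suc[OF hi_pos z0]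
      by (intro sum.cong refl arg_cong2[where f = "(*)"] measure_state_dist_cong)
        (use state_dist_hi[OF z0, of t] in \<open>auto simp: capped_def max_def\<close>)
    moreover have "(\<lambda>t. \<Sum>z\<in>Z. pmf (p z) \<zeta> * measure (state_dist hi z0 t) ((capped z -` {..x}) \<times> {z}))
       \<longlonglongrightarrow> (\<Sum>z\<in>Z. pmf (p z) \<zeta> * measure (slice z) (capped z -` {..x}))"
      by (intro tendsto_sum tendsto_mult tendsto_const) (rule slice_lim[OF z0 S(1) S(2)])
    moreover have "(\<lambda>t. measure (state_dist hi z0 (Suc t)) ({..x} \<times> {\<zeta>})) \<longlonglongrightarrow> joint_cdf \<zeta> x"
      by (rule LIMSEQ_Suc[OF joint_cdf_lim[OF hi_pos z0]])
    ultimately have "joint_cdf \<zeta> x = (\<Sum>z\<in>Z. pmf (p z) \<zeta> * measure (slice z) (capped z -` {..x}))"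
      by (simp add: LIMSEQ_unique)
    then show "measure (slice \<zeta>) {..x} = (\<Sum>z\<in>Z. pmf (p z) \<zeta> * measure (distr (slice z) borel (capped z)) {..x})"
      by (simp add: m measure_slice_atMost)
  qed
  then show ?thesis using A by (simp add: m)
qed

section \<open>The stationary distribution\<close>

text \<open>
  Binding over the counting measure adds up the slices, whose total masses sum to one. The map
  \<open>max lo\<close> leaves \<open>[lo, hi]\<close>, where the slices are concentrated, unchanged and makes all stocks
  positive, as the state space demands.
\<close>

definition invariant_dist :: "(real \<times> 'z) measure" where
  "invariant_dist = count_space Z \<bind> (\<lambda>\<zeta>. distr (slice \<zeta>) state_space (\<lambda>k. (max lo k, \<zeta>)))"

lemma embed_measurable:
  assumes "\<zeta> \<in> Z"
  shows "(\<lambda>k. (max lo k, \<zeta>)) \<in> measurable (slice \<zeta>) state_space"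
proof (rule measurable_Pair)
  show "(\<lambda>k. max lo k) \<in> measurable (slice \<zeta>) (restrict_space borel {0<..})"
    using lo_pos by (intro measurable_restrict_space2) auto
qed (use assms in auto)

lemma invariant_dist_kernel:
  "(\<lambda>\<zeta>. distr (slice \<zeta>) state_space (\<lambda>k. (max lo k, \<zeta>))) \<in> measurable (count_space Z) (subprob_algebra state_space)"
proof -
  have "subprob_space (distr (slice \<zeta>) state_space (\<lambda>k. (max lo k, \<zeta>)))" if "\<zeta> \<in> Z" for \<zeta>
  proof -
    have "joint_cdf \<zeta> hi \<le> (\<Sum>\<zeta>\<in>Z. joint_cdf \<zeta> hi)"
      by (rule member_le_sum[OF that]) (auto simp: joint_cdf_nonneg finite_Z)
    then have "subprob_space (slice \<zeta>)"
      by (intro subprob_spaceI) (auto simp: emeasure_slice_UNIV joint_cdf_sum)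
    then show ?thesis
      using that by (intro subprob_space.subprob_space_distr embed_measurable) (auto simp: space_pair_measure space_restrict_space Z_nonempty intro: exI[of _ 1])
  qed
  then show ?thesis by (auto simp: space_subprob_algebra)
qed

lemma sets_invariant_dist: "sets invariant_dist = sets state_space"
  unfolding invariant_dist_def by (rule sets_bind) (auto simp: Z_nonempty)

lemma emeasure_invariant_dist:
  assumes "X \<in> sets state_space"
  shows "emeasure invariant_dist X = (\<Sum>\<zeta>\<in>Z. emeasure (slice \<zeta>) {k. (max lo k, \<zeta>) \<in> X})"
proof -
  have "emeasure invariant_dist X = (\<integral>\<^sup>+\<zeta>. emeasure (distr (slice \<zeta>) state_space (\<lambda>k. (max lo k, \<zeta>))) X \<partial>count_space Z)"
    unfolding invariant_dist_def
    by (rule emeasure_bind[OF _ invariant_dist_kernel assms]) (simp add: Z_nonempty)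
  also have "\<dots> = (\<Sum>\<zeta>\<in>Z. emeasure (distr (slice \<zeta>) state_space (\<lambda>k. (max lo k, \<zeta>))) X)"
    by (rule nn_integral_count_space_finite[OF finite_Z])
  also have "\<dots> = (\<Sum>\<zeta>\<in>Z. emeasure (slice \<zeta>) {k. (max lo k, \<zeta>) \<in> X})"
    by (intro sum.cong refl) (simp add: emeasure_distr[OF embed_measurable assms] vimage_def)
  finally show ?thesis .
qed

lemma rectangle_sets:
  assumes "A \<in> sets borel" "A \<subseteq> {0<..}" "\<zeta> \<in> Z"
  shows "A \<times> {\<zeta>} \<in> sets state_space"
  using assms by (intro pair_measureI) (auto simp: sets_restrict_space_iff)

lemma measure_invariant_dist:
  assumes "A \<in> sets borel" "A \<subseteq> {0<..}" "\<zeta> \<in> Z"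
  shows "measure invariant_dist (A \<times> {\<zeta>}) = measure (slice \<zeta>) {k. max lo k \<in> A}"
proof -
  have "emeasure invariant_dist (A \<times> {\<zeta>}) = (\<Sum>\<zeta>'\<in>Z. if \<zeta>' = \<zeta> then emeasure (slice \<zeta>) {k. max lo k \<in> A} else 0)"
    unfolding emeasure_invariant_dist[OF rectangle_sets[OF assms]] by (intro sum.cong refl) auto
  then show ?thesis using assms finite_Z by (simp add: measure_def)
qed

lemma prob_space_invariant_dist: "prob_space invariant_dist"
proof
  have sp: "space invariant_dist = space state_space"
    by (rule sets_eq_imp_space_eq[OF sets_invariant_dist])
  have "emeasure invariant_dist (space state_space) = (\<Sum>\<zeta>\<in>Z. emeasure (slice \<zeta>) UNIV)"
    unfolding emeasure_invariant_dist[OF sets.top] using lo_pos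
    by (intro sum.cong refl arg_cong2[where f = emeasure]) (auto simp: space_pair_measure space_restrict_space)
  also have "\<dots> = ennreal (\<Sum>\<zeta>\<in>Z. joint_cdf \<zeta> hi)"
    by (simp add: emeasure_slice_UNIV joint_cdf_nonneg)
  finally show "emeasure invariant_dist (space invariant_dist) = 1" by (simp add: sp joint_cdf_sum)
qed

lemma preimage_borel:
  assumes "z \<in> Z" "A \<in> sets borel"
  shows "{k. 0 < k \<and> g k z \<in> A} \<in> sets borel"
proof -
  have "(\<lambda>k. g k z) \<in> borel_measurable (restrict_space borel {0<..})"
    by (rule borel_measurable_continuous_on_restrict[OF g_cont[OF assms(1)]])
  from measurable_sets[OF this assms(2)] have "(\<lambda>k. g k z) -` A \<inter> {0<..} \<in> sets (restrict_space borel {0<..})"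
    by (simp add: space_restrict_space)
  then have "(\<lambda>k. g k z) -` A \<inter> {0<..} \<in> sets borel"
    by (simp add: sets_restrict_space_iff)
  also have "(\<lambda>k. g k z) -` A \<inter> {0<..} = {k. 0 < k \<and> g k z \<in> A}" by auto
  finally show ?thesis .
qed

lemma transition_integral:
  assumes "prob_space \<mu>" and sets: "sets \<mu> = sets state_space" and A: "A \<in> sets borel"
  shows "(\<integral>(k, z). indicator A (g k z) * pmf (p z) \<zeta> \<partial>\<mu>) =
     (\<Sum>z\<in>Z. pmf (p z) \<zeta> * measure \<mu> ({k. 0 < k \<and> g k z \<in> A} \<times> {z}))"
proof -
  interpret prob_space \<mu> by fact
  have sp: "space \<mu> = {0<..} \<times> Z"
    using sets_eq_imp_space_eq[OF sets] by (simp add: space_pair_measure space_restrict_space)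
  have ms: "{k. 0 < k \<and> g k z \<in> A} \<times> {z} \<in> sets \<mu>" if "z \<in> Z" for z
    unfolding sets by (rule rectangle_sets) (use preimage_borel[OF that A] that in auto)
  have "(\<integral>(k, z). indicator A (g k z) * pmf (p z) \<zeta> \<partial>\<mu>) =
     (\<integral>x. (\<Sum>z\<in>Z. pmf (p z) \<zeta> * indicator ({k. 0 < k \<and> g k z \<in> A} \<times> {z}) x) \<partial>\<mu>)"
  proof (rule Bochner_Integration.integral_cong[OF refl])
    fix x assume "x \<in> space \<mu>"
    then obtain k y where x: "x = (k, y)" "0 < k" "y \<in> Z" using sp by auto
    have "(\<Sum>z\<in>Z. pmf (p z) \<zeta> * indicator ({k. 0 < k \<and> g k z \<in> A} \<times> {z}) x)
       = (\<Sum>z\<in>Z. if z = y then indicator A (g k y) * pmf (p y) \<zeta> else 0)"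
      by (rule sum.cong) (use x in \<open>auto simp: indicator_def\<close>)
    then show "(case x of (k, z) \<Rightarrow> indicator A (g k z) * pmf (p z) \<zeta>) =
      (\<Sum>z\<in>Z. pmf (p z) \<zeta> * indicator ({k. 0 < k \<and> g k z \<in> A} \<times> {z}) x)"
      using x finite_Z by simp
  qed
  also have "\<dots> = (\<Sum>z\<in>Z. pmf (p z) \<zeta> * measure \<mu> ({k. 0 < k \<and> g k z \<in> A} \<times> {z}))"
    using ms by (subst Bochner_Integration.integral_sum)
      (auto intro!: integrable_real_mult_indicator simp: emeasure_eq_measure)
  finally show ?thesis .
qed

lemma invariant_state_distribution_invariant_dist: "invariant_state_distribution Z p g invariant_dist"
  unfolding invariant_state_distribution_def
proof (intro conjI allI ballI impI prob_space_invariant_dist sets_invariant_dist)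
  fix A :: "real set" and \<zeta> assume A: "A \<in> sets borel" "A \<subseteq> {0<..}" and \<zeta>: "\<zeta> \<in> Z"
  have A': "{k. max lo k \<in> A} \<in> sets borel"
    using measurable_sets[of "\<lambda>k. max lo k" borel borel A] A by (simp add: vimage_def)
  have "measure invariant_dist (A \<times> {\<zeta>}) = (\<Sum>z\<in>Z. pmf (p z) \<zeta> * measure (slice z) (capped z -` {k. max lo k \<in> A}))"
    unfolding measure_invariant_dist[OF A \<zeta>] by (rule slice_invariant[OF \<zeta> A'])
  also have "\<dots> = (\<Sum>z\<in>Z. pmf (p z) \<zeta> * measure (slice z) {k. max lo k \<in> {k. 0 < k \<and> g k z \<in> A}})"
  proof (intro sum.cong refl arg_cong2[where f = "(*)"] arg_cong2[where f = measure])
    fix z assume "z \<in> Z"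
    then show "capped z -` {k. max lo k \<in> A} = {k. max lo k \<in> {k. 0 < k \<and> g k z \<in> A}}"
      using capped_ge[of z] lo_pos by (auto simp: max_absorb2 capped_def less_max_iff_disj)
  qed
  also have "\<dots> = (\<Sum>z\<in>Z. pmf (p z) \<zeta> * measure invariant_dist ({k. 0 < k \<and> g k z \<in> A} \<times> {z}))"
    by (intro sum.cong refl arg_cong2[where f = "(*)"] measure_invariant_dist[symmetric] preimage_borel A) auto
  also have "\<dots> = (\<integral>(k, z). indicator A (g k z) * pmf (p z) \<zeta> \<partial>invariant_dist)"
    by (rule transition_integral[symmetric, OF prob_space_invariant_dist sets_invariant_dist A(1)])
  finally show "measure invariant_dist (A \<times> {\<zeta>}) = (\<integral>(k, z). indicator A (g k z) * pmf (p z) \<zeta> \<partial>invariant_dist)" .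
qed

context
  fixes \<mu> assumes \<mu>: "invariant_state_distribution Z p g \<mu>"
begin

interpretation \<mu>: prob_space \<mu>
  using \<mu> by (simp add: invariant_state_distribution_def)

lemma sets_\<mu>: "sets \<mu> = sets state_space" and space_\<mu>: "space \<mu> = {0<..} \<times> Z"
proof -
  show s: "sets \<mu> = sets state_space" using \<mu> by (simp add: invariant_state_distribution_def)
  show "space \<mu> = {0<..} \<times> Z"
    using sets_eq_imp_space_eq[OF s] by (simp add: space_pair_measure space_restrict_space)
qed

lemma invariance_sum:
  assumes "A \<in> sets borel" "A \<subseteq> {0<..}" "\<zeta> \<in> Z"
  shows "measure \<mu> (A \<times> {\<zeta>}) = (\<Sum>z\<in>Z. pmf (p z) \<zeta> * measure \<mu> ({k. 0 < k \<and> g k z \<in> A} \<times> {z}))"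
  using \<mu> assms transition_integral[OF \<mu>.prob_space_axioms sets_\<mu> assms(1)]
  by (simp add: invariant_state_distribution_def)

text \<open>
  One-step invariance propagates to \<open>t\<close> steps by splitting off the last step.
\<close>

lemma invariance_iterate:
  assumes "A \<in> sets borel" "A \<subseteq> {0<..}" "\<zeta> \<in> Z"
  shows "integrable \<mu> (\<lambda>(k, z). measure (state_dist k z t) (A \<times> {\<zeta>})) \<and>
    measure \<mu> (A \<times> {\<zeta>}) = (\<integral>(k, z). measure (state_dist k z t) (A \<times> {\<zeta>}) \<partial>\<mu>)"
  using assms
proof (induction t arbitrary: A \<zeta>)
  case 0
  have "(\<lambda>(k, z). measure (state_dist k z 0) (A \<times> {\<zeta>})) = (\<lambda>x. indicator (A \<times> {\<zeta>}) x)"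
    by (auto simp: state_dist_0 measure_return_pmf fun_eq_iff)
  moreover have "A \<times> {\<zeta>} \<in> sets \<mu>" using rectangle_sets[OF 0] by (simp add: sets_\<mu>)
  ultimately show ?case by (simp add: \<mu>.emeasure_eq_measure)
next
  case (Suc t)
  let ?P = "\<lambda>z. {k. 0 < k \<and> g k z \<in> A}"
  have IH: "integrable \<mu> (\<lambda>x. case x of (k, z') \<Rightarrow> measure (state_dist k z' t) (?P z \<times> {z}))"
    "measure \<mu> (?P z \<times> {z}) = (\<integral>x. (case x of (k, z') \<Rightarrow> measure (state_dist k z' t) (?P z \<times> {z})) \<partial>\<mu>)"
    if "z \<in> Z" for z
    using Suc.IH[of "?P z" z] preimage_borel[OF that Suc.prems(1)] that by auto
  have eq: "(case x of (k, z) \<Rightarrow> measure (state_dist k z (Suc t)) (A \<times> {\<zeta>})) =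
     (\<Sum>z\<in>Z. pmf (p z) \<zeta> * (case x of (k, z') \<Rightarrow> measure (state_dist k z' t) (?P z \<times> {z})))"
    if "x \<in> space \<mu>" for x
  proof -
    obtain k y where x: "x = (k, y)" "0 < k" "y \<in> Z" using \<open>x \<in> space \<mu>\<close> space_\<mu> by auto
    have "measure (state_dist k y t) ({k. g k z \<in> A} \<times> {z}) = measure (state_dist k y t) (?P z \<times> {z})" for z
      by (rule measure_state_dist_cong) (use state_dist_Z[OF x(2,3), of t] in auto)
    then show ?thesis using x by (simp add: measure_state_dist_Suc)
  qed
  have int: "integrable \<mu> (\<lambda>x. \<Sum>z\<in>Z. pmf (p z) \<zeta> * (case x of (k, z') \<Rightarrow> measure (state_dist k z' t) (?P z \<times> {z})))"
    by (intro Bochner_Integration.integrable_sum integrable_mult_right IH)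
  have "integrable \<mu> (\<lambda>(k, z). measure (state_dist k z (Suc t)) (A \<times> {\<zeta>}))"
    by (rule Bochner_Integration.integrable_cong[OF refl eq, THEN iffD2, OF _ int])
  moreover have "measure \<mu> (A \<times> {\<zeta>}) = (\<integral>(k, z). measure (state_dist k z (Suc t)) (A \<times> {\<zeta>}) \<partial>\<mu>)"
  proof -
    have "(\<integral>(k, z). measure (state_dist k z (Suc t)) (A \<times> {\<zeta>}) \<partial>\<mu>) =
      (\<integral>x. (\<Sum>z\<in>Z. pmf (p z) \<zeta> * (case x of (k, z') \<Rightarrow> measure (state_dist k z' t) (?P z \<times> {z}))) \<partial>\<mu>)"
      by (rule Bochner_Integration.integral_cong[OF refl eq])
    also have "\<dots> = (\<Sum>z\<in>Z. pmf (p z) \<zeta> * measure \<mu> (?P z \<times> {z}))"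
      using IH by (subst Bochner_Integration.integral_sum) auto
    also have "\<dots> = measure \<mu> (A \<times> {\<zeta>})"
      by (rule invariance_sum[symmetric, OF Suc.prems])
    finally show ?thesis ..
  qed
  ultimately show ?case ..
qed

text \<open>
  Let \<open>t\<close> tend to infinity under the integral in \<open>invariance_iterate\<close>: the integrand converges to a
  constant from every initial state.
\<close>

lemma invariant_joint_cdf:
  assumes \<zeta>: "\<zeta> \<in> Z"
  shows "measure \<mu> ({0<..x} \<times> {\<zeta>}) = joint_cdf \<zeta> x"
proof (rule LIMSEQ_unique)
  let ?f = "\<lambda>t x'. case x' of (k, z) \<Rightarrow> measure (state_dist k z t) ({0<..x} \<times> {\<zeta>})"
  have it: "integrable \<mu> (?f t)" "measure \<mu> ({0<..x} \<times> {\<zeta>}) = (\<integral>x. ?f t x \<partial>\<mu>)" for t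
    using invariance_iterate[OF _ _ \<zeta>, of "{0<..x}" t] by (simp_all add: subset_iff)
  show "(\<lambda>t. \<integral>x. ?f t x \<partial>\<mu>) \<longlonglongrightarrow> measure \<mu> ({0<..x} \<times> {\<zeta>})"
    unfolding it(2)[symmetric] by (rule tendsto_const)
  have "(\<lambda>t. \<integral>x. ?f t x \<partial>\<mu>) \<longlonglongrightarrow> (\<integral>_. joint_cdf \<zeta> x \<partial>\<mu>)"
  proof (rule integral_dominated_convergence[where w = "\<lambda>_. 1"])
    show "?f t \<in> borel_measurable \<mu>" for t using it(1) by (rule borel_measurable_integrable)
    show "AE x' in \<mu>. (\<lambda>t. ?f t x') \<longlonglongrightarrow> joint_cdf \<zeta> x"
    proof (rule AE_I2)
      fix x' assume "x' \<in> space \<mu>"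
      then obtain k y where x': "x' = (k, y)" "0 < k" "y \<in> Z" using space_\<mu> by auto
      have "measure (state_dist k y t) ({0<..x} \<times> {\<zeta>}) = measure (state_dist k y t) ({..x} \<times> {\<zeta>})" for t
        by (rule measure_state_dist_cong) (use state_dist_Z[OF x'(2,3), of t] in auto)
      then show "(\<lambda>t. ?f t x') \<longlonglongrightarrow> joint_cdf \<zeta> x"
        using joint_cdf_lim[OF x'(2,3)] x' by simp
    qed
  qed auto
  then show "(\<lambda>t. \<integral>x. ?f t x \<partial>\<mu>) \<longlonglongrightarrow> joint_cdf \<zeta> x" by (simp add: \<mu>.prob_space)
qed

lemma fst_measurable: "fst \<in> measurable \<mu> borel"
proof -
  have "fst \<in> measurable state_space (restrict_space borel {0<..})" by simp
  then have "fst \<in> measurable state_space (borel :: real measure)"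
    by (simp add: measurable_restrict_space2_iff)
  then show ?thesis by (simp add: measurable_cong_sets[OF sets_\<mu> refl])
qed

lemma real_distribution_marginal: "real_distribution (distr \<mu> borel fst)"
  by (rule \<mu>.real_distribution_distr[OF fst_measurable])

lemma measure_marginal:
  assumes "A \<in> sets borel"
  shows "measure (distr \<mu> borel fst) A = (\<Sum>\<zeta>\<in>Z. measure \<mu> ((A \<inter> {0<..}) \<times> {\<zeta>}))"
proof -
  have "measure (distr \<mu> borel fst) A = measure \<mu> (fst -` A \<inter> space \<mu>)"
    by (rule measure_distr[OF fst_measurable assms])
  also have "fst -` A \<inter> space \<mu> = (\<Union>\<zeta>\<in>Z. (A \<inter> {0<..}) \<times> {\<zeta>})"
    by (auto simp: space_\<mu>)
  also have "measure \<mu> \<dots> = (\<Sum>\<zeta>\<in>Z. measure \<mu> ((A \<inter> {0<..}) \<times> {\<zeta>}))"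
    using finite_Z assms rectangle_sets by (intro \<mu>.finite_measure_finite_Union) (auto simp: sets_\<mu> disjoint_family_on_def)
  finally show ?thesis .
qed

lemma cdf_marginal: "cdf (distr \<mu> borel fst) x = (\<Sum>\<zeta>\<in>Z. joint_cdf \<zeta> x)"
proof -
  have "{..x} \<inter> {0<..} = {0<..x}" by auto
  then show ?thesis by (simp add: cdf_def measure_marginal invariant_joint_cdf)
qed

text \<open>
  If all capital sat at \<open>x\<close>, invariance would move away the mass carried by any shock \<open>z\<close> with
  \<open>g x z \<noteq> x\<close>. Such a shock exists, and every shock carries mass because all transition probabilities
  are positive.
\<close>

lemma marginal_nondegenerate: "\<not> degenerate_distribution (distr \<mu> borel fst)"
proof
  assume "degenerate_distribution (distr \<mu> borel fst)"
  then obtain x where x: "distr \<mu> borel fst = return borel x"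
    by (auto simp: degenerate_distribution_def)
  have conc: "(\<Sum>\<zeta>\<in>Z. measure \<mu> ((A \<inter> {0<..}) \<times> {\<zeta>})) = indicator A x" if "A \<in> sets borel" for A
    using measure_marginal[OF that] that by (simp add: x measure_return)
  have xpos: "0 < x"
  proof (rule ccontr)
    assume "\<not> 0 < x"
    then have "{x} \<inter> {0<..} = {}" by auto
    then show False using conc[of "{x}"] by simp
  qed
  then have xi: "{x} \<inter> {0<..} = {x}" by auto
  define q where "q \<zeta> = measure \<mu> ({x} \<times> {\<zeta>})" for \<zeta>
  have q_sum: "(\<Sum>\<zeta>\<in>Z. q \<zeta>) = 1" using conc[of "{x}"] by (simp add: q_def xi)
  have null: "measure \<mu> (S \<times> {z}) = 0" if S: "S \<in> sets borel" "S \<subseteq> {0<..}" "x \<notin> S" and z: "z \<in> Z" for S z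
  proof -
    have "S \<inter> {0<..} = S" using S by auto
    then have "(\<Sum>\<zeta>\<in>Z. measure \<mu> (S \<times> {\<zeta>})) = 0" using conc[OF S(1)] S(3) by simp
    then show ?thesis using z finite_Z by (simp add: sum_nonneg_eq_0_iff)
  qed
  have fixed: "measure \<mu> ({k. 0 < k \<and> g k z \<in> {x}} \<times> {z}) = (if g x z = x then q z else 0)" if z: "z \<in> Z" for z
  proof (cases "g x z = x")
    case True
    let ?S = "{k. 0 < k \<and> g k z \<in> {x}}"
    have S: "?S \<in> sets borel" by (rule preimage_borel[OF z]) simp
    have "measure \<mu> (?S \<times> {z}) = measure \<mu> ({x} \<times> {z}) + measure \<mu> ((?S - {x}) \<times> {z})"
    proof (subst \<mu>.finite_measure_Union[symmetric])
      show "{x} \<times> {z} \<in> sets \<mu>" "(?S - {x}) \<times> {z} \<in> sets \<mu>"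
        unfolding sets_\<mu> by (rule rectangle_sets; use S xpos z in force)+
    qed (use xpos True in \<open>auto intro!: arg_cong2[where f = measure]\<close>)
    moreover have "measure \<mu> ((?S - {x}) \<times> {z}) = 0" by (rule null) (use S z in auto)
    ultimately show ?thesis using True by (simp add: q_def)
  next
    case False
    have "measure \<mu> ({k. 0 < k \<and> g k z \<in> {x}} \<times> {z}) = 0"
      by (rule null[OF preimage_borel]) (use z False in auto)
    then show ?thesis using False by simp
  qed
  have q_eq: "q \<zeta> = (\<Sum>z\<in>Z. pmf (p z) \<zeta> * (if g x z = x then q z else 0))" if "\<zeta> \<in> Z" for \<zeta>
  proof -
    have "q \<zeta> = (\<Sum>z\<in>Z. pmf (p z) \<zeta> * measure \<mu> ({k. 0 < k \<and> g k z \<in> {x}} \<times> {z}))"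
      unfolding q_def by (rule invariance_sum) (use xpos that in auto)
    also have "\<dots> = (\<Sum>z\<in>Z. pmf (p z) \<zeta> * (if g x z = x then q z else 0))"
      by (rule sum.cong[OF refl]) (simp only: fixed)
    finally show ?thesis .
  qed
  obtain z1 where z1: "z1 \<in> Z" "g x z1 \<noteq> x"
    using can_rise[OF xpos] can_fall[of x] lo_less_hi by (cases "x < hi") force+
  have qn: "0 \<le> q z" for z by (simp add: q_def)
  have q1: "0 < q z1"
  proof -
    have "\<exists>z\<in>Z. 0 < (if g x z = x then q z else 0)"
    proof (rule ccontr)
      assume "\<not> ?thesis"
      then have "(if g x z = x then q z else 0) = 0" if "z \<in> Z" for z
        using that qn[of z] by (metis less_eq_real_def)
      then have "q \<zeta> = 0" if "\<zeta> \<in> Z" for \<zeta> using q_eq[OF that] by simp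
      then show False using q_sum by simp
    qed
    then obtain z where z: "z \<in> Z" "0 < (if g x z = x then q z else 0)" by blast
    have "0 < pmf (p z) z1" using full_support[OF z(1)] z1 by (simp add: pmf_positive)
    then have "0 < pmf (p z) z1 * (if g x z = x then q z else 0)" using z by simp
    also have "\<dots> \<le> q z1" unfolding q_eq[OF z1(1)]
      by (rule member_le_sum[OF z(1)]) (auto simp: qn finite_Z)
    finally show ?thesis .
  qed
  have "1 = (\<Sum>\<zeta>\<in>Z. \<Sum>z\<in>Z. pmf (p z) \<zeta> * (if g x z = x then q z else 0))"
    using q_sum q_eq by simp
  also have "\<dots> = (\<Sum>z\<in>Z. \<Sum>\<zeta>\<in>Z. pmf (p z) \<zeta> * (if g x z = x then q z else 0))"
    by (rule sum.swap)
  also have "\<dots> = (\<Sum>z\<in>Z. (if g x z = x then q z else 0))"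
    using sum_pmf_eq_1[OF finite_Z] full_support by (simp flip: sum_distrib_right)
  also have "\<dots> < (\<Sum>z\<in>Z. q z)"
    by (rule sum_strict_mono_ex1) (use finite_Z qn z1 q1 in auto)
  finally show False using q_sum by simp
qed

lemma marginal_support: "measure_support (distr \<mu> borel fst) \<subseteq> {lo..hi}"
proof
  let ?\<pi> = "distr \<mu> borel fst"
  interpret \<pi>: real_distribution ?\<pi> by (rule real_distribution_marginal)
  fix x assume x: "x \<in> measure_support ?\<pi>"
  have "\<not> x < lo"
  proof
    assume l: "x < lo"
    have "measure ?\<pi> {..<(x + lo) / 2} \<le> cdf ?\<pi> ((x + lo) / 2)"
      unfolding cdf_def by (rule \<pi>.finite_measure_mono) auto
    also have "\<dots> = 0" unfolding cdf_marginal using l by (simp add: joint_cdf_below)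
    finally show False using x l by (force simp: measure_support_def dest!: spec[of _ "{..<(x + lo) / 2}"])
  qed
  moreover have "\<not> hi < x"
  proof
    assume l: "hi < x"
    have "measure ?\<pi> {hi<..} = measure ?\<pi> (space ?\<pi> - {..hi})"
      by (rule arg_cong2[where f = measure]) auto
    also have "\<dots> = 1 - cdf ?\<pi> hi" unfolding cdf_def by (rule \<pi>.prob_compl) simp
    also have "\<dots> = 0" unfolding cdf_marginal by (simp add: joint_cdf_sum)
    finally show False using x l by (force simp: measure_support_def dest!: spec[of _ "{hi<..}"])
  qed
  ultimately show "x \<in> {lo..hi}" by simp
qed

lemma marginal_limiting:
  assumes k: "0 < k" and z: "z \<in> Z"
  shows "limiting_distribution p g k z (distr \<mu> borel fst)"
  unfolding limiting_distribution_def
proof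
  let ?\<pi> = "distr \<mu> borel fst"
  show rd: "real_distribution ?\<pi>" by (rule real_distribution_marginal)
  obtain C where C: "C \<longlonglongrightarrow> 0" "\<And>\<zeta> x t. \<bar>measure (measure_pmf (state_dist k z t)) ({..x} \<times> {\<zeta>}) - joint_cdf \<zeta> x\<bar> \<le> C t"
    using joint_cdf_uniform[OF k] z by blast
  have um: "uniform_metric (measure_pmf (capital_distribution p g k z t)) ?\<pi> \<le> real (card Z) * C t" for t
    unfolding uniform_metric_def
  proof (rule cSUP_least)
    fix x
    have "cdf (measure_pmf (capital_distribution p g k z t)) x = (\<Sum>\<zeta>\<in>Z. measure (measure_pmf (state_dist k z t)) ({..x} \<times> {\<zeta>}))"
      by (simp add: cdf_def capital_distribution_eq measure_state_dist_sum[OF k z])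
    then have "\<bar>cdf (measure_pmf (capital_distribution p g k z t)) x - cdf ?\<pi> x\<bar> =
      \<bar>\<Sum>\<zeta>\<in>Z. measure (measure_pmf (state_dist k z t)) ({..x} \<times> {\<zeta>}) - joint_cdf \<zeta> x\<bar>"
      by (simp add: cdf_marginal sum_subtractf)
    also have "\<dots> \<le> (\<Sum>\<zeta>\<in>Z. C t)" by (rule order.trans[OF sum_abs sum_mono]) (rule C(2))
    finally show "\<bar>cdf (measure_pmf (capital_distribution p g k z t)) x - cdf ?\<pi> x\<bar> \<le> real (card Z) * C t" by simp
  qed simp
  have nn: "0 \<le> uniform_metric (measure_pmf (capital_distribution p g k z t)) ?\<pi>" for t
    using uniform_metric_upper[OF prob_space_measure_pmf, of ?\<pi> _ 0] rd
    by (meson abs_ge_zero order_trans real_distribution_def)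
  have "(\<lambda>t. real (card Z) * C t) \<longlonglongrightarrow> 0" using tendsto_mult_left[OF C(1), of "real (card Z)"] by simp
  then show "(\<lambda>t. uniform_metric (measure_pmf (capital_distribution p g k z t)) ?\<pi>) \<longlonglongrightarrow> 0"
    by (rule tendsto_sandwich[OF always_eventually[OF allI[OF nn]] always_eventually[OF allI[OF um]] tendsto_const])
qed

end

theorem unique_stationary_distribution:
  "\<exists>\<pi>.
      (\<forall>k0>0. \<forall>z0\<in>Z. limiting_distribution p g k0 z0 \<pi>) \<and>
      (\<forall>\<pi>' k0 z0. 0 < k0 \<and> z0 \<in> Z \<and> limiting_distribution p g k0 z0 \<pi>' \<longrightarrow> \<pi>' = \<pi>) \<and>
      stationary_distribution Z p g \<pi> \<and>
      (\<forall>\<pi>'. stationary_distribution Z p g \<pi>' \<longrightarrow> \<pi>' = \<pi>) \<and>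
      \<not> degenerate_distribution \<pi> \<and>
      measure_support \<pi> \<subseteq> {lo..hi}"
proof (intro exI conjI allI impI ballI)
  let ?\<pi> = "distr invariant_dist borel fst"
  note inv = invariant_state_distribution_invariant_dist
  show lim: "limiting_distribution p g k0 z0 ?\<pi>" if "0 < k0" "z0 \<in> Z" for k0 z0
    by (rule marginal_limiting[OF inv that])
  show "\<pi>' = ?\<pi>" if "0 < k0 \<and> z0 \<in> Z \<and> limiting_distribution p g k0 z0 \<pi>'" for \<pi>' k0 z0
    using limiting_distribution_unique[of p g k0 z0 \<pi>' ?\<pi>] lim that by blast
  show "stationary_distribution Z p g ?\<pi>"
    using inv by (auto simp: stationary_distribution_def)
  show "\<pi>' = ?\<pi>" if "stationary_distribution Z p g \<pi>'" for \<pi>'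
  proof -
    obtain \<mu> where \<mu>: "invariant_state_distribution Z p g \<mu>" "\<pi>' = distr \<mu> borel fst"
      using \<open>stationary_distribution Z p g \<pi>'\<close> by (auto simp: stationary_distribution_def)
    show ?thesis unfolding \<mu>(2)
      by (rule cdf_unique[OF real_distribution_marginal[OF \<mu>(1)] real_distribution_marginal[OF inv]])
        (simp add: fun_eq_iff cdf_marginal[OF \<mu>(1)] cdf_marginal[OF inv])
  qed
  show "\<not> degenerate_distribution ?\<pi>" by (rule marginal_nondegenerate[OF inv])
  show "measure_support ?\<pi> \<subseteq> {lo..hi}" by (rule marginal_support[OF inv])
qed

end

section \<open>Convergence to the stationary distribution\<close>

text \<open>
  The largest point of \<open>(0, k'']\<close> at which capital weakly rises under all shocks is a fixed point of
  the lower envelope, hence is \<open>k'\<close>; it differs from \<open>k''\<close> because equality would be a degenerate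
  equilibrium. Above \<open>k'\<close> capital can fall: up to \<open>k''\<close> by maximality, beyond \<open>k''\<close> by \<open>no_crossing\<close>.
\<close>

lemma growth_model_mixing:
  assumes model: "growth_model \<beta> Z p u f"
    and policy: "optimal_policy \<beta> Z p u f g"
    and nondeg: "\<not> (\<exists>k>0. \<forall>z\<in>Z. g k z = k)"
  shows "mixing_policy Z p g (k_lower Z g) (k_upper Z g)"
proof -
  interpret growth_policy \<beta> Z p u f g
    using model policy by (simp add: growth_policy_def growth_policy_axioms_def)
  have up_le: "upper_envelope Z g k \<le> k \<longleftrightarrow> (\<forall>z\<in>Z. g k z \<le> k)" for k
    using shocks(1) Z_nonempty by (simp add: upper_envelope_def)
  have low_eq: "lower_envelope Z g k = k \<longleftrightarrow> (\<forall>z\<in>Z. k \<le> g k z) \<and> (\<exists>z\<in>Z. g k z = k)" for k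
    using shocks(1) Z_nonempty unfolding lower_envelope_def
    by (subst Min_eq_iff) (auto simp: image_iff eq_commute)
  obtain m where m: "0 < m" "\<And>k z. 0 < k \<Longrightarrow> k \<le> m \<Longrightarrow> z \<in> Z \<Longrightarrow> k < g k z"
    using growth_near_zero by blast
  obtain z0 where z0: "z0 \<in> Z" using Z_nonempty by blast
  have ceiling: "\<exists>M\<ge>k. \<forall>z\<in>Z. g M z \<le> M" if "0 < k" for k
  proof -
    obtain M where M: "M \<ge> k" "0 < M" "\<forall>z\<in>Z. f M z < M" using capacity by blast
    then show ?thesis using g_range[of M] by (intro exI[of _ M]) (fastforce)
  qed
  let ?S = "{k. 0 < k \<and> upper_envelope Z g k \<le> k}"
  let ?hi = "k_upper Z g" and ?lo = "k_lower Z g"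
  have S_eq: "?S = {k\<in>{m..}. \<forall>z\<in>Z. g k z \<le> k}"
    using m z0 unfolding up_le by (auto simp: not_le intro: less_imp_le) (meson leD linear)
  have closed_le: "closed {k\<in>I. \<forall>z\<in>Z. g k z \<le> k}" "closed {k\<in>I. \<forall>z\<in>Z. k \<le> g k z}"
    if I: "closed I" "I \<subseteq> {0<..}" for I
  proof -
    have c: "continuous_on I (\<lambda>k. g k z)" if "z \<in> Z" for z
      by (rule continuous_on_subset[OF g_cont[OF that] I(2)])
    have "{k\<in>I. \<forall>z\<in>Z. g k z \<le> k} = (\<Inter>z\<in>Z. {k\<in>I. g k z \<le> k})"
      "{k\<in>I. \<forall>z\<in>Z. k \<le> g k z} = (\<Inter>z\<in>Z. {k\<in>I. k \<le> g k z})" using z0 by auto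
    then show "closed {k\<in>I. \<forall>z\<in>Z. g k z \<le> k}" "closed {k\<in>I. \<forall>z\<in>Z. k \<le> g k z}"
      using I(1) c by (auto intro!: closed_INT continuous_on_closed_Collect_le continuous_on_id)
  qed
  have "closed ?S" unfolding S_eq by (rule closed_le) (use m in auto)
  moreover have "?S \<noteq> {}"
  proof -
    obtain M where M: "M \<ge> 1" "\<forall>z\<in>Z. g M z \<le> M" using ceiling[of 1] by auto
    then have "M \<in> ?S" by (simp add: up_le)
    then show ?thesis by blast
  qed
  moreover have bddS: "bdd_below ?S" by (rule bdd_belowI[of _ 0]) auto
  ultimately have hiS: "?hi \<in> ?S" unfolding k_upper_def by (intro closed_contains_Inf)
  then have hi: "0 < ?hi" "\<And>z. z \<in> Z \<Longrightarrow> g ?hi z \<le> ?hi" by (auto simp: up_le)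
  have rise: "\<exists>z\<in>Z. k < g k z" if "0 < k" "k < ?hi" for k
  proof (rule ccontr)
    assume "\<not> ?thesis"
    then have "k \<in> ?S" using that by (auto simp: up_le not_less)
    then have "?hi \<le> k" unfolding k_upper_def by (rule cInf_lower[OF _ bddS])
    then show False using that by simp
  qed
  have m_hi: "m < ?hi" using m(2)[OF hi(1) _ z0] hi(2)[OF z0] by force
  let ?L = "{k\<in>{m..?hi}. \<forall>z\<in>Z. k \<le> g k z}"
  have mL: "m \<in> ?L" using m m_hi by (auto intro: less_imp_le)
  define s where "s = Sup ?L"
  have bddL: "bdd_above ?L" by (rule bdd_aboveI[of _ ?hi]) auto
  have "closed ?L" by (rule closed_le) (use m in auto)
  then have sL: "s \<in> ?L" unfolding s_def using mL bddL by (intro closed_contains_Sup) auto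
  have sub: "k \<le> s" if "k \<in> ?L" for k unfolding s_def by (rule cSup_upper[OF that bddL])
  have s_hi: "s < ?hi"
  proof (rule ccontr)
    assume "\<not> s < ?hi"
    then have "s = ?hi" using sL by auto
    then have "\<forall>z\<in>Z. g ?hi z = ?hi" using sL hi(2) by (force intro: antisym)
    then show False using nondeg hi(1) by blast
  qed
  have fixed: "\<exists>z\<in>Z. g s z = s"
  proof (rule ccontr)
    assume "\<not> ?thesis"
    then have gt: "s < g s z" if "z \<in> Z" for z using sL that by (force simp: less_le)
    \<comment> \<open>Monotonicity lets \<open>s\<close> be increased up to the least of its images.\<close>
    define x where "x = min ?hi (Min (g s ` Z))"
    have x: "s < x" using gt s_hi shocks(1) Z_nonempty by (auto simp: x_def)
    have "x \<le> g x z" if z: "z \<in> Z" for z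
    proof -
      have "x \<le> Min (g s ` Z)" by (simp add: x_def)
      also have "\<dots> \<le> g s z" using shocks(1) z by (intro Min_le) auto
      also have "\<dots> \<le> g x z" using sL m x z by (intro g_mono) auto
      finally show ?thesis .
    qed
    moreover have "x \<in> {m..?hi}" using x sL by (auto simp: x_def)
    ultimately show False using sub[of x] x by auto
  qed
  let ?T = "{k. 0 < k \<and> k \<le> ?hi \<and> lower_envelope Z g k = k}"
  have "k \<in> ?L" if k: "k \<in> ?T" for k
  proof -
    obtain z where "z \<in> Z" "g k z = k" using k by (auto simp: low_eq)
    then have "m < k" using m(2)[of k z] k by force
    then show ?thesis using k by (auto simp: low_eq)
  qed
  moreover have "s \<in> ?T" using sL m(1) fixed by (auto simp: low_eq)
  ultimately have lo: "?lo = s" unfolding k_lower_def using sub by (intro cSup_eq_maximum) auto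
  have s_pos: "0 < s" using sL m(1) by auto
  have fall: "\<exists>z\<in>Z. g k z < k" if k: "s < k" for k
  proof (rule ccontr)
    assume "\<not> ?thesis"
    then have ge: "k \<le> g k z" if "z \<in> Z" for z using that by force
    show False
    proof (cases "k \<le> ?hi")
      case True
      then have "k \<in> ?L" using k sL ge by auto
      then show False using sub[of k] k by simp
    next
      case False
      then show False using no_crossing[OF hi(1) _ hi(2) ge] by auto
    qed
  qed
  show ?thesis
    unfolding lo
  proof
    show "\<exists>x>0. x \<le> k \<and> (\<forall>z\<in>Z. x \<le> g x z)" if "0 < k" for k
      using m that by (intro exI[of _ "min m k"]) (auto intro!: less_imp_le)
  qed (use shocks(1) transition s_pos s_hi g_mono g_cont rise fall sL hi ceiling in auto)
qed

theorem mainTheorem4: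
  fixes \<beta> :: real
    and Z :: "'z set"
    and p :: "'z \<Rightarrow> 'z pmf"
    and u :: "real \<Rightarrow> ereal"
    and f g :: "real \<Rightarrow> 'z \<Rightarrow> real"
  assumes model: "growth_model \<beta> Z p u f"
    and policy: "optimal_policy \<beta> Z p u f g"
    and no_degenerate_equilibrium: "\<not> (\<exists>k>0. \<forall>z\<in>Z. g k z = k)"
  shows "\<exists>\<pi>.
      (\<forall>k0>0. \<forall>z0\<in>Z. limiting_distribution p g k0 z0 \<pi>) \<and>
      (\<forall>\<pi>' k0 z0. 0 < k0 \<and> z0 \<in> Z \<and> limiting_distribution p g k0 z0 \<pi>' \<longrightarrow> \<pi>' = \<pi>) \<and>
      stationary_distribution Z p g \<pi> \<and>
      (\<forall>\<pi>'. stationary_distribution Z p g \<pi>' \<longrightarrow> \<pi>' = \<pi>) \<and>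
      \<not> degenerate_distribution \<pi> \<and>
      measure_support \<pi> \<subseteq> {k_lower Z g..k_upper Z g}"
proof -
  interpret mixing_policy Z p g "k_lower Z g" "k_upper Z g"
    by (rule growth_model_mixing[OF model policy no_degenerate_equilibrium])
  show ?thesis by (rule unique_stationary_distribution)
qed

end
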